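(* Let $m,n$ be coprime positive integers and let $p$ and $z$ be negative real numbers. Let $P_1$ be the large radius limit of the A-model $R$-matrix of $W\mathbb P(m,n)$ on the chart with group $\mathbb Z/m\mathbb Z$, and let $\tilde R_1$ be the corresponding $m\times m$ block of the large radius limit of the B-model $R$-matrix. It holds that $$(\tilde R_1)_\alpha^\beta=(P_1)_\beta^\alpha\qquad\text{for } 0\le\alpha,\beta\le m-1,$$ if we identify $\lambda=\frac{w_1}{z}$ and $\mu=\frac{p}{mz}$.
   Context: Notation. $W\mathbb P(m,n)=(\mathbb C^2\setminus\{(0,0)\})/\sim$ with $(z_1,z_2)\sim(\lambda^nz_1,\lambda^mz_2)$. $i_0=\sqrt{-1}$, $B_k(s)$ are the Bernoulli polynomials, and $\omega=e^{2\pi i_0\frac{\alpha-\beta}{m}}$. A-model block. The A-model $R$-matrix is the unitary formal power series $R(z)=\mathrm{id}+R_1z+\cdots$ such that $\Psi R(z)e^{U/z}$ is a fundamental solution of the quantum differential equation of $W\mathbb P(m,n)$ ($\Psi$ the base change from the normalized canonical basis to the flat basis, $U$ the diagonal matrix of canonical coordinates). At $t=0$, $q=0$ it is block diagonal with blocks $P_1,P_2$, one for each of the two torus charts. On the chart with group $\mathbb Z/m\mathbb Z$ let $w_1$ be the weight of the torus action, $w_1=\lambda_2^{n/m}\lambda_1$ when $(\lambda_1,\lambda_2)$ acts by multiplication by $\lambda_2^{n/m}\lambda_1$. By orbifold quantum Riemann–Roch, for $0\le i,j\le m-1$, $$(P_1)_j^i=\frac1m\sum_{h=0}^{m-1}e^{2\pi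 i_0\frac{h(j-i)}m}\exp\Big[\sum_{t=1}^\infty\frac{(-1)^t}{t(t+1)}B_{t+1}\Big(\frac hm\Big)\Big(\frac z{w_1}\Big)^t\Big].$$ Through the expansion $\log\Gamma(z+s)=(z+s-\frac12)\log z-z+\frac12\log2\pi+\sum_{t\ge1}\frac{(-1)^tB_{t+1}(s)}{t(t+1)}\frac1{z^t}$, this is evaluated, with $\lambda=w_1/z$, as $$(P_1)_\beta^\alpha=\frac{\sqrt{2\pi}\,e^\lambda}{m\sqrt\lambda}\sum_{h=0}^{m-1}\omega^{-h}\,\Gamma\Big(\lambda+\frac hm\Big)\lambda^{1-\lambda-\frac hm}.$$ B-model block. For $Y=e^y\in\mathbb C^*$ and parameters $\tilde q_\ell$, let, up to an additive constant (which plays no role below), $$W_T(Y)=Y^m+\sum_{\ell=1}^{m-1}\tilde q_\ell Y^\ell+\sum_{\ell=1}^n\tilde q_{-\ell}Y^{-\ell}+p\log Y.$$ Define $$\tilde R_\alpha^\beta(\tilde q)=\sqrt{-2\pi z}\int_{\gamma_\beta}e^{\frac{W_T(Y)-W_T(p^\beta)}{z}}\,\theta_\alpha,$$ where $p^\beta$ ($\beta=0,\dots,m+n-1$) are the critical points of $W_T$ with respect to $y$; $\gamma_\beta=W_T^{-1}(W_T(p^\beta)+[0,+\infty))$; and $\theta_\alpha=\frac{dz_\alpha}{z_\alpha^2}$ with $z_\alpha=c_\alpha(Y-p^\alpha)$, $c_\alpha\in\mathbb C$ such that $W_T(Y)-W_T(p^\alpha)=\frac12z_\alpha^2+o(z_\alpha^2)$.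 $(\tilde R_1)_\alpha^\beta$ is the submatrix of the first $m$ rows and columns of $\lim_{\tilde q\to0}\tilde R_\alpha^\beta(\tilde q)$. It is computed by replacing $W_T$ with $\tilde W_T=Y^m+p\log Y$, for which $p^\beta=\sqrt[m]{-p/m}\;e^{2\pi i_0\beta/m}$, $\gamma_\beta=(0,+\infty)\cdot p^\beta$, $c_\alpha=-\frac{\sqrt{-mp}}{p^\alpha}$ and $\theta_\alpha=\frac{-p^\alpha}{\sqrt{-mp}}\frac{dY}{(Y-p^\alpha)^2}$; with $\mu=\frac p{mz}$ it is evaluated as $$(\tilde R_1)_\alpha^\beta=e^\mu\frac{\sqrt{2\pi}}{m\sqrt\mu}\sum_{h=0}^{m-1}\Gamma\Big(\mu+\frac hm\Big)\mu^{1-\mu-\frac hm}\,\omega^{-h}.$$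
   Formalization: P_1 is taken as its Gamma-function evaluation; the quantum Riemann–Roch series given for P_1 disagrees with it, so the identity with that series is false. Proved instead: P_1 is asymptotic to 2π times the transposed series at −z. *)

theory Defs
  imports
    "HOL-Complex_Analysis.Complex_Analysis"
    "HOL-Library.Landau_Symbols"
begin

(* Generating function t e^{st} / (e^t - 1) = sum_k B_k(s) t^k / k!. *)
definition bernoulli_poly :: "nat \<Rightarrow> real \<Rightarrow> real" where
  "bernoulli_poly k s = fact k * fps_nth (fps_X * fps_exp s / (fps_exp 1 - 1)) k"

definition qrr_exponent :: "nat \<Rightarrow> real \<Rightarrow> nat \<Rightarrow> complex fps" where
  "qrr_exponent m w1 h = Abs_fps (\<lambda>t. if t = 0 then 0 else
     of_real ((-1) ^ t / (real t * (real t + 1))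
       * bernoulli_poly (t + 1) (real h / real m) * (1 / w1) ^ t))"

(* The entry (P_1)^i_j given by orbifold quantum Riemann-Roch, a (divergent) power
   series in z. *)
definition P1_series :: "nat \<Rightarrow> real \<Rightarrow> nat \<Rightarrow> nat \<Rightarrow> complex fps" where
  "P1_series m w1 i j = fps_const (1 / of_nat m) *
     (\<Sum>h<m. fps_const (cis (2 * pi * real h * (real j - real i) / real m))
             * (fps_exp 1 oo qrr_exponent m w1 h))"

definition omega :: "nat \<Rightarrow> nat \<Rightarrow> nat \<Rightarrow> complex" where
  "omega m \<alpha> \<beta> = cis (2 * pi * (real \<alpha> - real \<beta>) / real m)"

(* The entry (P_1)^alpha_beta as a function of lam = w_1 / z, after evaluation of the
   divergent series by Gamma functions. In terms of P1_series its asymptotic expansion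
   for z -> 0 is 2 pi times the transpose of P_1(-z). *)
definition P1 :: "nat \<Rightarrow> real \<Rightarrow> nat \<Rightarrow> nat \<Rightarrow> complex" where
  "P1 m lam \<alpha> \<beta> = of_real (sqrt (2 * pi) * exp lam / (real m * sqrt lam)) *
     (\<Sum>h<m. omega m \<alpha> \<beta> powi (- int h) *
        of_real (Gamma (lam + real h / real m) * lam powr (1 - lam - real h / real m)))"

(* The superpotential in the coordinate y = log Y, where p log Y = p y is single-valued.
   The parameter of the monomial Y^l is q l, for l in {-n..-1} or {1..m-1}. *)
definition W_T :: "nat \<Rightarrow> nat \<Rightarrow> real \<Rightarrow> (int \<Rightarrow> complex) \<Rightarrow> complex \<Rightarrow> complex" where
  "W_T m n p q y = exp y ^ m + (\<Sum>l\<in>{1..<m}. q (int l) * exp y powi int l)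
     + (\<Sum>l\<in>{1..n}. q (- int l) * exp y powi (- int l)) + of_real p * y"

(* Critical points with respect to y, as points Y = e^y of C^*. *)
definition critical_points :: "(complex \<Rightarrow> complex) \<Rightarrow> complex set" where
  "critical_points W = {exp y |y. deriv W y = 0}"

definition thimble :: "(complex \<Rightarrow> complex) \<Rightarrow> complex \<Rightarrow> complex set" where
  "thimble W y0 = connected_component_set {y. W y - W y0 \<in> \<real>\<^sub>\<ge>\<^sub>0} y0"

(* g parametrises the thimble through the critical point P = e^{g 0} by a square root of
   W - W(P); it is oriented such that |Y| increases through P. *)
definition thimble_param :: "(complex \<Rightarrow> complex) \<Rightarrow> complex \<Rightarrow> (real \<Rightarrow> complex) \<Rightarrow> bool" where
  "thimble_param W P g \<longleftrightarrow>
     exp (g 0) = P \<and>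
     g C1_differentiable_on UNIV \<and>
     bij_betw g UNIV (thimble W (g 0)) \<and>
     (\<forall>t. W (g t) = W (g 0) + of_real (t\<^sup>2)) \<and>
     Re (vector_derivative g (at 0)) > 0"

(* c is a constant with W(Y) - W(P) = z^2/2 + o(z^2) for z = c (Y - P). *)
definition local_coord_const :: "(complex \<Rightarrow> complex) \<Rightarrow> complex \<Rightarrow> complex \<Rightarrow> bool" where
  "local_coord_const W P c \<longleftrightarrow>
     (\<forall>y0. exp y0 = P \<longrightarrow>
        (\<lambda>y. W y - W y0 - (c * (exp y - P))\<^sup>2 / 2) \<in> o[at y0](\<lambda>y. (c * (exp y - P))\<^sup>2))"

(* Finite part of an integral over the real line with a possible double pole at 0.
   For an integrable f it is the ordinary integral. For a double pole without residue it
   equals the integral along a contour indented around the pole on either side. *)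
definition has_finite_part :: "(real \<Rightarrow> complex) \<Rightarrow> complex \<Rightarrow> bool" where
  "has_finite_part f L \<longleftrightarrow>
     (\<forall>e>0. set_integrable lborel {t. e \<le> \<bar>t\<bar>} f) \<and>
     (\<exists>A. ((\<lambda>e. (LINT t:{t. e \<le> \<bar>t\<bar>}|lborel. f t) - A / of_real e) \<longlongrightarrow> L) (at_right 0))"

definition finite_part :: "(real \<Rightarrow> complex) \<Rightarrow> complex" where
  "finite_part f = (THE L. has_finite_part f L)"

(* Pullback along g of e^{(W - W(g 0))/z} d(z_a) / z_a^2 with z_a = c (Y - P), Y = e^y. *)
definition oscillatory_integrand ::
    "(complex \<Rightarrow> complex) \<Rightarrow> real \<Rightarrow> complex \<Rightarrow> complex \<Rightarrow> (real \<Rightarrow> complex) \<Rightarrow> real \<Rightarrow> complex" where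
  "oscillatory_integrand W z P c g t =
     exp ((W (g t) - W (g 0)) / of_real z) *
     (vector_derivative (\<lambda>s. c * (exp (g s) - P)) (at t) / (c * (exp (g t) - P))\<^sup>2)"

(* Pa, ca belong to the form theta_alpha and Pb is the critical point of gamma_beta. A
   parametrisation of the thimble is unique up to translation by multiples of 2 pi i, which
   does not change the integrand. *)
definition R_tilde :: "(complex \<Rightarrow> complex) \<Rightarrow> real \<Rightarrow> complex \<Rightarrow> complex \<Rightarrow> complex \<Rightarrow> complex" where
  "R_tilde W z Pa ca Pb =
     of_real (sqrt (- 2 * pi * z)) *
     finite_part (oscillatory_integrand W z Pa ca (SOME g. thimble_param W Pb g))"

(* Parameters with the full number m + n of critical points (with multiplicity). *)
definition parameters :: "nat \<Rightarrow> (int \<Rightarrow> complex) set" where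
  "parameters n = {q. q (- int n) \<noteq> 0}"

(* Parameters for which the thimble of the beta-th critical point is a smooth curve, i.e.
   does not run into another critical point. *)
definition thimble_parameters ::
    "nat \<Rightarrow> nat \<Rightarrow> real \<Rightarrow> ((int \<Rightarrow> complex) \<Rightarrow> nat \<Rightarrow> complex) \<Rightarrow> nat \<Rightarrow> (int \<Rightarrow> complex) set" where
  "thimble_parameters m n p crit \<beta> =
     {q \<in> parameters n. \<exists>g. thimble_param (W_T m n p q) (crit q \<beta>) g}"

definition limit_crit :: "nat \<Rightarrow> real \<Rightarrow> nat \<Rightarrow> complex" where
  "limit_crit m p \<beta> = of_real (root m (- p / real m)) * cis (2 * pi * real \<beta> / real m)"

end

theory Submission
  imports Defs "HOL-Real_Asymp.Real_Asymp" "HOL-Probability.Distributions"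
begin

text \<open>
  Along a thimble parametrised by \<open>W = W(P) + t\<^sup>2\<close> the integrand is \<open>exp (t\<^sup>2 / z)\<close> times the derivative of
  \<open>- 1 / (c (Y - P))\<close>. After an integration by parts the finite part is the integral of
  \<open>2 t / z * exp (t\<^sup>2 / z) / (c (Y - P))\<close>, which no longer involves the velocity of the curve. The imaginary part
  of \<open>W\<close> is constant on a thimble and separates the critical values, so the denominator is bounded below by a
  multiple of \<open>min 1 \<bar>t\<bar>\<close>, uniformly in small parameters and regardless of how the thimble behaves near \<open>Y = 0\<close>.
  Dominated convergence then reduces the limit to the straight thimble of \<open>Y\<^sup>m + p log Y\<close>, where expanding
  \<open>1 / (1 - w)\<close> as \<open>(1 + w + \<dots> + w\<^bsup>m-1\<^esup>) / (1 - w\<^sup>m)\<close> leaves a sum of Gamma integrals.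

  Thimbles exist for arbitrarily small parameters because a suitable phase of the coefficient of \<open>Y\<^bsup>-n\<^esup>\<close> makes
  \<open>W\<close> real and convex, up to a constant, on the horizontal line through the critical point.

  For the asymptotic expansion, Watson's lemma is applied to the trigamma function, whose Laplace density is the
  generating function of the Bernoulli polynomials. Integrating twice gives Stirling's series.
\<close>

subsection \<open>Stirling's series for the Gamma function\<close>

text \<open>The perturbation is singular. The monomials \<open>Y^-l\<close> are unbounded at
  \<open>Y = 0\<close>, so \<open>W_T\<close> is close to \<open>W_lim\<close> only on strips of
  bounded \<open>Re y\<close>, and nothing is known about a perturbed thimble near
  \<open>Y = 0\<close>, in particular no uniform bound for its velocity. Hence two kinds of estimate
  are kept apart: what must be uniform in \<open>t\<close> is proved for every point of a level set
  \<open>W y = W y1 + t^2\<close>, whether or not it lies on the thimble, and convergence of the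
  curves is proved for one \<open>t\<close> at a time. A velocity bound with constants depending on
  the parameter is enough to make the finite part meaningful. The limit in the parameter would say
  nothing if no small parameter had a smooth thimble, hence the separate proof that the filter is
  nontrivial. For \<open>\<alpha> = \<beta>\<close> the form has a double pole on the thimble
  itself; the boundary terms of the integration by parts then diverge, and they have to be shown to
  consist of a multiple of \<open>1 / e\<close> and a null term. The two constants of integration in
  Stirling's series come from the limit of \<open>Digamma x - ln x\<close> and from the duplication
  formula of \<open>Gamma\<close>.\<close>

lemma has_fps_expansion_remainder_bound:
  fixes f :: "'a :: {banach, real_normed_field} \<Rightarrow> 'a"
  assumes "f has_fps_expansion F"
  shows "\<exists>C \<delta>. \<delta> > 0 \<and> C \<ge> 0 \<and> (\<forall>x. norm x < \<delta> \<longrightarrow> norm (f x - (\<Sum>k<N. fps_nth F k * x ^ k)) \<le> C * norm x ^ N)"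
proof -
  \<comment> \<open>Near 0 the shifted series sums to the remainder divided by \<open>z ^ N\<close>;
    its continuity at 0 provides the constant \<open>norm (eval_fps G 0) + 1\<close>.\<close>
  define G where "G = fps_shift N F"
  have R: "fps_conv_radius F > 0" and ev: "\<forall>\<^sub>F z in nhds 0. eval_fps F z = f z"
    using assms by (auto simp: has_fps_expansion_def)
  have RG: "fps_conv_radius G > 0" using R by (simp add: G_def)
  have "isCont (eval_fps G) 0"
    by (rule continuous_eval_fps) (use RG in \<open>auto simp: zero_ereal_def\<close>)
  then have "\<forall>\<^sub>F z in nhds 0. norm (eval_fps G z - eval_fps G 0) < 1"
    by (simp add: continuous_at eventually_nhds_metric tendsto_iff dist_norm eventually_at)
       (metis (no_types, opaque_lifting) cancel_comm_monoid_add_class.diff_cancel dist_norm norm_zero zero_less_one zero_less_dist_iff diff_zero dist_0_norm)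
  moreover have "\<forall>\<^sub>F z in nhds 0. z \<in> eball 0 (fps_conv_radius F)"
    by (intro eventually_nhds_in_open) (use R in \<open>auto simp: zero_ereal_def\<close>)
  ultimately have "\<forall>\<^sub>F z in nhds 0. norm (f z - (\<Sum>k<N. fps_nth F k * z ^ k)) \<le> (norm (eval_fps G 0) + 1) * norm z ^ N"
    using ev
  proof eventually_elim
    case (elim z)
    have z: "norm z < fps_conv_radius F" using elim(2) by (simp add: dist_norm)
    have s: "summable (\<lambda>n. fps_nth F n * z ^ n)" by (rule summable_fps[OF z])
    have sG: "summable (\<lambda>n. fps_nth G n * z ^ n)" by (rule summable_fps) (use z in \<open>simp add: G_def\<close>)
    have "f z = (\<Sum>n. fps_nth F (n + N) * z ^ (n + N)) + (\<Sum>n<N. fps_nth F n * z ^ n)"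
      using suminf_split_initial_segment[OF s, of N] elim(3) by (simp add: eval_fps_def)
    also have "(\<Sum>n. fps_nth F (n + N) * z ^ (n + N)) = (\<Sum>n. z ^ N * (fps_nth G n * z ^ n))"
      by (intro suminf_cong) (simp add: G_def power_add mult_ac)
    also have "\<dots> = z ^ N * eval_fps G z"
      unfolding eval_fps_def using sG by (rule suminf_mult)
    finally have "norm (f z - (\<Sum>k<N. fps_nth F k * z ^ k)) = norm (eval_fps G z) * norm z ^ N"
      by (simp add: norm_mult norm_power)
    also have "norm (eval_fps G z) \<le> norm (eval_fps G 0) + 1"
      using elim(1) norm_triangle_ineq2[of "eval_fps G z" "eval_fps G 0"] by simp
    finally show ?case by (simp add: mult_right_mono)
  qed
  then obtain d where "d > 0" "\<And>z. dist z 0 < d \<Longrightarrow> norm (f z - (\<Sum>k<N. fps_nth F k * z ^ k)) \<le> (norm (eval_fps G 0) + 1) * norm z ^ N"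
    unfolding eventually_nhds_metric by blast
  then show ?thesis
    by (intro exI[of _ "norm (eval_fps G 0) + 1"] exI[of _ d]) auto
qed

text \<open>Coefficients of \<open>B\<close> beyond \<open>k\<close> cannot influence coefficient
  \<open>k\<close> of the composition. This makes it possible to replace the divergent exponent of
  the Riemann-Roch formula by a polynomial.\<close>

lemma fps_nth_compose_cutoff:
  fixes A B :: "'a :: comm_ring_1 fps"
  assumes "k < N"
  shows "fps_nth (A oo fps_cutoff N B) k = fps_nth (A oo B) k"
proof -
  have "\<forall>k<N. fps_nth ((fps_cutoff N B) ^ i) k = fps_nth (B ^ i) k" for i
  proof (induction i)
    case (Suc i)
    show ?case
    proof (intro allI impI)
      fix k assume k: "k < N"
      show "fps_nth (fps_cutoff N B ^ Suc i) k = fps_nth (B ^ Suc i) k"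
        using k Suc by (auto simp: fps_mult_nth intro!: sum.cong)
    qed
  qed auto
  with assms show ?thesis by (simp add: fps_compose_nth)
qed

text \<open>The series \<open>A\<close> may diverge, so only its cutoff \<open>p\<close> is a
  function. Splitting \<open>exp E = exp (p u) * exp (E - p u)\<close> leaves a convergent
  expansion, which agrees with the formal composition below order \<open>N\<close>, and a factor
  \<open>1 + O(u ^ N)\<close>. Positivity of \<open>N\<close> makes \<open>E - p u\<close> tend to
  0, where \<open>exp\<close> can be linearised.\<close>

lemma exp_fps_asymp:
  fixes A :: "complex fps" and E u :: "'b \<Rightarrow> complex"
  assumes A0: "fps_nth A 0 = 0" and u: "(u \<longlongrightarrow> 0) Fl"
    and E: "(\<lambda>x. E x - (\<Sum>k<N. fps_nth A k * u x ^ k)) \<in> O[Fl](\<lambda>x. u x ^ N)"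
    and N: "N > 0"
  shows "(\<lambda>x. exp (E x) - (\<Sum>k<N. fps_nth (fps_exp 1 oo A) k * u x ^ k)) \<in> O[Fl](\<lambda>x. u x ^ N)"
proof -
  define p where "p = (\<lambda>z::complex. \<Sum>k<N. fps_nth A k * z ^ k)"
  have cut: "fps_cutoff N A = (\<Sum>k<N. fps_const (fps_nth A k) * fps_X ^ k)"
    by (rule fps_ext) (auto simp: fps_sum_nth fps_X_power_nth if_distrib cong: if_cong)
  have p: "p has_fps_expansion fps_cutoff N A"
    unfolding cut p_def by (intro fps_expansion_intros)
  have "(exp \<circ> p) has_fps_expansion (fps_exp 1 oo fps_cutoff N A)"
    by (intro has_fps_expansion_compose p has_fps_expansion_exp1) (use A0 N in simp)
  from has_fps_expansion_remainder_bound[OF this, of N] obtain C \<delta> where C: "\<delta> > 0" 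
    "\<And>z. norm z < \<delta> \<Longrightarrow> norm ((exp \<circ> p) z - (\<Sum>k<N. fps_nth (fps_exp 1 oo fps_cutoff N A) k * z ^ k)) \<le> C * norm z ^ N"
    by blast
  have ev: "\<forall>\<^sub>F x in Fl. norm (u x) < \<delta>"
    using u C(1) by (auto simp: tendsto_iff)
  have 1: "(\<lambda>x. exp (p (u x)) - (\<Sum>k<N. fps_nth (fps_exp 1 oo A) k * u x ^ k)) \<in> O[Fl](\<lambda>x. u x ^ N)"
    by (rule bigoI[of _ C], rule eventually_mono[OF ev])
       (use C(2) in \<open>simp add: fps_nth_compose_cutoff norm_power\<close>)
  have "((\<lambda>x. u x ^ N) \<longlongrightarrow> 0 ^ N) Fl" by (intro tendsto_intros u)
  then have "(\<lambda>x. u x ^ N) \<in> o[Fl](\<lambda>_. 1)"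
    using N by (intro smalloI_tendsto) (auto simp: power_0_left)
  then have d0: "((\<lambda>x. E x - p (u x)) \<longlongrightarrow> 0) Fl"
    using landau_o.big_small_trans[OF E] unfolding p_def
    using smalloD_tendsto by fastforce
  have "((\<lambda>x. exp (p (u x))) \<longlongrightarrow> exp (p 0)) Fl"
    unfolding p_def by (intro tendsto_intros u)
  then have 2: "(\<lambda>x. exp (p (u x))) \<in> O[Fl](\<lambda>_. 1)"
    by (intro bigoI_tendsto[where c = "exp (p 0)"]) auto
  from has_fps_expansion_remainder_bound[OF has_fps_expansion_exp1, of 1] obtain C' \<delta>' where C': "\<delta>' > 0" 
    "\<And>w::complex. norm w < \<delta>' \<Longrightarrow> norm (exp w - 1) \<le> C' * norm w"
    by auto
  have 3: "(\<lambda>x. exp (E x - p (u x)) - 1) \<in> O[Fl](\<lambda>x. E x - p (u x))"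
  proof (rule bigoI)
    have "\<forall>\<^sub>F x in Fl. norm (E x - p (u x)) < \<delta>'"
      using d0 C'(1) by (auto simp: tendsto_iff)
    then show "\<forall>\<^sub>F x in Fl. norm (exp (E x - p (u x)) - 1) \<le> C' * norm (E x - p (u x))"
      by eventually_elim (rule C'(2))
  qed
  have "(\<lambda>x. exp (p (u x)) * (exp (E x - p (u x)) - 1)) \<in> O[Fl](\<lambda>x. 1 * u x ^ N)"
    using E by (intro landau_o.big.mult 2 landau_o.big_trans[OF 3]) (simp add: p_def)
  then have "(\<lambda>x. exp (E x) - exp (p (u x))) \<in> O[Fl](\<lambda>x. u x ^ N)"
    by (simp add: algebra_simps flip: exp_add)
  from sum_in_bigo(1)[OF this 1] show ?thesis by simp
qed

section \<open>Laplace integral of the trigamma function\<close>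

lemma has_bochner_integral_power_exp:
  fixes a :: real
  assumes "a > 0"
  shows "has_bochner_integral lborel (\<lambda>t. indicator {0..} t * (t ^ k * exp (- a * t))) (fact k / a ^ Suc k)"
proof -
  have "has_bochner_integral lborel (erlang_density k a) 1"
    using nn_integral_erlang_ith_moment[OF assms, of k 0] assms
    by (intro has_bochner_integral_nn_integral) (auto simp: )
  from has_bochner_integral_mult_right[OF this, of "fact k / a ^ Suc k"]
  show ?thesis
    by (rule has_bochner_integral_cong[THEN iffD1, rotated 3])
       (use assms in \<open>auto simp: erlang_density_def indicator_def\<close>)
qed

text \<open>Expanding \<open>1 / (1 - exp (- t))\<close> as a geometric series produces the
  integrals of \<open>t * exp (- (x + k) * t)\<close>, whose values \<open>1 / (x + k)^2\<close> are
  the terms of the series of \<open>Polygamma 1\<close>. All terms are nonnegative, so they may be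
  summed under the integral without any estimate.\<close>

lemma Polygamma_1_integral:
  fixes x :: real
  assumes x: "x > 0"
  shows "has_bochner_integral lborel (\<lambda>t. indicator {0..} t * (t * exp (- x * t) / (1 - exp (- t)))) (Polygamma 1 x)"
proof (rule has_bochner_integral_nn_integral)
  let ?g = "\<lambda>k t. indicator {0..} t * (t ^ 1 * exp (- (x + real k) * t))"
  let ?f = "\<lambda>t. indicator {0..} t * (t * exp (- x * t) / (1 - exp (- t)))"
  show "?f \<in> borel_measurable lborel" by measurable
  show "AE t in lborel. 0 \<le> ?f t" by (auto simp: indicator_def)
  show "0 \<le> Polygamma 1 x" using Polygamma_real_odd_pos[of x 1] x by (force elim: nonpos_Ints_cases)
  have g0: "?g k t \<ge> 0" for k t by (auto simp: indicator_def)
  have pt: "(\<lambda>k. ?g k t) sums ?f t" for t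
  proof (cases "t > 0")
    case True
    have "(\<lambda>k. exp (- t) ^ k) sums (1 / (1 - exp (- t)))"
      by (rule geometric_sums) (use True in auto)
    from sums_mult[OF this, of "t * exp (- x * t)"] show ?thesis
      using True by (simp add: algebra_simps exp_add exp_diff exp_minus divide_simps exp_of_nat_mult[symmetric])
  next
    case False
    then show ?thesis by (cases "t = 0") auto
  qed
  have "(\<integral>\<^sup>+t. ennreal (?f t) \<partial>lborel) = (\<integral>\<^sup>+t. (\<Sum>k. ennreal (?g k t)) \<partial>lborel)"
    by (intro nn_integral_cong suminf_ennreal_eq[symmetric] g0 pt)
  also have "\<dots> = (\<Sum>k. \<integral>\<^sup>+t. ennreal (?g k t) \<partial>lborel)"
    by (rule nn_integral_suminf) measurable
  also have "\<dots> = (\<Sum>k. ennreal (inverse ((x + real k) ^ Suc 1)))"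
  proof (rule suminf_cong)
    fix k
    have "has_bochner_integral lborel (?g k) (fact 1 / (x + real k) ^ Suc 1)"
      by (rule has_bochner_integral_power_exp) (use x in auto)
    then show "(\<integral>\<^sup>+t. ennreal (?g k t) \<partial>lborel) = ennreal (inverse ((x + real k) ^ Suc 1))"
      using g0 by (subst nn_integral_eq_integral) (auto simp: has_bochner_integral_iff field_simps)
  qed
  also have "\<dots> = ennreal (Polygamma 1 x)"
    using Polygamma_LIMSEQ[of x 1] x by (intro suminf_ennreal_eq) auto
  finally show "(\<integral>\<^sup>+t. ennreal (?f t) \<partial>lborel) = ennreal (Polygamma 1 x)" .
qed

text \<open>The value 1 at \<open>t = 0\<close> fills the removable singularity, where the quotient
  would evaluate to 0.\<close>

lemma bernoulli_generating:
  "(\<lambda>t. if t = 0 then 1 else t * exp (\<sigma> * t) / (exp t - 1)) has_fps_expansion (fps_X * fps_exp \<sigma> / (fps_exp 1 - 1) :: real fps)"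
proof (rule has_fps_expansion_divide)
  have sd: "subdegree (fps_exp 1 - 1 :: real fps) = 1"
    by (rule subdegreeI) auto
  show "(\<lambda>t. t * exp (\<sigma> * t)) has_fps_expansion (fps_X * fps_exp \<sigma> :: real fps)"
    by (intro fps_expansion_intros)
  show "(\<lambda>t. exp t - 1) has_fps_expansion (fps_exp 1 - 1 :: real fps)"
    by (intro fps_expansion_intros)
  show nz: "(fps_exp 1 - 1 :: real fps) \<noteq> 0" using sd by auto
  show "subdegree (fps_exp 1 - 1 :: real fps) \<le> subdegree (fps_X * fps_exp \<sigma> :: real fps)"
    unfolding sd by (subst subdegree_mult) auto
  show "1 = fps_nth (fps_X * fps_exp \<sigma> :: real fps) (subdegree (fps_exp 1 - 1 :: real fps)) /
      fps_nth (fps_exp 1 - 1) (subdegree (fps_exp 1 - 1 :: real fps))"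
    unfolding sd by simp
qed

text \<open>The quotient of series is exact because numerator and denominator both have subdegree 1;
  multiplying back turns it into equations between coefficients.\<close>

lemma bernoulli_poly_recurrence:
  "(fps_X * fps_exp \<sigma> / (fps_exp 1 - 1)) * (fps_exp 1 - 1) = (fps_X * fps_exp \<sigma> :: real fps)"
proof -
  have sd: "subdegree (fps_exp 1 - 1 :: real fps) = 1"
    by (rule subdegreeI) auto
  then have "(fps_exp 1 - 1 :: real fps) dvd fps_X * fps_exp \<sigma>"
    by (subst fps_dvd_iff) (auto simp: subdegree_mult)
  then show ?thesis by simp
qed

lemma bernoulli_poly_0: "bernoulli_poly 0 \<sigma> = 1"
  and bernoulli_poly_1: "bernoulli_poly 1 \<sigma> = \<sigma> - 1 / 2"
proof -
  let ?B = "fps_X * fps_exp \<sigma> / (fps_exp 1 - 1) :: real fps"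
  have e: "fps_nth (?B * (fps_exp 1 - 1)) k = fps_nth (fps_X * fps_exp \<sigma>) k" for k
    by (simp only: bernoulli_poly_recurrence)
  have 0: "fps_nth ?B 0 = 1"
    using e[of 1] by (simp add: fps_mult_nth)
  have "fps_nth ?B 1 = \<sigma> - 1 / 2"
    using e[of 2] 0 by (simp add: fps_mult_nth numeral_2_eq_2)
  with 0 show "bernoulli_poly 0 \<sigma> = 1" "bernoulli_poly 1 \<sigma> = \<sigma> - 1 / 2"
    by (simp_all add: bernoulli_poly_def)
qed

text \<open>The generating functions at 1 and at 0 differ by exactly \<open>fps_X\<close>. In the
  expansion of \<open>P1\<close> this covers the summand \<open>h = 0\<close>, whose Stirling series
  has its Bernoulli polynomials at 1 instead of \<open>h / m = 0\<close>.\<close>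

lemma bernoulli_poly_at_1:
  assumes "k \<noteq> 1"
  shows "bernoulli_poly k 1 = bernoulli_poly k 0"
proof -
  have nz: "(fps_exp 1 - 1 :: real fps) \<noteq> 0"
    by (metis bernoulli_poly_recurrence fps_exp_neq_0 fps_X_neq_zero mult_eq_0_iff mult_zero_right)
  have "(fps_X * fps_exp 1 / (fps_exp 1 - 1) :: real fps) - fps_X * fps_exp 0 / (fps_exp 1 - 1) = fps_X"
    (is "?a - ?b = _")
  proof -
    have "(?a - ?b) * (fps_exp 1 - 1) = fps_X * (fps_exp 1 - 1)"
      by (simp only: left_diff_distrib bernoulli_poly_recurrence) (simp add: algebra_simps)
    with nz show ?thesis by simp
  qed
  from arg_cong[OF this, of "\<lambda>f. fps_nth f k"] assms show ?thesis
    by (simp add: bernoulli_poly_def)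
qed

text \<open>Watson's lemma: with the shift \<open>1 - \<sigma>\<close> the Laplace density becomes
  \<open>exp (- x * t)\<close> times the generating function of the Bernoulli polynomials at
  \<open>\<sigma>\<close>, and its Taylor polynomial is integrated termwise. The Taylor remainder is
  bounded on the whole half line by a multiple of \<open>t ^ N * exp t\<close>; the extra
  exponential costs a shift from \<open>x\<close> to \<open>x - 1\<close>.\<close>

lemma Polygamma_1_asymp:
  assumes \<sigma>: "0 \<le> \<sigma>" "\<sigma> \<le> 1"
  shows "\<exists>C. \<forall>x\<ge>2. \<bar>Polygamma 1 (x + 1 - \<sigma>) - (\<Sum>k<N. bernoulli_poly k \<sigma> / x ^ Suc k)\<bar> \<le> C / x ^ Suc N"
proof -
  define F where "F = (fps_X * fps_exp \<sigma> / (fps_exp 1 - 1) :: real fps)"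
  define \<phi> where "\<phi> = (\<lambda>t. t * exp (\<sigma> * t) / (exp t - 1))"
  define P where "P = (\<lambda>t. \<Sum>k<N. fps_nth F k * t ^ k)"
  from has_fps_expansion_remainder_bound[OF bernoulli_generating[of \<sigma>], of N] obtain C \<delta> where
    C: "\<delta> > 0" "C \<ge> 0" "\<And>t. \<bar>t\<bar> < \<delta> \<Longrightarrow> \<bar>(if t = 0 then 1 else \<phi> t) - P t\<bar> \<le> C * \<bar>t\<bar> ^ N"
    unfolding F_def[symmetric] \<phi>_def P_def real_norm_def by blast
  \<comment> \<open>The three terms pay for the remainder below \<open>\<delta>\<close>, for
    \<open>\<phi>\<close> above \<open>\<delta>\<close> and for the polynomial above
    \<open>\<delta>\<close>, where any power of \<open>t / \<delta>\<close> may be inserted since it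
    is at least 1.\<close>
  define D where "D = C + 1 / \<delta> ^ N + (\<Sum>k<N. \<bar>fps_nth F k\<bar> / \<delta> ^ (N - k))"
  have D: "D \<ge> 0" unfolding D_def using C(1,2) by (intro add_nonneg_nonneg sum_nonneg) auto
  have bound: "\<bar>\<phi> t - P t\<bar> \<le> D * (t ^ N * exp t)" if t: "t > 0" for t
  proof (cases "t < \<delta>")
    case True
    have "\<bar>\<phi> t - P t\<bar> \<le> C * t ^ N" using C(3)[of t] True t by simp
    also have "\<dots> \<le> D * (t ^ N * exp t)"
    proof (rule mult_mono)
      show "C \<le> D" unfolding D_def using C(1,2) by (simp add: add_nonneg_nonneg sum_nonneg)
      show "t ^ N \<le> t ^ N * exp t" using t by simp
    qed (use D t in auto)
    finally show ?thesis .
  next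
    case False
    then have t\<delta>: "1 \<le> (t / \<delta>) ^ j" for j using C(1) by (simp add: one_le_power)
    have 1: "\<bar>\<phi> t\<bar> \<le> exp t"
    proof -
      have "t \<le> exp t - 1" using exp_ge_add_one_self[of t] by linarith
      moreover have "exp (\<sigma> * t) \<le> exp t" using \<sigma> t by (simp add: mult_left_le_one_le)
      ultimately have "t * exp (\<sigma> * t) \<le> (exp t - 1) * exp t" using t by (intro mult_mono) auto
      then show ?thesis unfolding \<phi>_def using t by (simp add: abs_mult divide_le_eq mult.commute)
    qed
    also have "exp t \<le> exp t * (t / \<delta>) ^ N" using t\<delta>[of N] by simp
    finally have 2: "\<bar>\<phi> t\<bar> \<le> (1 / \<delta> ^ N) * (t ^ N * exp t)" by (simp add: power_divide mult_ac)
    have "\<bar>P t\<bar> \<le> (\<Sum>k<N. \<bar>fps_nth F k * t ^ k\<bar>)" unfolding P_def by (rule sum_abs)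
    also have "\<dots> \<le> (\<Sum>k<N. \<bar>fps_nth F k\<bar> / \<delta> ^ (N - k) * (t ^ N * exp t))"
    proof (rule sum_mono)
      fix k assume k: "k \<in> {..<N}"
      have "t ^ k \<le> t ^ k * (t / \<delta>) ^ (N - k)" using t\<delta>[of "N - k"] t by simp
      also have "\<dots> = t ^ N / \<delta> ^ (N - k)" using k by (simp add: power_divide flip: power_add)
      also have "\<dots> \<le> t ^ N * exp t / \<delta> ^ (N - k)" using t C(1) by (intro divide_right_mono) auto
      finally have "\<bar>fps_nth F k\<bar> * t ^ k \<le> \<bar>fps_nth F k\<bar> * (t ^ N * exp t / \<delta> ^ (N - k))"
        by (intro mult_left_mono) auto
      then show "\<bar>fps_nth F k * t ^ k\<bar> \<le> \<bar>fps_nth F k\<bar> / \<delta> ^ (N - k) * (t ^ N * exp t)"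
        using t by (simp add: abs_mult power_abs)
    qed
    also have "\<dots> = (\<Sum>k<N. \<bar>fps_nth F k\<bar> / \<delta> ^ (N - k)) * (t ^ N * exp t)"
      by (simp add: sum_distrib_right)
    finally have "\<bar>\<phi> t - P t\<bar> \<le> (1 / \<delta> ^ N + (\<Sum>k<N. \<bar>fps_nth F k\<bar> / \<delta> ^ (N - k))) * (t ^ N * exp t)"
      using 2 by (simp add: algebra_simps)
    also have "\<dots> \<le> D * (t ^ N * exp t)"
      unfolding D_def using C(2) t by (intro mult_right_mono) auto
    finally show ?thesis .
  qed
  show ?thesis
  proof (intro exI allI impI)
    fix x :: real assume x: "x \<ge> 2"
    let ?d = "Polygamma 1 (x + 1 - \<sigma>) - (\<Sum>k<N. bernoulli_poly k \<sigma> / x ^ Suc k)"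
    let ?i = "\<lambda>t. indicator {0..} t * (t * exp (- (x + 1 - \<sigma>) * t) / (1 - exp (- t)))
          - (\<Sum>k<N. fps_nth F k * (indicator {0..} t * (t ^ k * exp (- x * t))))"
    let ?j = "\<lambda>t. D * (indicator {0..} t * (t ^ N * exp (- (x - 1) * t)))"
    have "has_bochner_integral lborel ?i (Polygamma 1 (x + 1 - \<sigma>) - (\<Sum>k<N. fps_nth F k * (fact k / x ^ Suc k)))"
      by (intro has_bochner_integral_diff has_bochner_integral_sum Polygamma_1_integral
          has_bochner_integral_mult_right has_bochner_integral_power_exp) (use x \<sigma> in auto)
    then have i: "has_bochner_integral lborel ?i ?d"
      by (simp add: bernoulli_poly_def F_def mult_ac)
    have j: "has_bochner_integral lborel ?j (D * (fact N / (x - 1) ^ Suc N))"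
      by (intro has_bochner_integral_mult_right has_bochner_integral_power_exp) (use x in auto)
    have "\<bar>?i t\<bar> \<le> ?j t" if "t \<noteq> 0" for t
    proof (cases "t > 0")
      case True
      have "t * exp (- (x + 1 - \<sigma>) * t) / (1 - exp (- t)) = exp (- x * t) * \<phi> t"
        unfolding \<phi>_def using True
        by (simp add: algebra_simps exp_add exp_diff exp_minus divide_simps)
      then have "?i t = exp (- x * t) * (\<phi> t - P t)"
        using True by (simp add: P_def algebra_simps sum_distrib_left)
      then have "\<bar>?i t\<bar> = exp (- x * t) * \<bar>\<phi> t - P t\<bar>" by (simp only: abs_mult abs_exp_cancel)
      also have "\<dots> \<le> exp (- x * t) * (D * (t ^ N * exp t))"
        by (intro mult_left_mono bound True) auto
      also have "\<dots> = ?j t" using True by (simp add: algebra_simps exp_add exp_diff exp_minus divide_simps)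
      finally show ?thesis .
    qed (use that in auto)
    then have ae: "AE t in lborel. \<bar>?i t\<bar> \<le> ?j t"
      by (intro AE_I'[of "{0}"]) auto
    have "\<bar>?d\<bar> = \<bar>integral\<^sup>L lborel ?i\<bar>" using i by (simp only: has_bochner_integral_integral_eq)
    also have "\<dots> \<le> integral\<^sup>L lborel (\<lambda>t. \<bar>?i t\<bar>)" by (rule integral_abs_bound)
    also have "\<dots> \<le> integral\<^sup>L lborel ?j"
      using i j by (intro integral_mono_AE ae integrable_abs) (auto simp only: has_bochner_integral_iff)
    also have "\<dots> = D * (fact N / (x - 1) ^ Suc N)" using j by (rule has_bochner_integral_integral_eq)
    \<comment> \<open>From \<open>x >= 2\<close> follows \<open>x - 1 >= x / 2\<close>, which
      restores a power of \<open>x\<close>.\<close>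
    also have "\<dots> \<le> D * (fact N / (x / 2) ^ Suc N)"
      using x D by (intro mult_left_mono divide_left_mono power_mono mult_pos_pos zero_less_power) auto
    also have "\<dots> = (D * fact N * 2 ^ Suc N) / x ^ Suc N"
      by (simp add: power_divide)
    finally show "\<bar>?d\<bar> \<le> (D * fact N * 2 ^ Suc N) / x ^ Suc N" .
  qed
qed

text \<open>The function \<open>C / (k * x^k)\<close> is a primitive of the bound up to sign. Adding
  it to \<open>f\<close> gives a nonincreasing function and subtracting it a nondecreasing one, both
  with limit \<open>L\<close>, so that derivative bounds are integrated from infinity without
  integrals.\<close>

lemma tail_bound_of_deriv:
  fixes f f' :: "real \<Rightarrow> real"
  assumes f: "\<And>x. x \<ge> a \<Longrightarrow> (f has_real_derivative f' x) (at x)"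
    and f': "\<And>x. x \<ge> a \<Longrightarrow> \<bar>f' x\<bar> \<le> C / x ^ Suc k"
    and a: "a > 0" and k: "k > 0" and lim: "(f \<longlongrightarrow> L) at_top" and x: "x \<ge> a"
  shows "\<bar>f x - L\<bar> \<le> C / real k / x ^ k"
proof -
  define g where "g = (\<lambda>x. C / real k / x ^ k)"
  have g: "(g has_real_derivative - (C / x ^ Suc k)) (at x)" if "x \<ge> a" for x
  proof -
    obtain j where j: "k = Suc j" using k by (cases k) auto
    have x: "x \<noteq> 0" using that a by simp
    have "((\<lambda>x. C / real k / x ^ k) has_real_derivative - (C / real k * (real k * x ^ (k - Suc 0))) / (x ^ k * x ^ k)) (at x)"
      using x by (auto intro!: derivative_eq_intros simp: power2_eq_square)
    also have "- (C / real k * (real k * x ^ (k - Suc 0))) / (x ^ k * x ^ k) = - (C / x ^ Suc k)"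
      using x k by (simp add: j)
    finally show ?thesis unfolding g_def .
  qed
  have g0: "(g \<longlongrightarrow> 0) at_top" unfolding g_def
    using k by (intro tendsto_divide_0[OF tendsto_const] filterlim_at_top_imp_at_infinity filterlim_pow_at_top filterlim_ident) simp
  have "f x + g x \<ge> L"
  proof (rule tendsto_upperbound)
    show "((\<lambda>y. f y + g y) \<longlongrightarrow> L) at_top" using tendsto_add[OF lim g0] by simp
    show "\<forall>\<^sub>F y in at_top. f y + g y \<le> f x + g x"
      using eventually_ge_at_top[of x]
    proof eventually_elim
      case (elim y)
      show ?case
      proof (rule DERIV_nonpos_imp_nonincreasing[OF elim])
        fix u assume "x \<le> u" "u \<le> y"
        then have u: "u \<ge> a" using x by simp
        show "\<exists>w. ((\<lambda>y. f y + g y) has_real_derivative w) (at u) \<and> w \<le> 0"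
          using f'[OF u] by (intro exI[of _ "f' u + - (C / u ^ Suc k)"] conjI DERIV_add f[OF u] g[OF u]) (simp add: abs_le_iff)
      qed
    qed
  qed auto
  moreover have "f x - g x \<le> L"
  proof (rule tendsto_lowerbound)
    show "((\<lambda>y. f y - g y) \<longlongrightarrow> L) at_top" using tendsto_diff[OF lim g0] by simp
    show "\<forall>\<^sub>F y in at_top. f x - g x \<le> f y - g y"
      using eventually_ge_at_top[of x]
    proof eventually_elim
      case (elim y)
      show ?case
      proof (rule DERIV_nonneg_imp_nondecreasing[OF elim])
        fix u assume "x \<le> u" "u \<le> y"
        then have u: "u \<ge> a" using x by simp
        show "\<exists>w. ((\<lambda>y. f y - g y) has_real_derivative w) (at u) \<and> 0 \<le> w"
          using f'[OF u] by (intro exI[of _ "f' u - - (C / u ^ Suc k)"] conjI DERIV_diff f[OF u] g[OF u]) (simp add: abs_le_iff)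
      qed
    qed
  qed auto
  ultimately show ?thesis unfolding g_def by linarith
qed

text \<open>The Stirling remainder must be known to converge before its limit can be identified. The
  functions \<open>f - C / x\<close> and \<open>f + C / x\<close> are monotone in opposite
  directions, which bounds the oscillation of \<open>f\<close> beyond \<open>x\<close> by
  \<open>C / x\<close>.\<close>

lemma convergent_of_deriv_bound:
  fixes f f' :: "real \<Rightarrow> real"
  assumes f: "\<And>x. x \<ge> a \<Longrightarrow> (f has_real_derivative f' x) (at x)"
    and f': "\<And>x. x \<ge> a \<Longrightarrow> \<bar>f' x\<bar> \<le> C / x\<^sup>2" and a: "a > 0"
  shows "\<exists>L. (f \<longlongrightarrow> L) at_top"
proof -
  have "0 \<le> C / a\<^sup>2" using f'[of a] abs_ge_zero[of "f' a"] by linarith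
  then have C: "C \<ge> 0" using a by (simp add: zero_le_divide_iff)
  have lip: "\<bar>f y - f x\<bar> \<le> C / x" if xy: "a \<le> x" "x \<le> y" for x y
  proof -
    have d1: "((\<lambda>x. f x - C / x) has_real_derivative f' u + C / u\<^sup>2) (at u)" if "u \<ge> a" for u
      using f[OF that] that a by (auto intro!: derivative_eq_intros simp: power2_eq_square)
    have d2: "((\<lambda>x. f x + C / x) has_real_derivative f' u - C / u\<^sup>2) (at u)" if "u \<ge> a" for u
      using f[OF that] that a by (auto intro!: derivative_eq_intros simp: power2_eq_square)
    have "f x - C / x \<le> f y - C / y"
    proof (rule DERIV_nonneg_imp_nondecreasing[OF xy(2)])
      fix u assume "x \<le> u" "u \<le> y"
      then have "a \<le> u" using xy by simp
      with d1[OF this] f'[OF this] show "\<exists>w. ((\<lambda>x. f x - C / x) has_real_derivative w) (at u) \<and> 0 \<le> w"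
        by (intro exI[of _ "f' u + C / u\<^sup>2"]) linarith
    qed
    moreover have "f y + C / y \<le> f x + C / x"
    proof (rule DERIV_nonpos_imp_nonincreasing[OF xy(2)])
      fix u assume "x \<le> u" "u \<le> y"
      then have "a \<le> u" using xy by simp
      with d2[OF this] f'[OF this] show "\<exists>w. ((\<lambda>x. f x + C / x) has_real_derivative w) (at u) \<and> w \<le> 0"
        by (intro exI[of _ "f' u - C / u\<^sup>2"]) linarith
    qed
    moreover have "C / y \<ge> 0" using C xy a by simp
    ultimately show ?thesis by linarith
  qed
  \<comment> \<open>The Cauchy criterion is applied to integer arguments; the oscillation bound then
    extends the limit to real ones.\<close>
  have "convergent (\<lambda>n. f (real n))"
  proof (rule Cauchy_convergent, rule metric_CauchyI)
    fix e :: real assume e: "e > 0"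
    obtain M :: nat where M: "real M > max a (C / e)" using reals_Archimedean2 by blast
    then have "C / real M < e" using M e a by (simp add: field_simps)
    then have *: "\<bar>f (real n) - f (real m)\<bar> < e" if "M \<le> m" "m \<le> n" for m n
      using lip[of "real m" "real n"] that M C a divide_left_mono[of "real M" "real m" C] by force
    show "\<exists>M. \<forall>m\<ge>M. \<forall>n\<ge>M. dist (f (real m)) (f (real n)) < e"
    proof (intro exI[of _ M] allI impI)
      fix m n assume "M \<le> m" "M \<le> n"
      then show "dist (f (real m)) (f (real n)) < e"
        using *[of m n] *[of n m] by (cases "m \<le> n") (auto simp: dist_real_def abs_minus_commute)
    qed
  qed
  then obtain L where L: "(\<lambda>n. f (real n)) \<longlonglongrightarrow> L" by (auto simp: convergent_def)
  have "\<bar>f x - L\<bar> \<le> C / x" if x: "a \<le> x" for x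
  proof (rule tendsto_upperbound)
    show "(\<lambda>n. \<bar>f x - f (real n)\<bar>) \<longlonglongrightarrow> \<bar>f x - L\<bar>" by (intro tendsto_intros L)
    have "\<forall>\<^sub>F n in sequentially. x \<le> real n" by real_asymp
    then show "\<forall>\<^sub>F n in sequentially. \<bar>f x - f (real n)\<bar> \<le> C / x"
      by eventually_elim (metis lip x abs_minus_commute)
  qed auto
  moreover have "((\<lambda>x. C / x) \<longlongrightarrow> 0) at_top" by real_asymp
  ultimately have "((\<lambda>x. f x - L) \<longlongrightarrow> 0) at_top"
    by (intro Lim_null_comparison[of "\<lambda>x. f x - L" "\<lambda>x. C / x"])
       (auto intro: eventually_mono[OF eventually_ge_at_top[of a]])
  then show ?thesis by (auto simp: LIM_zero_iff)
qed

text \<open>The increment of \<open>ln_Gamma\<close> over \<open>[x, x + 1]\<close> is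
  \<open>ln x\<close> by the functional equation and a value of \<open>Digamma\<close> by the mean
  value theorem. Monotonicity and \<open>Digamma (x + 1) = Digamma x + 1 / x\<close> enclose
  it.\<close>

lemma Digamma_ln_bounds:
  fixes x :: real
  assumes x: "x > 0"
  shows "ln x - 1 / x \<le> Digamma x" "Digamma x \<le> ln x"
proof -
  have "\<exists>\<xi>. x < \<xi> \<and> \<xi> < x + 1 \<and> ln_Gamma (x + 1) - ln_Gamma x = (x + 1 - x) * Digamma \<xi>"
    using x by (intro MVT2 has_field_derivative_ln_Gamma_real) auto
  then obtain \<xi> where \<xi>: "x < \<xi>" "\<xi> < x + 1" "ln_Gamma (x + 1) - ln_Gamma x = Digamma \<xi>" by auto
  have "Gamma (x + 1) = x * Gamma x" using x by (intro Gamma_plus1) (auto elim: nonpos_Ints_cases)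
  then have "ln_Gamma (x + 1) - ln_Gamma x = ln x"
    using x Gamma_real_pos[of x] by (simp add: ln_Gamma_real_pos ln_mult_pos)
  moreover have "Digamma x \<le> Digamma \<xi>" "Digamma \<xi> \<le> Digamma (x + 1)"
    using \<xi> x by (auto intro!: Digamma_real_mono)
  moreover have "Digamma (x + 1) = Digamma x + 1 / x" using x by (simp add: Digamma_plus1)
  ultimately show "ln x - 1 / x \<le> Digamma x" "Digamma x \<le> ln x" using \<xi>(3) by auto
qed

lemma Digamma_minus_ln_tendsto:
  fixes s :: real
  assumes "s \<ge> 0"
  shows "((\<lambda>x. Digamma (x + s) - ln x) \<longlongrightarrow> 0) at_top"
proof (rule tendsto_sandwich)
  show "\<forall>\<^sub>F x in at_top. ln (x + s) - 1 / (x + s) - ln x \<le> Digamma (x + s) - ln x"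
    using eventually_gt_at_top[of 0]
    by eventually_elim (use Digamma_ln_bounds assms in \<open>simp add: add_pos_nonneg\<close>)
  show "\<forall>\<^sub>F x in at_top. Digamma (x + s) - ln x \<le> ln (x + s) - ln x"
    using eventually_gt_at_top[of 0]
    by eventually_elim (use Digamma_ln_bounds assms in \<open>simp add: add_pos_nonneg\<close>)
  show "((\<lambda>x. ln (x + s) - 1 / (x + s) - ln x) \<longlongrightarrow> 0) at_top" by real_asymp
  show "((\<lambda>x. ln (x + s) - ln x) \<longlongrightarrow> 0) at_top" by real_asymp
qed

text \<open>The mean value theorem encloses the increment between \<open>s * Digamma x\<close> and
  \<open>s * Digamma (x + s)\<close>. Thus the constant in Stirling's formula is the same for every
  shift \<open>s\<close>.\<close>

lemma ln_Gamma_shift_tendsto: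
  fixes s :: real
  assumes "s \<ge> 0"
  shows "((\<lambda>x. ln_Gamma (x + s) - ln_Gamma x - s * ln x) \<longlongrightarrow> 0) at_top"
proof (cases "s = 0")
  case False
  then have s: "s > 0" using assms by simp
  have b: "s * (Digamma x - ln x) \<le> ln_Gamma (x + s) - ln_Gamma x - s * ln x \<and>
       ln_Gamma (x + s) - ln_Gamma x - s * ln x \<le> s * (Digamma (x + s) - ln x)" if x: "x > 0" for x
  proof -
    have "\<exists>\<xi>. x < \<xi> \<and> \<xi> < x + s \<and> ln_Gamma (x + s) - ln_Gamma x = (x + s - x) * Digamma \<xi>"
      using x s by (intro MVT2 has_field_derivative_ln_Gamma_real) auto
    then obtain \<xi> where \<xi>: "x < \<xi>" "\<xi> < x + s" "ln_Gamma (x + s) - ln_Gamma x = s * Digamma \<xi>" by auto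
    moreover have "s * Digamma x \<le> s * Digamma \<xi>" "s * Digamma \<xi> \<le> s * Digamma (x + s)"
      using \<xi> x s by (auto intro!: Digamma_real_mono)
    ultimately show ?thesis by (simp add: algebra_simps)
  qed
  show ?thesis
  proof (rule tendsto_sandwich)
    show "\<forall>\<^sub>F x in at_top. s * (Digamma x - ln x) \<le> ln_Gamma (x + s) - ln_Gamma x - s * ln x"
      using eventually_gt_at_top[of 0] by eventually_elim (use b in blast)
    show "\<forall>\<^sub>F x in at_top. ln_Gamma (x + s) - ln_Gamma x - s * ln x \<le> s * (Digamma (x + s) - ln x)"
      using eventually_gt_at_top[of 0] by eventually_elim (use b in blast)
    show "((\<lambda>x. s * (Digamma x - ln x)) \<longlongrightarrow> 0) at_top"
      using tendsto_mult_left[OF Digamma_minus_ln_tendsto[of 0], of s] by simp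
    show "((\<lambda>x. s * (Digamma (x + s) - ln x)) \<longlongrightarrow> 0) at_top"
      using tendsto_mult_left[OF Digamma_minus_ln_tendsto[OF assms], of s] by simp
  qed
qed auto

section \<open>Stirling's constant and the full series\<close>

lemma has_real_derivative_stirling:
  fixes s x :: real
  assumes "x > 0" "s \<ge> 0"
  shows "((\<lambda>x. ln_Gamma (x + s) - ((x + s - 1 / 2) * ln x - x)) has_real_derivative
           Digamma (x + s) - ln x - (s - 1 / 2) / x) (at x)"
  using assms by (auto intro!: derivative_eq_intros simp: field_simps add_pos_nonneg)

text \<open>For \<open>s = 0\<close> the derivative is of order \<open>1 / x^2\<close>, hence there
  is a limit \<open>K\<close>, and the shift lemma gives the same \<open>K\<close> for all
  \<open>s\<close>. Legendre's duplication formula, which compares the remainders at shifts 0 and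
  1/2 with the one at \<open>2 * x\<close>, becomes
  \<open>K + K - K = ln (2 * pi) / 2\<close>.\<close>

lemma stirling_remainder_tendsto:
  fixes s :: real
  assumes s: "0 \<le> s" "s \<le> 1"
  shows "((\<lambda>x. ln_Gamma (x + s) - ((x + s - 1 / 2) * ln x - x)) \<longlongrightarrow> ln (2 * pi) / 2) at_top"
proof -
  define f where "f = (\<lambda>s x::real. ln_Gamma (x + s) - ((x + s - 1 / 2) * ln x - x))"
  \<comment> \<open>The choice \<open>\<sigma> = 1\<close> gives the unshifted argument, and the two
    terms subtracted are the derivative of \<open>ln x - 1 / (2 * x)\<close>.\<close>
  obtain C where C: "\<And>x. x \<ge> 2 \<Longrightarrow> \<bar>Polygamma 1 (x + 1 - 1) - (\<Sum>k<2. bernoulli_poly k 1 / x ^ Suc k)\<bar> \<le> C / x ^ Suc 2"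
    using Polygamma_1_asymp[of 1 2] by auto
  have d: "((\<lambda>x. Digamma x - ln x - (0 - 1 / 2) / x) has_real_derivative
           Polygamma 1 (x + 1 - 1) - (\<Sum>k<2. bernoulli_poly k 1 / x ^ Suc k)) (at x)" if "x \<ge> 2" for x
    using that by (auto intro!: derivative_eq_intros elim: nonpos_Ints_cases
      simp: bernoulli_poly_0 bernoulli_poly_1[unfolded One_nat_def] numeral_2_eq_2 field_simps)
  have l: "((\<lambda>x::real. Digamma x - ln x - (0 - 1 / 2) / x) \<longlongrightarrow> 0) at_top"
  proof -
    have "((\<lambda>x::real. (0 - 1 / 2) / x) \<longlongrightarrow> 0) at_top" by real_asymp
    from tendsto_diff[OF Digamma_minus_ln_tendsto[of 0] this] show ?thesis by simp
  qed
  have "\<bar>Digamma x - ln x - (0 - 1 / 2) / x - 0\<bar> \<le> C / real 2 / x ^ 2" if "x \<ge> 2" for x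
    by (rule tail_bound_of_deriv[where a = 2 and k = 2, OF d C _ _ l that]) auto
  then have "\<exists>K. (f 0 \<longlongrightarrow> K) at_top"
    using has_real_derivative_stirling[of _ 0] unfolding f_def
    by (intro convergent_of_deriv_bound[of 2 _ "\<lambda>x. Digamma x - ln x - (0 - 1 / 2) / x" "C / 2"]) auto
  then obtain K where K: "(f 0 \<longlongrightarrow> K) at_top" by blast
  have fs: "(f s \<longlongrightarrow> K) at_top" if "s \<ge> 0" for s
    using tendsto_add[OF K ln_Gamma_shift_tendsto[OF that]] by (simp add: f_def algebra_simps)
  have dup: "f 0 x + f (1 / 2) x - f 0 (2 * x) = ln (2 * pi) / 2" if x: "x > 0" for x
  proof -
    have nn: "complex_of_real y \<notin> \<int>\<^sub>\<le>\<^sub>0" if "y > 0" for y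
    proof
      assume "complex_of_real y \<in> \<int>\<^sub>\<le>\<^sub>0"
      then obtain k where k: "k \<le> 0" "complex_of_real y = of_int k" by (elim nonpos_Ints_cases)
      from k(2) have "y = of_int k" by (metis of_real_eq_iff of_real_of_int_eq)
      with k(1) that show False by simp
    qed
    have "Gamma (complex_of_real x) * Gamma (complex_of_real x + 1 / 2) =
        exp ((1 - 2 * complex_of_real x) * of_real (ln 2)) * of_real (sqrt pi) * Gamma (2 * complex_of_real x)"
      using nn[OF x] nn[of "x + 1 / 2"] x by (intro Gamma_legendre_duplication) auto
    also have "complex_of_real x + 1 / 2 = of_real (x + 1 / 2)" by simp
    also have "2 * complex_of_real x = of_real (2 * x)" by simp
    also have "(1 - of_real (2 * x)) * complex_of_real (ln 2) = of_real ((1 - 2 * x) * ln 2)" by simp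
    finally have "complex_of_real (Gamma x * Gamma (x + 1 / 2)) = complex_of_real (exp ((1 - 2 * x) * ln 2) * sqrt pi * Gamma (2 * x))"
      by (simp only: Gamma_complex_of_real exp_of_real of_real_mult[symmetric])
    then have "Gamma x * Gamma (x + 1 / 2) = exp ((1 - 2 * x) * ln 2) * sqrt pi * Gamma (2 * x)"
      by (simp only: of_real_eq_iff)
    then have "ln (Gamma x * Gamma (x + 1 / 2)) = ln (exp ((1 - 2 * x) * ln 2) * sqrt pi * Gamma (2 * x))" by simp
    then have "ln_Gamma x + ln_Gamma (x + 1 / 2) = (1 - 2 * x) * ln 2 + ln pi / 2 + ln_Gamma (2 * x)"
      using x Gamma_real_pos[of x] Gamma_real_pos[of "x + 1 / 2"] Gamma_real_pos[of "2 * x"]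
      by (simp add: ln_Gamma_real_pos ln_mult_pos ln_sqrt)
    then show ?thesis using x by (simp add: f_def ln_mult_pos field_simps)
  qed
  have "((\<lambda>x. f 0 x + f (1 / 2) x - f 0 (2 * x)) \<longlongrightarrow> K + K - K) at_top"
    by (intro tendsto_intros K fs filterlim_compose[OF K]) (simp, real_asymp)
  moreover have "((\<lambda>x. f 0 x + f (1 / 2) x - f 0 (2 * x)) \<longlongrightarrow> ln (2 * pi) / 2) at_top"
    by (rule tendsto_eventually, rule eventually_mono[OF eventually_gt_at_top[of 0]]) (rule dup)
  ultimately have "K = ln (2 * pi) / 2" using tendsto_unique trivial_limit_at_top_linorder by fastforce
  with fs[OF s(1)] show ?thesis unfolding f_def by (simp only:)
qed

text \<open>Two integrations from infinity of the trigamma expansion, each lowering the order of the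
  error by one; this is why \<open>N + 1\<close> terms with error \<open>1 / x ^ (N + 2)\<close> are
  taken at the start. The integration constants are the limits 0 of \<open>F'\<close> and
  \<open>ln (2 * pi) / 2\<close> of \<open>F\<close>.\<close>

theorem ln_Gamma_stirling:
  fixes \<sigma> :: real
  assumes \<sigma>: "0 \<le> \<sigma>" "\<sigma> \<le> 1" and N: "N > 0"
  shows "\<exists>C. \<forall>x\<ge>2. \<bar>ln_Gamma (x + 1 - \<sigma>) - ((x + 1 / 2 - \<sigma>) * ln x - x + ln (2 * pi) / 2 +
           (\<Sum>t\<in>{1..<N}. bernoulli_poly (t + 1) \<sigma> / (real t * (real t + 1)) / x ^ t))\<bar> \<le> C / x ^ N"
proof -
  let ?b = "\<lambda>k. bernoulli_poly k \<sigma>"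
  let ?S = "\<lambda>x. \<Sum>t\<in>{1..<N}. ?b (t + 1) / (real t * (real t + 1)) / x ^ t"
  let ?S' = "\<lambda>x. \<Sum>t\<in>{1..<N}. ?b (t + 1) / (real t + 1) / x ^ (t + 1)"
  let ?S'' = "\<lambda>x. \<Sum>t\<in>{1..<N}. ?b (t + 1) / x ^ (t + 2)"
  define F where "F = (\<lambda>x. ln_Gamma (x + (1 - \<sigma>)) - ((x + (1 - \<sigma>) - 1 / 2) * ln x - x) - ?S x)"
  define F' where "F' = (\<lambda>x. Digamma (x + (1 - \<sigma>)) - ln x - ((1 - \<sigma>) - 1 / 2) / x + ?S' x)"
  define F'' where "F'' = (\<lambda>x. Polygamma 1 (x + 1 - \<sigma>) - (\<Sum>k<Suc N. ?b k / x ^ Suc k))"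
  have pw: "((\<lambda>x. c / x ^ t) has_real_derivative - (c * real t / x ^ (t + 1))) (at x)" if "x > 0" for c x :: real and t :: nat
  proof -
    have "((\<lambda>x. c / x ^ t) has_real_derivative - (c * (real t * x ^ (t - Suc 0))) / (x ^ t * x ^ t)) (at x)"
      using that by (auto intro!: derivative_eq_intros simp: power2_eq_square)
    also have "- (c * (real t * x ^ (t - Suc 0))) / (x ^ t * x ^ t) = - (c * real t / x ^ (t + 1))"
      using that by (cases t) auto
    finally show ?thesis .
  qed
  have dS: "(?S has_real_derivative - ?S' x) (at x)" if "x > 0" for x
  proof -
    have "(?S has_real_derivative (\<Sum>t\<in>{1..<N}. - (?b (t + 1) / (real t * (real t + 1)) * real t / x ^ (t + 1)))) (at x)"
      by (intro DERIV_sum pw that)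
    also have "(\<Sum>t\<in>{1..<N}. - (?b (t + 1) / (real t * (real t + 1)) * real t / x ^ (t + 1))) = - ?S' x"
      unfolding sum_negf[symmetric] by (intro sum.cong refl) auto
    finally show ?thesis .
  qed
  have dS': "(?S' has_real_derivative - ?S'' x) (at x)" if "x > 0" for x
  proof -
    have "(?S' has_real_derivative (\<Sum>t\<in>{1..<N}. - (?b (t + 1) / (real t + 1) * real (t + 1) / x ^ (t + 1 + 1)))) (at x)"
      by (intro DERIV_sum pw that)
    also have "(\<Sum>t\<in>{1..<N}. - (?b (t + 1) / (real t + 1) * real (t + 1) / x ^ (t + 1 + 1))) = - ?S'' x"
      unfolding sum_negf[symmetric] by (intro sum.cong refl) (simp add: divide_simps add_eq_0_iff)
    finally show ?thesis .
  qed
  have F: "(F has_real_derivative F' x) (at x)" if "x > 0" for x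
    unfolding F_def F'_def
    using DERIV_diff[OF has_real_derivative_stirling[OF that, of "1 - \<sigma>"] dS[OF that]] \<sigma> by simp
  have F': "(F' has_real_derivative F'' x) (at x)" if "x > 0" for x
  proof -
    have "(F' has_real_derivative Polygamma 1 (x + (1 - \<sigma>)) - 1 / x + ((1 - \<sigma>) - 1 / 2) / x\<^sup>2 + - ?S'' x) (at x)"
      unfolding F'_def using that \<sigma>
      by (intro DERIV_add dS') (auto intro!: derivative_eq_intros elim!: nonpos_Ints_cases simp: power2_eq_square add_pos_nonneg diff_divide_distrib)
    also have "Polygamma 1 (x + (1 - \<sigma>)) - 1 / x + ((1 - \<sigma>) - 1 / 2) / x\<^sup>2 + - ?S'' x = F'' x"
    proof -
      \<comment> \<open>The terms 0 and 1 are the second derivative of the logarithmic part; the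
        remaining ones are reindexed by \<open>k = t + 1\<close>.\<close>
      have "{..<Suc N} = insert 0 (insert 1 (Suc ` {1..<N}))" using N by (auto simp: image_iff less_Suc_eq_0_disj)
      then have "(\<Sum>k<Suc N. ?b k / x ^ Suc k) = ?b 0 / x + (?b 1 / x\<^sup>2 + ?S'' x)"
        by (simp add: sum.shift_bounds_Suc_ivl power2_eq_square del: lessThan_Suc sum.lessThan_Suc sum.op_ivl_Suc)
      then show ?thesis unfolding F''_def
        by (simp add: bernoulli_poly_0 bernoulli_poly_1[unfolded One_nat_def] algebra_simps add_divide_distrib diff_divide_distrib)
    qed
    finally show ?thesis .
  qed
  obtain C where C: "\<And>x. x \<ge> 2 \<Longrightarrow> \<bar>F'' x\<bar> \<le> C / x ^ Suc (Suc N)"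
    using Polygamma_1_asymp[OF \<sigma>, of "Suc N"] unfolding F''_def by blast
  have S0: "((\<lambda>x. c / x ^ t) \<longlongrightarrow> 0) at_top" if "t > 0" for c :: real and t :: nat
    using that by (intro tendsto_divide_0[OF tendsto_const] filterlim_at_top_imp_at_infinity filterlim_pow_at_top filterlim_ident) simp
  have "(F' \<longlongrightarrow> 0 - 0 + (\<Sum>t\<in>{1..<N}. 0)) at_top"
    unfolding F'_def using S0[of 1 "(1 - \<sigma>) - 1 / 2"] \<sigma> S0
    by (intro tendsto_add tendsto_diff Digamma_minus_ln_tendsto tendsto_sum S0) auto
  then have F'0: "(F' \<longlongrightarrow> 0) at_top" by simp
  have "\<bar>F' x - 0\<bar> \<le> C / real (Suc N) / x ^ Suc N" if "x \<ge> 2" for x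
    by (rule tail_bound_of_deriv[where a = 2 and f' = F'', OF F' C _ _ F'0 that]) auto
  then have F'b: "\<And>x. x \<ge> 2 \<Longrightarrow> \<bar>F' x\<bar> \<le> C / real (Suc N) / x ^ Suc N" by simp
  have "(F \<longlongrightarrow> ln (2 * pi) / 2 - (\<Sum>t\<in>{1..<N}. 0)) at_top"
    unfolding F_def by (intro tendsto_diff stirling_remainder_tendsto tendsto_sum S0) (use \<sigma> in auto)
  then have F0: "(F \<longlongrightarrow> ln (2 * pi) / 2) at_top" by simp
  have "\<bar>F x - ln (2 * pi) / 2\<bar> \<le> C / real (Suc N) / real N / x ^ N" if "x \<ge> 2" for x
    by (rule tail_bound_of_deriv[where a = 2 and f' = F', OF F F'b _ _ F0 that]) (use N in auto)
  then show ?thesis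
    by (intro exI[of _ "C / real (Suc N) / real N"]) (simp add: F_def algebra_simps)
qed

text \<open>Reversing the sum turns the argument of \<open>Gamma\<close> into \<open>lam + 1 - h / m\<close>, whose Stirling series involves
  Bernoulli polynomials at \<open>h / m\<close>. The term \<open>h = 0\<close> is fixed by the reversal.\<close>

lemma P1_reflected:
  assumes m: "m > 0"
  shows "P1 m lam \<alpha> \<beta> = of_real (sqrt (2 * pi) * exp lam / (real m * sqrt lam)) *
     (\<Sum>h<m. cis (2 * pi * real h * (real \<alpha> - real \<beta>) / real m) *
        of_real (Gamma (lam + (if h = 0 then 0 else 1 - real h / real m)) *
           lam powr (1 - lam - (if h = 0 then 0 else 1 - real h / real m))))"
proof -
  define g where "g = (\<lambda>h. omega m \<alpha> \<beta> powi (- int h) *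
        of_real (Gamma (lam + real h / real m) * lam powr (1 - lam - real h / real m)))"
  \<comment> \<open>An involution of the indices, congruent to \<open>- h\<close> modulo
    \<open>m\<close>.\<close>
  define \<pi> where "\<pi> = (\<lambda>h. if h = 0 then 0 else m - h)"
  have "(\<Sum>h<m. g h) = (\<Sum>h<m. g (\<pi> h))"
    by (rule sum.reindex_bij_witness[of _ \<pi> \<pi>]) (use m in \<open>auto simp: \<pi>_def\<close>)
  also have "\<dots> = (\<Sum>h<m. cis (2 * pi * real h * (real \<alpha> - real \<beta>) / real m) *
        of_real (Gamma (lam + (if h = 0 then 0 else 1 - real h / real m)) *
           lam powr (1 - lam - (if h = 0 then 0 else 1 - real h / real m))))"
  proof (rule sum.cong[OF refl])
    fix h assume h: "h \<in> {..<m}"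
    have om: "omega m \<alpha> \<beta> powi (- int k) = cis (- (2 * pi * real k * (real \<alpha> - real \<beta>) / real m))" for k
      unfolding omega_def by (simp add: power_int_minus Complex.DeMoivre cis_inverse mult_ac)
    have "cis (- (2 * pi * real (m - h) * (real \<alpha> - real \<beta>) / real m)) =
        cis (2 * pi * real h * (real \<alpha> - real \<beta>) / real m)"
    proof -
      have "- (2 * pi * real (m - h) * (real \<alpha> - real \<beta>) / real m) =
          2 * pi * real h * (real \<alpha> - real \<beta>) / real m + 2 * pi * of_int (int \<beta> - int \<alpha>)"
        using h m by (simp add: of_nat_diff field_simps)
      then show ?thesis by (simp only: cis_mult[symmetric] cis_multiple_2pi Ints_of_int mult_1_right)
    qed
    moreover have "real (m - h) / real m = 1 - real h / real m"
      using h m by (simp add: of_nat_diff field_simps)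
    ultimately show "g (\<pi> h) = cis (2 * pi * real h * (real \<alpha> - real \<beta>) / real m) *
        of_real (Gamma (lam + (if h = 0 then 0 else 1 - real h / real m)) *
           lam powr (1 - lam - (if h = 0 then 0 else 1 - real h / real m)))"
      unfolding g_def om by (auto simp: \<pi>_def)
  qed
  finally show ?thesis unfolding P1_def g_def by simp
qed

text \<open>The prefactor of \<open>P1\<close> cancels the leading terms of Stirling's formula and
  leaves \<open>2 * pi / m\<close> times \<open>exp (E h l)\<close>. The exponent has an expansion
  in \<open>1 / l = x / w1\<close> without signs, whereas \<open>qrr_exponent\<close> carries
  \<open>(-1) ^ t\<close>; this accounts for the argument \<open>- x\<close>. Negative
  \<open>w1\<close> and \<open>x\<close> keep \<open>l\<close> positive.\<close>

theorem P1_asymp: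
  assumes m: "m > 0" and w1: "w1 < 0"
  shows "(\<lambda>x. P1 m (w1 / x) \<alpha> \<beta> -
                  of_real (2 * pi) *
                  (\<Sum>k<N. fps_nth (P1_series m w1 \<beta> \<alpha>) k * of_real (- x) ^ k))
               \<in> O[at_left 0](\<lambda>x. of_real x ^ N)"
proof -
  define s where "s = (\<lambda>h. if h = 0 then 0 else 1 - real h / real m)"
  define E where "E = (\<lambda>h l. ln_Gamma (l + s h) - ((l + s h - 1 / 2) * ln l - l + ln (2 * pi) / 2))"
  define e where "e = (\<lambda>h. cis (2 * pi * real h * (real \<alpha> - real \<beta>) / real m))"
  have s: "0 \<le> s h" "s h \<le> 1" if "h < m" for h using that m by (auto simp: s_def)
  have P: "P1 m l \<alpha> \<beta> = of_real (2 * pi / real m) * (\<Sum>h<m. e h * exp (of_real (E h l)))" if l: "l > 0" for l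
  proof -
    have "sqrt (2 * pi) * exp l / (real m * sqrt l) * (Gamma (l + s h) * l powr (1 - l - s h)) = 2 * pi / real m * exp (E h l)"
      if h: "h < m" for h
    proof -
      have g: "Gamma (l + s h) = exp (ln_Gamma (l + s h))"
        using l s[OF h] by (intro Gamma_real_pos_exp) auto
      have sq: "sqrt y = exp (ln y / 2)" if "y > 0" for y :: real
        using that by (simp flip: ln_sqrt)
      have "sqrt (2 * pi) = exp (ln (2 * pi) / 2)" by (rule sq) simp
      moreover have "sqrt l = exp (ln l / 2)" using l by (rule sq)
      moreover have "2 * pi = exp (ln (2 * pi))" by simp
      moreover have "l powr (1 - l - s h) = exp ((1 - l - s h) * ln l)" using l by (simp add: powr_def)
      ultimately have "sqrt (2 * pi) * exp l * (Gamma (l + s h) * l powr (1 - l - s h)) =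
          exp (ln (2 * pi) / 2 + l + (ln_Gamma (l + s h) + (1 - l - s h) * ln l))"
        unfolding g by (simp only: exp_add)
      also have "ln (2 * pi) / 2 + l + (ln_Gamma (l + s h) + (1 - l - s h) * ln l) = ln (2 * pi) + ln l / 2 + E h l"
        unfolding E_def by (simp add: field_simps)
      also have "exp \<dots> = 2 * pi * sqrt l * exp (E h l)"
        using \<open>sqrt l = exp (ln l / 2)\<close> \<open>2 * pi = exp (ln (2 * pi))\<close> by (simp only: exp_add)
      finally have "sqrt (2 * pi) * exp l * (Gamma (l + s h) * l powr (1 - l - s h)) = 2 * pi * sqrt l * exp (E h l)" .
      then show ?thesis using l m by (simp add: field_simps)
    qed
    then have "(\<Sum>h<m. e h * of_real (sqrt (2 * pi) * exp l / (real m * sqrt l) * (Gamma (l + s h) * l powr (1 - l - s h))))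
       = (\<Sum>h<m. e h * complex_of_real (2 * pi / real m * exp (E h l)))"
      by (intro sum.cong refl) auto
    moreover have "P1 m l \<alpha> \<beta> = of_real (sqrt (2 * pi) * exp l / (real m * sqrt l)) *
        (\<Sum>h<m. e h * of_real (Gamma (l + s h) * l powr (1 - l - s h)))"
      unfolding P1_reflected[OF m] s_def e_def ..
    ultimately show ?thesis by (simp add: sum_distrib_left mult_ac exp_of_real)
  qed
  \<comment> \<open>On this interval \<open>w1 / x > 2\<close>, inside the range of the Stirling
    estimate.\<close>
  have ev: "\<forall>\<^sub>F x in at_left 0. x \<in> {w1 / 2<..<0}"
    by (rule eventually_at_leftI[of "w1 / 2"]) (use w1 in auto)
  let ?G = "\<lambda>N x. P1 m (w1 / x) \<alpha> \<beta> -
                  of_real (2 * pi) *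
                  (\<Sum>k<N. fps_nth (P1_series m w1 \<beta> \<alpha>) k * of_real (- x) ^ k)"
  have main: "?G N \<in> O[at_left 0](\<lambda>x. of_real x ^ N)" if N: "N \<noteq> 0" for N
  proof -
    let ?Q = "\<lambda>h x. \<Sum>k<N. fps_nth (fps_exp 1 oo qrr_exponent m w1 h) k * complex_of_real (- x) ^ k"
    let ?q = "\<lambda>h x. \<Sum>k<N. fps_nth (qrr_exponent m w1 h) k * complex_of_real (- x) ^ k"
    let ?D = "\<lambda>x. of_real (2 * pi / real m) * (\<Sum>h<m. e h * (exp (complex_of_real (E h (w1 / x))) - ?Q h x))"
    have E: "(\<lambda>x. exp (complex_of_real (E h (w1 / x))) -
        ?Q h x) \<in> O[at_left 0](\<lambda>x. complex_of_real (- x) ^ N)"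
      if h: "h < m" for h
    proof (rule exp_fps_asymp)
      show "fps_nth (qrr_exponent m w1 h) 0 = 0" by (simp add: qrr_exponent_def)
      show "((\<lambda>x. complex_of_real (- x)) \<longlongrightarrow> 0) (at_left 0)"
        by (auto intro!: tendsto_eq_intros)
      show "N > 0" using N by simp
      define \<sigma> where "\<sigma> = 1 - s h"
      \<comment> \<open>For \<open>h = 0\<close> the point is \<open>\<sigma> = 1\<close> and the
        values agree by \<open>bernoulli_poly_at_1\<close>; otherwise
        \<open>\<sigma> = h / m\<close>.\<close>
      have bern: "bernoulli_poly (t + 1) \<sigma> = bernoulli_poly (t + 1) (real h / real m)" if "t \<ge> 1" for t
        using that bernoulli_poly_at_1[of "t + 1"] by (auto simp: \<sigma>_def s_def)
      obtain C where C: "\<And>x. x \<ge> 2 \<Longrightarrow> \<bar>ln_Gamma (x + 1 - \<sigma>) - ((x + 1 / 2 - \<sigma>) * ln x - x + ln (2 * pi) / 2 +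
           (\<Sum>t\<in>{1..<N}. bernoulli_poly (t + 1) \<sigma> / (real t * (real t + 1)) / x ^ t))\<bar> \<le> C / x ^ N"
        using ln_Gamma_stirling[of \<sigma> N] s[OF h] N unfolding \<sigma>_def by auto
      show "(\<lambda>x. complex_of_real (E h (w1 / x)) - ?q h x)
          \<in> O[at_left 0](\<lambda>x. complex_of_real (- x) ^ N)"
      proof (rule bigoI[of _ "C / \<bar>w1\<bar> ^ N"], rule eventually_mono[OF ev])
        fix x assume x: "x \<in> {w1 / 2<..<0}"
        define l where "l = w1 / x"
        have l: "l \<ge> 2" using x by (simp add: l_def field_simps)
        have "?q h x =
           (\<Sum>k\<in>{1..<N}. fps_nth (qrr_exponent m w1 h) k * complex_of_real (- x) ^ k)"
          by (rule sum.mono_neutral_right) (auto simp: qrr_exponent_def)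
        also have "\<dots> = (\<Sum>k\<in>{1..<N}. complex_of_real (bernoulli_poly (k + 1) \<sigma> / (real k * (real k + 1)) / l ^ k))"
        proof (rule sum.cong[OF refl])
          fix k assume k: "k \<in> {1..<N}"
          have "(-1) ^ k * (1 / w1) ^ k * (- x) ^ k = ((-1) * (1 / w1) * (- x)) ^ k"
            by (simp only: power_mult_distrib)
          also have "(-1) * (1 / w1) * (- x) = 1 / l" by (simp add: l_def)
          finally have "(-1) ^ k * (1 / w1) ^ k * (- x) ^ k = 1 / l ^ k" by (simp add: power_divide)
          note eq = this
          have "c / D * b * W * X = b / D * (c * W * X)" for c D b W X :: real
            by (simp add: divide_inverse)
          then have "(- 1) ^ k / (real k * (real k + 1)) * bernoulli_poly (k + 1) (real h / real m) * (1 / w1) ^ k * (- x) ^ k =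
              bernoulli_poly (k + 1) (real h / real m) / (real k * (real k + 1)) * ((-1) ^ k * (1 / w1) ^ k * (- x) ^ k)" .
          also have "\<dots> = bernoulli_poly (k + 1) (real h / real m) / (real k * (real k + 1)) / l ^ k"
            by (simp only: eq times_divide_eq_right mult_1_right)
          finally have "(- 1) ^ k / (real k * (real k + 1)) * bernoulli_poly (k + 1) (real h / real m) * (1 / w1) ^ k * (- x) ^ k =
              bernoulli_poly (k + 1) (real h / real m) / (real k * (real k + 1)) / l ^ k" .
          then show "fps_nth (qrr_exponent m w1 h) k * complex_of_real (- x) ^ k = complex_of_real (bernoulli_poly (k + 1) \<sigma> / (real k * (real k + 1)) / l ^ k)"
            using k bern[of k] unfolding qrr_exponent_def of_real_power[symmetric]
            by (simp del: of_real_power of_real_mult of_real_divide of_real_minus of_real_add add: of_real_mult[symmetric])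
        qed
        finally have "complex_of_real (E h (w1 / x)) - ?q h x =
           complex_of_real (ln_Gamma (l + 1 - \<sigma>) - ((l + 1 / 2 - \<sigma>) * ln l - l + ln (2 * pi) / 2 +
           (\<Sum>t\<in>{1..<N}. bernoulli_poly (t + 1) \<sigma> / (real t * (real t + 1)) / l ^ t)))"
          unfolding E_def l_def[symmetric] \<sigma>_def by (simp add: algebra_simps)
        then have "norm (complex_of_real (E h (w1 / x)) - ?q h x) \<le> C / l ^ N"
          using C[OF l] by (simp only: norm_of_real)
        also have "C / l ^ N = C / \<bar>w1\<bar> ^ N * norm (complex_of_real (- x) ^ N)"
        proof -
          have "l = \<bar>w1\<bar> / \<bar>x\<bar>" using x w1 by (simp add: l_def)
          then show ?thesis by (simp add: norm_power power_divide)
        qed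
        finally show "norm (complex_of_real (E h (w1 / x)) - ?q h x)
           \<le> C / \<bar>w1\<bar> ^ N * norm (complex_of_real (- x) ^ N)" .
      qed
    qed
    have "(\<lambda>x. ?D x) \<in> O[at_left 0](\<lambda>x. complex_of_real (- x) ^ N)"
    proof -
      have cm: "(\<lambda>x. a * f x) \<in> O[at_left 0](g)" if "f \<in> O[at_left 0](g)" for a :: complex and f g :: "real \<Rightarrow> complex"
        using that by (cases "a = 0") auto
      show ?thesis by (rule cm, rule big_sum_in_bigo, rule cm, rule E) simp
    qed
    moreover have eq: "\<forall>\<^sub>F x in at_left 0. ?D x = ?G N x"
    proof (rule eventually_mono[OF ev])
      fix x assume x: "x \<in> {w1 / 2<..<0}"
      have ser: "fps_nth (P1_series m w1 \<beta> \<alpha>) k = (1 / of_nat m) * (\<Sum>h<m. e h * fps_nth (fps_exp 1 oo qrr_exponent m w1 h) k)" for k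
        unfolding P1_series_def e_def by (simp add: fps_sum_nth)
      have "w1 / x > 0" using x w1 by (simp add: zero_less_divide_iff)
      then have "P1 m (w1 / x) \<alpha> \<beta> = of_real (2 * pi / real m) * (\<Sum>h<m. e h * exp (complex_of_real (E h (w1 / x))))"
        by (rule P)
      moreover have "of_real (2 * pi) * (\<Sum>k<N. fps_nth (P1_series m w1 \<beta> \<alpha>) k * of_real (- x) ^ k) =
          of_real (2 * pi / real m) * (\<Sum>h<m. e h * ?Q h x)"
      proof -
        have "(\<Sum>k<N. fps_nth (P1_series m w1 \<beta> \<alpha>) k * of_real (- x) ^ k) =
            (1 / of_nat m) * (\<Sum>k<N. \<Sum>h<m. e h * (fps_nth (fps_exp 1 oo qrr_exponent m w1 h) k * complex_of_real (- x) ^ k))"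
          unfolding ser by (simp only: sum_distrib_left sum_distrib_right mult.assoc)
        then show ?thesis
          by (subst (asm) sum.swap) (simp add: sum_distrib_left)
      qed
      ultimately show "?D x = ?G N x"
        by (simp only: right_diff_distrib sum_subtractf)
    qed
    ultimately have "?G N \<in> O[at_left 0](\<lambda>x. complex_of_real (- x) ^ N)"
      using landau_o.big.in_cong[OF eq] by blast
    moreover have "(\<lambda>x. complex_of_real (- x) ^ N) \<in> O[at_left 0](\<lambda>x. complex_of_real x ^ N)"
      by (intro bigoI[of _ 1]) (simp add: norm_power)
    ultimately show ?thesis by (rule landau_o.big_trans)
  qed
  show ?thesis
  proof (cases "N = 0")
    \<comment> \<open>Order 0 asserts only boundedness, which follows from order 1.\<close>
    case True
    have "(\<lambda>x. complex_of_real x ^ 1) \<in> O[at_left 0](\<lambda>_. 1)"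
      by (rule bigoI_tendsto[of _ _ 0]) (auto intro!: tendsto_eq_intros)
    from landau_o.big_trans[OF main[of 1] this]
    have "?G 1 \<in> O[at_left 0](\<lambda>_. 1)" by simp
    from sum_in_bigo(1)[OF this bigo_const[of "of_real (2 * pi) * fps_nth (P1_series m w1 \<beta> \<alpha>) 0"]]
    have "(\<lambda>x. P1 m (w1 / x) \<alpha> \<beta>) \<in> O[at_left 0](\<lambda>_. 1)" by simp
    then show ?thesis using True by simp
  qed (rule main)
qed

subsection \<open>Straight thimbles for special parameters\<close>

text \<open>The function \<open>sgn (x - x0) * sqrt (V x - V x0)\<close> is an increasing bijection
  of the line with a continuous positive derivative, also at the minimum, and its inverse is the
  parametrisation. Growth of \<open>V\<close> at both ends gives surjectivity.\<close>

lemma convex_square_parametrisation: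
  fixes V V' V'' :: "real \<Rightarrow> real"
  assumes V: "\<And>x. (V has_real_derivative V' x) (at x)"
    and V': "\<And>x. (V' has_real_derivative V'' x) (at x)"
    and pos: "\<And>x. V'' x > 0" and x0: "V' x0 = 0"
    and top: "filterlim V at_top at_top" and bot: "filterlim V at_top at_bot"
  shows "\<exists>\<xi> \<xi>'. \<xi> 0 = x0 \<and> bij \<xi> \<and> (\<forall>t. (\<xi> has_real_derivative \<xi>' t) (at t)) \<and>
     continuous_on UNIV \<xi>' \<and> (\<forall>t. \<xi>' t > 0) \<and> (\<forall>t. V (\<xi> t) = V x0 + t\<^sup>2)"
proof -
  have V'mono: "V' x < V' y" if "x < y" for x y
    by (rule DERIV_pos_imp_increasing[OF that]) (use V' pos in blast)
  have V'sgn: "V' x > 0" if "x > x0" for x using V'mono[OF that] x0 by simp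
  have V'sgn': "V' x < 0" if "x < x0" for x using V'mono[OF that] x0 by simp
  have min: "V x > V x0" if "x \<noteq> x0" for x
  proof (cases "x > x0")
    case True
    then show ?thesis
      by (rule DERIV_pos_imp_increasing_open)
         (use V V'sgn in \<open>auto intro!: continuous_at_imp_continuous_on DERIV_isCont\<close>)
  next
    case False
    then have "x < x0" using that by simp
    then show ?thesis
      by (rule DERIV_neg_imp_decreasing_open)
         (use V V'sgn' in \<open>auto intro!: continuous_at_imp_continuous_on DERIV_isCont\<close>)
  qed
  \<comment> \<open>By Taylor's formula \<open>V x - V x0\<close> is about
    \<open>V'' x0 / 2 * (x - x0)^2\<close>, so this is the slope of \<open>\<psi>\<close> at
    \<open>x0\<close>.\<close>
  define \<kappa> where "\<kappa> = sqrt (V'' x0 / 2)"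
  have \<kappa>: "\<kappa> > 0" "V'' x0 = 2 * \<kappa>\<^sup>2" using pos[of x0] by (auto simp: \<kappa>_def)
  define \<psi> where "\<psi> = (\<lambda>x. sgn (x - x0) * sqrt (V x - V x0))"
  have sq: "(\<psi> x)\<^sup>2 = V x - V x0" for x
    using min[of x] by (cases "x = x0") (auto simp: \<psi>_def power_mult_distrib sgn_if)
  have \<psi>0: "\<psi> x0 = 0" by (simp add: \<psi>_def)
  have \<psi>nz: "\<psi> x \<noteq> 0" if "x \<noteq> x0" for x using sq[of x] min[OF that] by auto
  define \<psi>' where "\<psi>' = (\<lambda>x. if x = x0 then \<kappa> else V' x / (2 * \<psi> x))"
  have Vq: "((\<lambda>x. V' x / (x - x0)) \<longlongrightarrow> V'' x0) (at x0)"
    using V'[of x0] x0 by (simp add: has_field_derivative_iff)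
  have "((\<lambda>x. (V x - V x0) / (x - x0)\<^sup>2) \<longlongrightarrow> V'' x0 / 2) (at x0)"
  proof (rule lhopital)
    have "isCont V x0" by (rule DERIV_isCont[OF V])
    then show "((\<lambda>x. V x - V x0) \<longlongrightarrow> 0) (at x0)" by (simp add: isCont_def LIM_zero_iff)
    show "((\<lambda>x. (x - x0)\<^sup>2) \<longlongrightarrow> 0) (at x0)" by (auto intro!: tendsto_eq_intros)
    show "\<forall>\<^sub>F x in at x0. (x - x0)\<^sup>2 \<noteq> 0" "\<forall>\<^sub>F x in at x0. 2 * (x - x0) \<noteq> 0"
      by (auto simp: eventually_at_filter)
    show "\<forall>\<^sub>F x in at x0. ((\<lambda>x. V x - V x0) has_real_derivative V' x) (at x)"
      by (auto intro!: always_eventually derivative_eq_intros V)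
    show "\<forall>\<^sub>F x in at x0. ((\<lambda>x. (x - x0)\<^sup>2) has_real_derivative 2 * (x - x0)) (at x)"
      by (auto intro!: always_eventually derivative_eq_intros)
    show "((\<lambda>x. V' x / (2 * (x - x0))) \<longlongrightarrow> V'' x0 / 2) (at x0)"
      using tendsto_divide[OF Vq tendsto_const[of 2]] by (simp add: mult.commute)
  qed
  then have "((\<lambda>x. sqrt ((V x - V x0) / (x - x0)\<^sup>2)) \<longlongrightarrow> \<kappa>) (at x0)"
    unfolding \<kappa>_def by (rule tendsto_real_sqrt)
  moreover have "sqrt ((V x - V x0) / (x - x0)\<^sup>2) = \<psi> x / (x - x0)" for x
    by (auto simp: \<psi>_def real_sqrt_divide sgn_if abs_if) (metis minus_diff_eq minus_divide_right)
  ultimately have \<psi>q: "((\<lambda>x. \<psi> x / (x - x0)) \<longlongrightarrow> \<kappa>) (at x0)" by simp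
  have d\<psi>: "(\<psi> has_real_derivative \<psi>' x) (at x)" for x
  proof (cases "x = x0")
    case True
    then show ?thesis using \<psi>q \<psi>0 by (simp add: has_field_derivative_iff \<psi>'_def)
  next
    case False
    define c where "c = sgn (x - x0)"
    have c: "c * c = 1" "c \<noteq> 0" using False by (auto simp: c_def sgn_if)
    have "((\<lambda>x. c * sqrt (V x - V x0)) has_real_derivative \<psi>' x) (at x)"
      using min[OF False] c False
      by (auto intro!: derivative_eq_intros V simp: \<psi>'_def \<psi>_def c_def[symmetric] field_simps)
    moreover have "open (if x > x0 then {x0<..} else {..<x0})" "x \<in> (if x > x0 then {x0<..} else {..<x0})"
      using False by auto
    ultimately show ?thesis
      by (rule has_field_derivative_transform_within_open)
         (use False in \<open>auto simp: \<psi>_def c_def sgn_if split: if_splits\<close>)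
  qed
  have c\<psi>': "isCont \<psi>' x" for x
  proof (cases "x = x0")
    case True
    have "((\<lambda>x. (V' x / (x - x0)) / (2 * (\<psi> x / (x - x0)))) \<longlongrightarrow> V'' x0 / (2 * \<kappa>)) (at x0)"
      by (intro tendsto_intros Vq \<psi>q) (use \<kappa> in auto)
    then have "(\<psi>' \<longlongrightarrow> V'' x0 / (2 * \<kappa>)) (at x0)"
      by (rule Lim_transform_eventually) (auto simp: \<psi>'_def eventually_at_filter)
    then show ?thesis using True \<kappa> by (simp add: isCont_def \<psi>'_def power2_eq_square)
  next
    case False
    have "isCont (\<lambda>x. V' x / (2 * \<psi> x)) x"
      using \<psi>nz[OF False] by (intro continuous_intros DERIV_isCont[OF V'] DERIV_isCont[OF d\<psi>]) auto
    moreover have "\<forall>\<^sub>F y in nhds x. \<psi>' y = V' y / (2 * \<psi> y)"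
      using t1_space_nhds[OF False] by eventually_elim (simp add: \<psi>'_def)
    ultimately show ?thesis using isCont_cong by fastforce
  qed
  have \<psi>'pos: "\<psi>' x > 0" for x
  proof (cases x x0 rule: linorder_cases)
    case less
    then have "\<psi> x < 0" using min[of x] by (auto simp: \<psi>_def sgn_if)
    then show ?thesis using V'sgn'[OF less] less by (simp add: \<psi>'_def divide_neg_neg)
  next
    case greater
    then have "\<psi> x > 0" using min[of x] by (auto simp: \<psi>_def sgn_if)
    then show ?thesis using V'sgn[OF greater] greater by (simp add: \<psi>'_def)
  qed (use \<kappa> in \<open>simp add: \<psi>'_def\<close>)
  have \<psi>mono: "strict_mono \<psi>"
    by (rule strict_monoI, rule DERIV_pos_imp_increasing) (use d\<psi> \<psi>'pos in blast)+
  have c\<psi>: "isCont \<psi> x" for x by (rule DERIV_isCont[OF d\<psi>])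
  have surj: "\<exists>x. \<psi> x = t" for t
  proof (cases "t \<ge> 0")
    case True
    have "\<forall>\<^sub>F x in at_top. x > x0 \<and> V x \<ge> V x0 + t\<^sup>2"
      using top eventually_gt_at_top[of x0] by (auto simp: filterlim_at_top eventually_conj_iff)
    then obtain b where b: "b > x0" "V b \<ge> V x0 + t\<^sup>2"
      using eventually_happens trivial_limit_at_top_linorder by blast
    have "\<bar>t\<bar> \<le> sqrt (V b - V x0)" using b by (intro real_le_rsqrt) auto
    then have "\<psi> b \<ge> t" using b by (simp add: \<psi>_def)
    then show ?thesis using IVT[of \<psi> x0 t b] c\<psi> b True \<psi>0 by auto
  next
    case False
    have "\<forall>\<^sub>F x in at_bot. x < x0 \<and> V x \<ge> V x0 + t\<^sup>2"
      using bot eventually_gt_at_bot[of x0] by (auto simp: filterlim_at_top eventually_conj_iff)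
    then obtain b where b: "b < x0" "V b \<ge> V x0 + t\<^sup>2"
      using eventually_happens trivial_limit_at_bot_linorder by blast
    have "\<bar>t\<bar> \<le> sqrt (V b - V x0)" using b by (intro real_le_rsqrt) auto
    then have "\<psi> b \<le> t" using b False by (simp add: \<psi>_def)
    then show ?thesis using IVT[of \<psi> b t x0] c\<psi> b False \<psi>0 by auto
  qed
  have bij: "bij \<psi>" using surj strict_mono_imp_inj_on[OF \<psi>mono] by (metis bijI surjI)
  define \<xi> where "\<xi> = inv \<psi>"
  have \<psi>\<xi>: "\<psi> (\<xi> t) = t" for t unfolding \<xi>_def by (rule surj_f_inv_f[OF bij_is_surj[OF bij]])
  have \<xi>\<psi>: "\<xi> (\<psi> t) = t" for t unfolding \<xi>_def by (rule inv_f_f[OF bij_is_inj[OF bij]])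
  have c\<xi>: "isCont \<xi> t" for t
    using isCont_inverse_function[of 1 "\<xi> t" \<xi> \<psi>] \<xi>\<psi> c\<psi> \<psi>\<xi> by simp
  have d\<xi>: "(\<xi> has_real_derivative inverse (\<psi>' (\<xi> t))) (at t)" for t
    by (rule DERIV_inverse_function[where a = "t - 1" and b = "t + 1", OF d\<psi>])
       (use \<psi>'pos[of "\<xi> t"] \<psi>\<xi> c\<xi> in auto)
  show ?thesis
  proof (intro exI conjI allI)
    show "\<xi> 0 = x0" using \<xi>\<psi>[of x0] \<psi>0 by simp
    show "bij \<xi>" unfolding \<xi>_def by (rule bij_imp_bij_inv[OF bij])
    show "(\<xi> has_real_derivative inverse (\<psi>' (\<xi> t))) (at t)" for t by (rule d\<xi>)
    show "continuous_on UNIV (\<lambda>t. inverse (\<psi>' (\<xi> t)))"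
      by (intro continuous_at_imp_continuous_on ballI continuous_intros isCont_o2[OF c\<xi> c\<psi>'])
         (use \<psi>'pos less_imp_neq in \<open>metis order_less_irrefl\<close>)
    show "inverse (\<psi>' (\<xi> t)) > 0" for t using \<psi>'pos by simp
    show "V (\<xi> t) = V x0 + t\<^sup>2" for t using sq[of "\<xi> t"] \<psi>\<xi>[of t] by simp
  qed
qed

section \<open>Exponentials off the real axis\<close>

lemma mult_cos_less_sin:
  fixes \<theta> :: real
  assumes "0 < \<theta>" "\<theta> < pi / 2"
  shows "\<theta> * cos \<theta> < sin \<theta>"
proof -
  have "sin 0 - 0 * cos 0 < sin \<theta> - \<theta> * cos \<theta>"
  proof (rule DERIV_pos_imp_increasing_open[OF assms(1)])
    fix x :: real assume x: "0 < x" "x < \<theta>"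
    have "((\<lambda>x. sin x - x * cos x) has_real_derivative x * sin x) (at x)"
      by (auto intro!: derivative_eq_intros)
    moreover have "x * sin x > 0" using x assms by (intro mult_pos_pos sin_gt_zero) auto
    ultimately show "\<exists>y. ((\<lambda>x. sin x - x * cos x) has_real_derivative y) (at x) \<and> 0 < y" by blast
  qed (auto intro!: continuous_intros)
  then show ?thesis by simp
qed

text \<open>With \<open>\<sigma> = sin \<theta> / \<theta>\<close> one has
  \<open>cos \<theta> < \<sigma> <= 1\<close>, so the left side is less than
  \<open>\<sigma> * (1 + D)\<close>, and this is at most \<open>exp D\<close>. The graph of
  \<open>exp\<close> thus lies above a line whose value and slope come from the complex exponential
  at angle \<open>\<theta>\<close>.\<close>

lemma cos_plus_sinc_mult_less_exp:
  fixes \<theta> D :: real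
  assumes "\<theta> \<noteq> 0" "\<bar>\<theta>\<bar> < pi / 2"
  shows "cos \<theta> + sin \<theta> / \<theta> * D < exp D"
proof -
  define \<sigma> where "\<sigma> = sin \<bar>\<theta>\<bar> / \<bar>\<theta>\<bar>"
  have eq: "cos \<theta> = cos \<bar>\<theta>\<bar>" "sin \<theta> / \<theta> = \<sigma>" by (auto simp: \<sigma>_def abs_if)
  have 1: "cos \<bar>\<theta>\<bar> < \<sigma>" unfolding \<sigma>_def
    using mult_cos_less_sin[of "\<bar>\<theta>\<bar>"] assms by (subst pos_less_divide_eq) (auto simp: mult.commute)
  have 2: "\<sigma> \<le> 1" unfolding \<sigma>_def using sin_x_le_x[of "\<bar>\<theta>\<bar>"] assms by (subst pos_divide_le_eq) auto
  have 3: "\<sigma> > 0" using 1 cos_gt_zero_pi[of "\<bar>\<theta>\<bar>"] assms by linarith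
  have "\<sigma> * (1 + D) \<le> exp D"
  proof (cases "1 + D \<ge> 0")
    case True
    then have "\<sigma> * (1 + D) \<le> 1 + D" using 2 3 by (intro mult_left_le_one_le) auto
    then show ?thesis using exp_ge_add_one_self[of D] by linarith
  next
    case False
    then have "\<sigma> * (1 + D) < 0" using 3 by (intro mult_pos_neg) auto
    then show ?thesis using exp_gt_zero[of D] by linarith
  qed
  then show ?thesis unfolding eq using 1 by (simp add: algebra_simps)
qed

text \<open>Each exponential lies above the line through \<open>exp a * cos \<theta>\<close> of slope \<open>exp a * sin \<theta> / \<theta>\<close>;
  the vanishing imaginary part makes these slopes cancel against the linear term.\<close>

lemma off_axis_below:
  fixes a b p s x v X :: real
  assumes v: "v \<noteq> 0" "\<bar>a * v\<bar> < pi / 2" "\<bar>b * v\<bar> < pi / 2" and a: "a > 0" and b: "b > 0" and s: "s \<ge> 0"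
    and im: "exp (a * x) * sin (a * v) - s * (exp (- (b * x)) * sin (b * v)) + p * v = 0"
  shows "exp (a * x) * cos (a * v) + s * (exp (- (b * x)) * cos (b * v)) + p * x
           < exp (a * X) + s * exp (- (b * X)) + p * X"
proof -
  define \<sigma>a \<sigma>b where "\<sigma>a = sin (a * v) / (a * v)" and "\<sigma>b = sin (b * v) / (b * v)"
  have "(exp (a * x) * (a * \<sigma>a) - s * (exp (- (b * x)) * (b * \<sigma>b)) + p) * v = 0"
    using im a b v(1) by (simp add: \<sigma>a_def \<sigma>b_def algebra_simps)
  then have p: "p = s * (exp (- (b * x)) * (b * \<sigma>b)) - exp (a * x) * (a * \<sigma>a)" using v(1) by simp
  have "exp (a * x) * (cos (a * v) + \<sigma>a * (a * (X - x))) < exp (a * x) * exp (a * (X - x))"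
    unfolding \<sigma>a_def using v a by (intro mult_strict_left_mono cos_plus_sinc_mult_less_exp) auto
  moreover have "s * (exp (- (b * x)) * (cos (b * v) + \<sigma>b * (- (b * (X - x))))) \<le> s * (exp (- (b * x)) * exp (- (b * (X - x))))"
    unfolding \<sigma>b_def using v b s
    by (intro mult_left_mono less_imp_le[OF cos_plus_sinc_mult_less_exp]) auto
  ultimately show ?thesis
    unfolding p by (simp add: algebra_simps flip: exp_add)
qed

section \<open>The superpotential on a horizontal line\<close>

lemma W_T_exp:
  "W_T m n p q = (\<lambda>y. exp (of_nat m * y) + (\<Sum>l\<in>{1..<m}. q (int l) * exp (of_nat l * y))
     + (\<Sum>l\<in>{1..n}. q (- int l) * exp (- (of_nat l * y))) + of_real p * y)"
  by (rule ext) (simp add: W_T_def exp_power_int exp_of_nat_mult)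

lemma has_field_derivative_W_T:
  "(W_T m n p q has_field_derivative
     (of_nat m * exp (of_nat m * y) + (\<Sum>l\<in>{1..<m}. q (int l) * (of_nat l * exp (of_nat l * y)))
     + (\<Sum>l\<in>{1..n}. q (- int l) * (- (of_nat l * exp (- (of_nat l * y))))) + of_real p)) (at y)"
  unfolding W_T_exp
  by (auto intro!: derivative_eq_intros sum.cong simp: mult_ac sum_negf)

text \<open>The phase makes \<open>W_T\<close> real, up to a constant, on the line of imaginary part \<open>2 * pi * \<beta> / m\<close>.\<close>

definition ray_parameter :: "nat \<Rightarrow> nat \<Rightarrow> nat \<Rightarrow> real \<Rightarrow> int \<Rightarrow> complex" where
  "ray_parameter m n \<beta> s = (\<lambda>k. if k = - int n then of_real s * cis (real n * (2 * pi * real \<beta> / real m)) else 0)"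

lemma W_T_ray_parameter:
  assumes "n > 0"
  shows "W_T m n p (ray_parameter m n \<beta> s) = (\<lambda>y. exp (of_nat m * y)
     + of_real s * cis (real n * (2 * pi * real \<beta> / real m)) * exp (- (of_nat n * y)) + of_real p * y)"
proof -
  have "(\<Sum>l\<in>{1..n}. ray_parameter m n \<beta> s (- int l) * exp (- (of_nat l * y))) =
     of_real s * cis (real n * (2 * pi * real \<beta> / real m)) * exp (- (of_nat n * y))" for y :: complex
    using assms by (subst sum.remove[of _ n]) (auto simp: ray_parameter_def)
  then show ?thesis unfolding W_T_exp by (simp add: ray_parameter_def)
qed

context
  fixes m n \<beta> :: nat and p s \<tau> :: real and W :: "complex \<Rightarrow> complex"
  assumes m: "m > 0" and n: "n > 0" and p: "p < 0" and s: "s > 0"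
    and \<tau>: "\<tau> = 2 * pi * real \<beta> / real m" and W: "W = W_T m n p (ray_parameter m n \<beta> s)"
begin

text \<open>On the line \<open>Im y = \<tau>\<close> the first exponential is real since
  \<open>m * \<tau>\<close> is a multiple of \<open>2 * pi\<close>; the second becomes real through
  the phase of the parameter.\<close>

lemma cis_ray_eqs:
  fixes x v :: real
  defines "y \<equiv> Complex x (\<tau> + v)"
  shows "exp (of_nat m * y) = of_real (exp (real m * x)) * cis (real m * v)"
    and "cis (real n * \<tau>) * exp (- (of_nat n * y)) = of_real (exp (- (real n * x))) * cis (- (real n * v))"
proof -
  have "real m * (\<tau> + v) = real m * v + 2 * pi * real_of_int (int \<beta>)"
    using m by (simp add: \<tau> field_simps)
  then have "cis (real m * (\<tau> + v)) = cis (real m * v)"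
    by (simp only: cis_mult[symmetric] cis_multiple_2pi Ints_of_int mult_1_right)
  then show "exp (of_nat m * y) = of_real (exp (real m * x)) * cis (real m * v)"
    by (subst exp_eq_polar) (simp add: y_def)
  have "cis (real n * \<tau>) * cis (- (real n * (\<tau> + v))) = cis (- (real n * v))"
    by (simp add: cis_mult algebra_simps)
  then show "cis (real n * \<tau>) * exp (- (of_nat n * y)) = of_real (exp (- (real n * x))) * cis (- (real n * v))"
    by (subst exp_eq_polar) (simp add: y_def mult.left_commute[of "cis _"])
qed

lemma ray_W:
  "W (Complex x (\<tau> + v)) =
     Complex (exp (real m * x) * cos (real m * v) + s * (exp (- (real n * x)) * cos (real n * v)) + p * x)
             (exp (real m * x) * sin (real m * v) - s * (exp (- (real n * x)) * sin (real n * v)) + p * (\<tau> + v))"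
  unfolding W W_T_ray_parameter[OF n] \<tau>[symmetric] mult.assoc[of "of_real s"] cis_ray_eqs
  by (simp add: complex_eq_iff)

lemma ray_deriv_W:
  "deriv W (Complex x (\<tau> + v)) =
     Complex (real m * exp (real m * x) * cos (real m * v) - s * (real n * exp (- (real n * x)) * cos (real n * v)) + p)
             (real m * exp (real m * x) * sin (real m * v) + s * (real n * exp (- (real n * x)) * sin (real n * v)))"
proof -
  let ?y = "Complex x (\<tau> + v)"
  have "(W has_field_derivative (of_nat m * exp (of_nat m * ?y) - of_real s * (of_nat n * (cis (real n * \<tau>) * exp (- (of_nat n * ?y)))) + of_real p)) (at ?y)"
    unfolding W W_T_ray_parameter[OF n] \<tau>[symmetric]
    by (auto intro!: derivative_eq_intros simp: mult_ac)
  from DERIV_imp_deriv[OF this] show ?thesis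
    unfolding cis_ray_eqs by (simp add: complex_eq_iff)
qed

text \<open>On the horizontal line \<open>W\<close> is, up to a constant, the strictly convex
  function \<open>V\<close>, so the line carries the parametrisation. Since \<open>thimble\<close>
  is a connected component, other parts of the level set must be kept away: by
  \<open>off_axis_below\<close> a point of the strip off the line at which \<open>Im W\<close> has
  the critical value satisfies \<open>Re W < V x1\<close>, so the line is isolated in the level
  set.\<close>

lemma ray_thimble_param:
  assumes x1: "deriv W (Complex x1 \<tau>) = 0"
  shows "\<exists>g. thimble_param W (exp (Complex x1 \<tau>)) g"
proof -
  define V where "V = (\<lambda>x. exp (real m * x) + s * exp (- (real n * x)) + p * x)"
  define V' where "V' = (\<lambda>x. real m * exp (real m * x) - s * (real n * exp (- (real n * x))) + p)"
  define V'' where "V'' = (\<lambda>x. (real m)\<^sup>2 * exp (real m * x) + s * ((real n)\<^sup>2 * exp (- (real n * x))))"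
  have pos: "real m > 0" "real n > 0" using m n by auto
  have "V' x1 = 0" using x1 ray_deriv_W[of x1 0] by (simp add: V'_def complex_eq_iff)
  moreover have "(V has_real_derivative V' x) (at x)" for x
    unfolding V_def V'_def by (auto intro!: derivative_eq_intros)
  moreover have "(V' has_real_derivative V'' x) (at x)" for x
    unfolding V'_def V''_def by (auto intro!: derivative_eq_intros simp: power2_eq_square)
  moreover have "V'' x > 0" for x
    unfolding V''_def using m s by (intro add_pos_nonneg) auto
  moreover have "filterlim V at_top at_top"
  proof (rule filterlim_at_top_mono)
    show "filterlim (\<lambda>x. exp (real m * x) + p * x) at_top at_top"
      using pos p by real_asymp
    show "\<forall>\<^sub>F x in at_top. exp (real m * x) + p * x \<le> V x"
      using s by (simp add: V_def)
  qed
  moreover have "filterlim V at_top at_bot"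
  proof (rule filterlim_at_top_mono)
    show "filterlim (\<lambda>x. p * x) at_top at_bot"
      using p by real_asymp
    show "\<forall>\<^sub>F x in at_bot. p * x \<le> V x"
      using s by (simp add: V_def add_nonneg_nonneg)
  qed
  ultimately obtain \<xi> \<xi>' where \<xi>: "\<xi> 0 = x1" "bij \<xi>" "\<And>t. (\<xi> has_real_derivative \<xi>' t) (at t)"
     "continuous_on UNIV \<xi>'" "\<And>t. \<xi>' t > 0" "\<And>t. V (\<xi> t) = V x1 + t\<^sup>2"
    using convex_square_parametrisation[of V V' V'' x1] by blast
  have WV: "W (Complex x \<tau>) = Complex (V x) (p * \<tau>)" for x
    using ray_W[of x 0] by (simp add: V_def)
  define g where "g = (\<lambda>t. Complex (\<xi> t) \<tau>)"
  \<comment> \<open>In a strip of this half width both angles \<open>m * v\<close> and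
    \<open>n * v\<close> stay below \<open>pi / 2\<close>.\<close>
  define D where "D = pi / (2 * (real m + real n))"
  have D: "D > 0" using m by (simp add: D_def)
  let ?S = "{y. W y - W (g 0) \<in> \<real>\<^sub>\<ge>\<^sub>0}"
  let ?L = "{y. Im y = \<tau>}"
  have strip: "Im y = \<tau>" if y: "y \<in> ?S" "\<bar>Im y - \<tau>\<bar> < D" for y
  proof (rule ccontr)
    assume ne: "Im y \<noteq> \<tau>"
    define x v where "x = Re y" and "v = Im y - \<tau>"
    have yv: "y = Complex x (\<tau> + v)" by (simp add: x_def v_def)
    have g0: "W (g 0) = Complex (V x1) (p * \<tau>)" using \<xi>(1) by (simp add: g_def WV)
    have re: "Re (W y) \<ge> V x1" and im: "Im (W y) = p * \<tau>"
      using y(1) g0 by (auto simp: complex_nonneg_Reals_iff)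
    have bound: "\<bar>real k * v\<bar> < pi / 2" if "k \<le> m + n" for k
    proof -
      have "\<bar>real k * v\<bar> \<le> (real m + real n) * \<bar>v\<bar>"
        using that by (simp add: abs_mult mult_right_mono)
      also have "\<dots> < (real m + real n) * D"
        using y(2) m by (intro mult_strict_left_mono) (auto simp: v_def)
      also have "\<dots> = pi / 2" using m by (simp add: D_def divide_simps)
      finally show ?thesis .
    qed
    have "Re (W y) < V x1"
      using off_axis_below[of v "real m" "real n" s x p x1] ne bound[of m] bound[of n] m n s im
      unfolding yv ray_W V_def by (simp add: v_def algebra_simps)
    with re show False by simp
  qed
  have LS: "?L \<subseteq> ?S"
  proof
    fix y assume "y \<in> ?L"
    then have "y = Complex (Re y) \<tau>" by (simp add: complex_eq_iff)
    then have "W y = Complex (V (Re y)) (p * \<tau>)" using WV[of "Re y"] by metis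
    moreover obtain t where "\<xi> t = Re y" using \<xi>(2) by (metis bij_pointE)
    ultimately have "W y - W (g 0) = of_real (t\<^sup>2)"
      using \<xi>(6)[of t] \<xi>(1) by (simp add: g_def WV complex_eq_iff)
    then show "y \<in> ?S" by (simp del: of_real_power)
  qed
  have g0L: "g 0 \<in> ?L" by (simp add: g_def)
  have "thimble W (g 0) = ?L"
  proof
    have "connected ?L"
      by (rule convex_connected) (auto simp: convex_def algebra_simps simp flip: distrib_right)
    then show "?L \<subseteq> thimble W (g 0)" unfolding thimble_def
      by (intro connected_component_maximal g0L LS)
    define C where "C = thimble W (g 0)"
    have C: "connected C" "C \<subseteq> ?S" "g 0 \<in> C"
      unfolding C_def thimble_def using g0L LS by (auto simp: connected_component_subset connected_component_refl_eq)
    let ?O = "{y. \<bar>Im y - \<tau>\<bar> < D}"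
    have "open ?O" "open (- ?L)"
      by (auto intro!: open_Collect_less closed_Collect_eq continuous_intros simp: open_Compl)
    \<comment> \<open>The strip and the complement of the line are open, cover the component and are
      disjoint on it. The component is connected and meets the strip in \<open>g 0\<close>, so it
      misses the complement of the line.\<close>
    moreover have "?O \<inter> - ?L \<inter> C = {}" using strip C(2) by auto
    moreover have "C \<subseteq> ?O \<union> - ?L" using D by auto
    ultimately have "?O \<inter> C = {} \<or> - ?L \<inter> C = {}" using C(1) by (rule connectedD[rotated])
    moreover have "g 0 \<in> ?O \<inter> C" using C(3) g0L D by auto
    ultimately show "thimble W (g 0) \<subseteq> ?L" unfolding C_def by blast
  qed
  moreover have "bij_betw g UNIV ?L"
  proof (rule bij_betwI')
    fix y assume "y \<in> ?L"
    moreover obtain t where "\<xi> t = Re y" using \<xi>(2) by (metis bij_pointE)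
    ultimately show "\<exists>t\<in>UNIV. y = g t" by (auto simp: g_def complex_eq_iff intro!: exI[of _ t])
  qed (use \<xi>(2) in \<open>auto simp: g_def bij_def inj_def\<close>)
  moreover have dg: "(g has_vector_derivative of_real (\<xi>' t)) (at t)" for t
  proof -
    have "g = (\<lambda>t. of_real (\<xi> t) + of_real \<tau> * \<i>)" by (auto simp: g_def complex_eq_iff)
    moreover have "((\<lambda>t. complex_of_real (\<xi> t)) has_vector_derivative of_real (\<xi>' t)) (at t)"
      using \<xi>(3)[of t] unfolding has_real_derivative_iff_has_vector_derivative
      by (rule bounded_linear.has_vector_derivative[OF bounded_linear_of_real])
    ultimately show ?thesis
      using has_vector_derivative_add[OF _ has_vector_derivative_const[of "of_real \<tau> * \<i>"]] by fastforce
  qed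
  moreover have "g C1_differentiable_on UNIV"
    unfolding C1_differentiable_on_def using dg \<xi>(4)
    by (intro exI[of _ "\<lambda>t. of_real (\<xi>' t)"]) (auto intro!: continuous_intros)
  moreover have "W (g t) = W (g 0) + of_real (t\<^sup>2)" for t
    using \<xi>(6)[of t] \<xi>(1) by (simp add: g_def WV complex_eq_iff)
  moreover have "Re (vector_derivative g (at 0)) > 0"
    using vector_derivative_at[OF dg] \<xi>(5) by simp
  ultimately show ?thesis
    unfolding thimble_param_def by (intro exI[of _ g]) (simp add: g_def \<xi>(1))
qed

end

text \<open>A logarithm of \<open>limit_crit\<close> with an explicit branch. The branch matters
  because \<open>W_T\<close> is periodic only up to a constant.\<close>

definition critical_log :: "nat \<Rightarrow> real \<Rightarrow> nat \<Rightarrow> complex" where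
  "critical_log m p \<beta> = Complex (ln (root m (- p / real m))) (2 * pi * real \<beta> / real m)"

lemma exp_critical_log:
  assumes "m > 0" "p < 0"
  shows "exp (critical_log m p \<beta>) = limit_crit m p \<beta>"
proof -
  have "root m (- p / real m) > 0" using assms by (simp add: divide_neg_pos)
  then show ?thesis
    by (subst exp_eq_polar) (simp add: critical_log_def limit_crit_def)
qed

lemma limit_crit_nonzero:
  assumes "m > 0" "p < 0"
  shows "limit_crit m p \<beta> \<noteq> 0"
  using exp_critical_log[OF assms, of \<beta>] exp_not_eq_zero by metis

text \<open>The principal logarithm is taken of a quotient which is close to 1 in the applications,
  away from the branch cut. The lift of a nearby critical point then depends continuously on it,
  even if the point itself lies near the negative axis.\<close>

lemma Ln_quotient_lift:
  assumes "m > 0" "p < 0" "P \<noteq> 0"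
  shows "exp (critical_log m p \<beta> + Ln (P / limit_crit m p \<beta>)) = P"
  using assms limit_crit_nonzero[OF assms(1,2), of \<beta>] by (simp add: exp_add exp_critical_log)

lemma tendsto_Ln_quotient:
  assumes "m > 0" "p < 0" "(f \<longlongrightarrow> limit_crit m p \<beta>) F"
  shows "((\<lambda>x. Ln (f x / limit_crit m p \<beta>)) \<longlongrightarrow> 0) F"
proof -
  have "((\<lambda>x. Ln (f x / limit_crit m p \<beta>)) \<longlongrightarrow> Ln (limit_crit m p \<beta> / limit_crit m p \<beta>)) F"
    by (intro tendsto_Ln tendsto_divide assms tendsto_const) (use limit_crit_nonzero[OF assms(1,2)] in auto)
  then show ?thesis using limit_crit_nonzero[OF assms(1,2), of \<beta>] by simp
qed

lemma tendsto_ray_parameter: "(ray_parameter m n \<beta> \<longlongrightarrow> (\<lambda>_. 0)) (at_right 0)"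
proof -
  have "continuous_on UNIV (ray_parameter m n \<beta>)"
  proof (rule continuous_on_coordinatewise_then_product)
    show "continuous_on UNIV (\<lambda>s. ray_parameter m n \<beta> s k)" for k
      by (cases "k = - int n") (auto simp: ray_parameter_def intro!: continuous_intros)
  qed
  then have "(ray_parameter m n \<beta> \<longlongrightarrow> ray_parameter m n \<beta> 0) (at 0)"
    by (simp add: continuous_on_def)
  then have "(ray_parameter m n \<beta> \<longlongrightarrow> ray_parameter m n \<beta> 0) (at_right 0)"
    by (rule filterlim_mono[OF _ order_refl]) (simp add: at_le)
  moreover have "ray_parameter m n \<beta> 0 = (\<lambda>_. 0)" by (auto simp: ray_parameter_def)
  ultimately show ?thesis by simp
qed

lemma filterlim_ray_parameter:
  "filterlim (ray_parameter m n \<beta>) (at (\<lambda>_. 0) within parameters n) (at_right 0)"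
  unfolding filterlim_at
proof
  have "ray_parameter m n \<beta> s \<in> parameters n \<and> ray_parameter m n \<beta> s \<noteq> (\<lambda>_. 0)" if "s > 0" for s
  proof -
    have "ray_parameter m n \<beta> s (- int n) \<noteq> 0" using that by (simp add: ray_parameter_def)
    then show ?thesis unfolding parameters_def by auto
  qed
  then show "\<forall>\<^sub>F s in at_right 0. ray_parameter m n \<beta> s \<in> parameters n \<and> ray_parameter m n \<beta> s \<noteq> (\<lambda>_. 0)"
    by (simp add: eventually_at_filter)
qed (rule tendsto_ray_parameter)

text \<open>The positive number \<open>s\<close> is sent to zero along \<open>ray_parameter\<close>.
  The hypotheses on \<open>crit\<close> place the critical point only near the horizontal line, and
  \<open>ray_thimble_param\<close> needs it exactly there. The imaginary part of
  \<open>deriv W\<close> is a sum of two terms that have the sign of the offset \<open>v\<close>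
  when \<open>v\<close> is small, so \<open>v = 0\<close>.\<close>

lemma thimble_parameters_accumulate:
  assumes m: "m > 0" and n: "n > 0" and p: "p < 0" and \<beta>: "\<beta> < m"
    and crit: "\<forall>\<^sub>F q in at (\<lambda>_. 0) within parameters n. crit q ` {..<m + n} = critical_points (W_T m n p q)"
    and lim: "((\<lambda>q. crit q \<beta>) \<longlongrightarrow> limit_crit m p \<beta>) (at (\<lambda>_. 0) within parameters n)"
  shows "at (\<lambda>_. 0) within thimble_parameters m n p crit \<beta> \<noteq> bot"
proof -
  let ?q = "ray_parameter m n \<beta>"
  define \<tau> where "\<tau> = 2 * pi * real \<beta> / real m"
  define \<eta> where "\<eta> = (\<lambda>s. Ln (crit (?q s) \<beta> / limit_crit m p \<beta>))"
  note ray = filterlim_ray_parameter[of m n \<beta>]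
  have "(\<eta> \<longlongrightarrow> 0) (at_right 0)"
    unfolding \<eta>_def by (rule tendsto_Ln_quotient[OF m p filterlim_compose[OF lim ray]])
  \<comment> \<open>This bound keeps \<open>m * v\<close> and \<open>n * v\<close> between
    \<open>- pi\<close> and \<open>pi\<close>, where \<open>sin\<close> has the sign of its
    argument.\<close>
  then have ev1: "\<forall>\<^sub>F s in at_right 0. norm (\<eta> s) < pi / (real m + real n)"
    using m by (auto simp: tendsto_iff dest!: spec[of _ "pi / (real m + real n)"])
  have ev2: "\<forall>\<^sub>F s in at_right 0. crit (?q s) ` {..<m + n} = critical_points (W_T m n p (?q s))"
    using ray[unfolded filterlim_iff, rule_format, OF crit] .
  have ev3: "\<forall>\<^sub>F s in at_right (0::real). s > 0" by (simp add: eventually_at_filter)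
  have "\<forall>\<^sub>F s in at_right 0. ?q s \<in> thimble_parameters m n p crit \<beta>"
    using ev1 ev2 ev3
  proof eventually_elim
    case (elim s)
    define W where "W = W_T m n p (?q s)"
    note dW = ray_deriv_W[OF m n p elim(3) \<tau>_def W_def]
    have "crit (?q s) \<beta> \<in> critical_points W" using elim(2) \<beta> unfolding W_def by auto
    then obtain y where y: "crit (?q s) \<beta> = exp y" "deriv W y = 0" unfolding critical_points_def by auto
    define x v where "x = ln (root m (- p / real m)) + Re (\<eta> s)" and "v = Im (\<eta> s)"
    have eq: "critical_log m p \<beta> + \<eta> s = Complex x (\<tau> + v)"
      by (simp add: critical_log_def x_def v_def \<tau>_def complex_eq_iff)
    have "exp (Complex x (\<tau> + v)) = exp y"
      using Ln_quotient_lift[OF m p, of "exp y" \<beta>] unfolding y(1)[symmetric] eq[symmetric] \<eta>_def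
      by (simp add: y(1))
    \<comment> \<open>The logarithm provided by \<open>critical_points\<close> may lie on another
      sheet, but the derivative of \<open>W\<close> is periodic, in contrast to \<open>W\<close>
      itself.\<close>
    then obtain k where "Complex x (\<tau> + v) = y + of_int (2 * k) * of_real pi * \<i>" by (auto simp: exp_eq)
    then have "y = Complex x (\<tau> + (v - 2 * pi * of_int k))"
      by (simp add: complex_eq_iff algebra_simps)
    then have "deriv W (Complex x (\<tau> + (v - 2 * pi * of_int k))) = 0" using y(2) by simp
    moreover have "sin (real j * (v - 2 * pi * of_int k)) = sin (real j * v)"
      "cos (real j * (v - 2 * pi * of_int k)) = cos (real j * v)" for j
    proof -
      have "real j * (v - 2 * pi * of_int k) = real j * v + 2 * pi * real_of_int (- k * int j)" by (simp add: algebra_simps)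
      then have "cis (real j * (v - 2 * pi * of_int k)) = cis (real j * v)"
        by (simp only: cis_mult[symmetric] cis_multiple_2pi Ints_of_int mult_1_right)
      then show "sin (real j * (v - 2 * pi * of_int k)) = sin (real j * v)"
        "cos (real j * (v - 2 * pi * of_int k)) = cos (real j * v)" by (simp_all add: complex_eq_iff)
    qed
    ultimately have d0: "deriv W (Complex x (\<tau> + v)) = 0" unfolding dW by simp
    have "v = 0"
    proof (rule ccontr)
      assume v: "v \<noteq> 0"
      have b: "\<bar>real k * v\<bar> < pi" if "k \<le> m + n" for k
      proof -
        have "\<bar>real k * v\<bar> \<le> (real m + real n) * \<bar>v\<bar>"
          using that by (simp add: abs_mult mult_right_mono)
        also have "\<dots> < (real m + real n) * (pi / (real m + real n))"
          using elim(1) abs_Im_le_cmod[of "\<eta> s"] m by (intro mult_strict_left_mono) (auto simp: v_def)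
        finally show ?thesis using m by simp
      qed
      have sg: "sin (real k * v) * v > 0" if "k \<le> m + n" "k > 0" for k
      proof (cases "v > 0")
        case True
        then show ?thesis using b[OF that(1)] that(2) by (intro mult_pos_pos sin_gt_zero) auto
      next
        case False
        then have "sin (real k * (- v)) > 0" using b[OF that(1)] that(2) v by (intro sin_gt_zero) (auto simp: mult_pos_neg)
        then show ?thesis using False v by (simp add: mult_neg_neg)
      qed
      have "real m * exp (real m * x) * (sin (real m * v) * v) + s * (real n * exp (- (real n * x)) * (sin (real n * v) * v)) > 0"
        using mult_pos_pos[OF _ sg[of m], of "real m * exp (real m * x)"]
          mult_pos_pos[OF _ sg[of n], of "s * (real n * exp (- (real n * x)))"] m n elim(3) by (simp add: mult.assoc)
      then have "(real m * exp (real m * x) * sin (real m * v) + s * (real n * exp (- (real n * x)) * sin (real n * v))) * v > 0"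
        by (simp add: algebra_simps)
      moreover have "real m * exp (real m * x) * sin (real m * v) + s * (real n * exp (- (real n * x)) * sin (real n * v)) = 0"
        using d0 unfolding dW by (simp add: complex_eq_iff)
      ultimately show False by simp
    qed
    then have "deriv W (Complex x \<tau>) = 0" "exp (Complex x \<tau>) = crit (?q s) \<beta>"
      using d0 y(1) \<open>exp (Complex x (\<tau> + v)) = exp y\<close> by auto
    then have "\<exists>g. thimble_param W (crit (?q s) \<beta>) g"
      using ray_thimble_param[OF m n p elim(3) \<tau>_def W_def] by metis
    moreover have "?q s \<in> parameters n"
      using elim(3) by (simp add: parameters_def ray_parameter_def)
    ultimately show ?case unfolding thimble_parameters_def W_def by simp
  qed
  moreover have "\<forall>\<^sub>F s in at_right 0. ?q s \<noteq> (\<lambda>_. 0)"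
    using ray by (auto simp: filterlim_at elim: eventually_mono)
  ultimately have "filterlim ?q (at (\<lambda>_. 0) within thimble_parameters m n p crit \<beta>) (at_right 0)"
    unfolding filterlim_at using tendsto_ray_parameter by (auto intro: eventually_conj)
  then show ?thesis by (auto simp: filterlim_def bot_unique filtermap_bot_iff trivial_limit_at_right_real)
qed

subsection \<open>Perturbation of the limit thimble\<close>

lemma compact_positive_lower_bound:
  fixes f :: "'a :: topological_space \<Rightarrow> real"
  assumes "compact K" "continuous_on K f" "\<And>x. x \<in> K \<Longrightarrow> f x > 0"
  shows "\<exists>\<mu>>0. \<forall>x\<in>K. \<mu> \<le> f x"
proof (cases "K = {}")
  case False
  from continuous_attains_inf[OF assms(1) False assms(2)] assms(3) show ?thesis by blast
qed (auto intro!: exI[of _ 1])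

definition W_lim :: "nat \<Rightarrow> real \<Rightarrow> complex \<Rightarrow> complex" where
  "W_lim m p y = exp (of_nat m * y) + of_real p * y"

lemma has_field_derivative_W_lim [derivative_intros]:
  "(W_lim m p has_field_derivative of_nat m * exp (of_nat m * y) + of_real p) (at y within S)"
  unfolding W_lim_def by (auto intro!: derivative_eq_intros)

lemma holomorphic_on_W_lim: "W_lim m p holomorphic_on S"
  unfolding W_lim_def by (intro holomorphic_intros)

lemma continuous_on_W_lim [continuous_intros]:
  "continuous_on S f \<Longrightarrow> continuous_on S (\<lambda>x. W_lim m p (f x))"
  unfolding W_lim_def by (intro continuous_intros)

lemma deriv_deriv_W_lim: "deriv (deriv (W_lim m p)) y = (of_nat m)\<^sup>2 * exp (of_nat m * y)"
proof -
  have "deriv (W_lim m p) = (\<lambda>y. of_nat m * exp (of_nat m * y) + of_real p)"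
    by (rule ext, rule DERIV_imp_deriv, rule has_field_derivative_W_lim)
  moreover have "((\<lambda>y. of_nat m * exp (of_nat m * y) + of_real p) has_field_derivative (of_nat m)\<^sup>2 * exp (of_nat m * y)) (at y)"
    by (auto intro!: derivative_eq_intros simp: power2_eq_square)
  ultimately show ?thesis by (simp add: DERIV_imp_deriv)
qed

text \<open>Closeness is required on a strip only, as the perturbing monomials are unbounded on the
  plane. Holomorphy is included so that closeness passes to derivatives by Cauchy's
  estimate.\<close>

definition close_to_W_lim :: "nat \<Rightarrow> real \<Rightarrow> real \<Rightarrow> real \<Rightarrow> (complex \<Rightarrow> complex) \<Rightarrow> bool" where
  "close_to_W_lim m p A \<epsilon> W \<longleftrightarrow> W holomorphic_on UNIV \<and> (\<forall>y. \<bar>Re y\<bar> \<le> A \<longrightarrow> norm (W y - W_lim m p y) \<le> \<epsilon>)"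

lemma close_to_W_lim_mono:
  "close_to_W_lim m p A \<epsilon> W \<Longrightarrow> A' \<le> A \<Longrightarrow> \<epsilon> \<le> \<epsilon>' \<Longrightarrow> close_to_W_lim m p A' \<epsilon>' W"
  unfolding close_to_W_lim_def by (meson order.trans)

lemma eventually_close_to_W_lim:
  assumes "\<epsilon> > 0"
  shows "\<forall>\<^sub>F q in at (\<lambda>_. 0) within S. close_to_W_lim m p A \<epsilon> (W_T m n p q)"
proof -
  \<comment> \<open>A majorant of the perturbation on the strip. It involves finitely many
    coordinates and is therefore continuous in the product topology.\<close>
  define N :: "(int \<Rightarrow> complex) \<Rightarrow> real" where
    "N = (\<lambda>q. (\<Sum>l\<in>{1..<m}. norm (q (int l)) * exp (real l * A)) + (\<Sum>l\<in>{1..n}. norm (q (- int l)) * exp (real l * A)))"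
  have "continuous_on UNIV N" unfolding N_def
    by (intro continuous_intros continuous_on_product_coordinates)
  then have "(N \<longlongrightarrow> N (\<lambda>_. 0)) (at (\<lambda>_. 0))" by (simp add: continuous_on_def)
  then have "(N \<longlongrightarrow> 0) (at (\<lambda>_. 0) within S)"
    by (simp add: N_def) (rule filterlim_mono[OF _ order_refl at_le], auto)
  then have "\<forall>\<^sub>F q in at (\<lambda>_. 0) within S. N q < \<epsilon>"
    using assms by (rule order_tendstoD)
  then show ?thesis
  proof eventually_elim
    case (elim q)
    have "norm (W_T m n p q y - W_lim m p y) \<le> \<epsilon>" if y: "\<bar>Re y\<bar> \<le> A" for y
    proof -
      have e: "norm (exp (of_nat l * y)) \<le> exp (real l * A)" "norm (exp (- (of_nat l * y))) \<le> exp (real l * A)" for l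
      proof -
        have "real l * Re y \<le> real l * A" using y by (intro mult_left_mono) auto
        then show "norm (exp (of_nat l * y)) \<le> exp (real l * A)" by simp
        have "real l * (- Re y) \<le> real l * A" using y by (intro mult_left_mono) auto
        then show "norm (exp (- (of_nat l * y))) \<le> exp (real l * A)" by simp
      qed
      have "W_T m n p q y - W_lim m p y = (\<Sum>l\<in>{1..<m}. q (int l) * exp (of_nat l * y))
          + (\<Sum>l\<in>{1..n}. q (- int l) * exp (- (of_nat l * y)))"
        unfolding W_T_exp W_lim_def by simp
      also have "norm \<dots> \<le> N q" unfolding N_def
        by (intro norm_triangle_mono sum_norm_le; simp only: norm_mult; intro mult_left_mono e norm_ge_zero)
      finally show ?thesis using elim by simp
    qed
    moreover have "W_T m n p q holomorphic_on UNIV"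
      unfolding holomorphic_on_def field_differentiable_def using has_field_derivative_W_T
      by (blast intro: has_field_derivative_at_within)
    ultimately show ?case unfolding close_to_W_lim_def by blast
  qed
qed

text \<open>Cauchy's estimate on a disc of radius 1, which costs 1 in the width of the strip. The
  factor 4 is \<open>fact 2\<close> times 2, the latter because the values have to lie in an open
  ball.\<close>

lemma close_to_W_lim_deriv2:
  assumes W: "close_to_W_lim m p A \<epsilon> W" and y: "\<bar>Re y\<bar> \<le> A - 1" and \<epsilon>: "\<epsilon> > 0"
  shows "norm (deriv (deriv W) y - (of_nat m)\<^sup>2 * exp (of_nat m * y)) \<le> 4 * \<epsilon>"
proof -
  let ?f = "\<lambda>y. W y - W_lim m p y"
  have hW: "W holomorphic_on UNIV" using W by (simp add: close_to_W_lim_def)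
  have hf: "?f holomorphic_on UNIV" by (intro holomorphic_on_diff hW holomorphic_on_W_lim)
  have "norm ((deriv ^^ 2) ?f y) \<le> fact 2 * (2 * \<epsilon>) / 1 ^ 2"
  proof (rule Cauchy_higher_deriv_bound)
    show "?f holomorphic_on ball y 1" by (rule holomorphic_on_subset[OF hf]) auto
    show "continuous_on (cball y 1) ?f"
      using holomorphic_on_imp_continuous_on[OF hf] continuous_on_subset by blast
    fix w assume "w \<in> ball y 1"
    then have "\<bar>Re w\<bar> \<le> A" using y abs_Re_le_cmod[of "y - w"] by (simp add: dist_norm)
    then show "?f w \<in> ball 0 (2 * \<epsilon>)" using W \<epsilon> unfolding close_to_W_lim_def by fastforce
  qed auto
  moreover have "(deriv ^^ 2) ?f y = deriv (deriv W) y - (of_nat m)\<^sup>2 * exp (of_nat m * y)"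
    using higher_deriv_diff[OF hW holomorphic_on_W_lim open_UNIV UNIV_I, of 2 m p y] deriv_deriv_W_lim
    by (simp add: numeral_2_eq_2)
  ultimately show ?thesis by simp
qed

lemma deriv_along_square_param:
  assumes W: "W holomorphic_on UNIV" and G: "(G has_vector_derivative G') (at (t::real))"
    and WG: "\<And>t. W (G t) = W (G 0) + of_real (t\<^sup>2)"
  shows "deriv W (G t) * G' = of_real (2 * t)"
proof -
  have "((W \<circ> G) has_vector_derivative G' * deriv W (G t)) (at t)"
    by (rule field_vector_diff_chain_at[OF G holomorphic_derivI[OF W open_UNIV UNIV_I]])
  moreover have "((W \<circ> G) has_vector_derivative of_real (2 * t)) (at t)"
  proof -
    have "((\<lambda>t::real. t\<^sup>2) has_vector_derivative 2 * t) (at t)"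
      unfolding has_real_derivative_iff_has_vector_derivative[symmetric] by (auto intro!: derivative_eq_intros)
    from has_vector_derivative_add[OF has_vector_derivative_const bounded_linear.has_vector_derivative[OF bounded_linear_of_real this]]
    have "((\<lambda>t::real. W (G 0) + of_real (t\<^sup>2)) has_vector_derivative of_real (2 * t)) (at t)" by simp
    moreover have "W \<circ> G = (\<lambda>t. W (G 0) + of_real (t\<^sup>2))"
      unfolding o_def by (rule ext) (rule WG)
    ultimately show ?thesis by (simp only:)
  qed
  ultimately have "G' * deriv W (G t) = of_real (2 * t)" by (rule vector_derivative_unique_at)
  then show ?thesis by (simp only: mult.commute)
qed

lemma critical_of_square_param:
  assumes "W holomorphic_on UNIV" and "(G has_vector_derivative G') (at (0::real))" "G' \<noteq> 0"
    and "\<And>t. W (G t) = W (G 0) + of_real (t\<^sup>2)"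
  shows "deriv W (G 0) = 0"
  using deriv_along_square_param[OF assms(1,2,4)] assms(3) by simp

text \<open>In the directions \<open>\<i>\<close> and \<open>- \<i>\<close> the second derivative of
  \<open>Re W\<close> is \<open>- Re W''\<close>, so \<open>Re W\<close> is concave on the segment
  with slope zero at the critical point. A curve on which \<open>Re W\<close> stays above the
  critical value therefore cannot meet this segment again.\<close>

lemma Re_less_on_vertical:
  assumes W: "W holomorphic_on UNIV" and crit: "deriv W y1 = 0" and d: "norm w = 1" "w\<^sup>2 = -1" and b: "b > 0"
    and pos: "\<And>s. 0 \<le> s \<Longrightarrow> s \<le> b \<Longrightarrow> Re (deriv (deriv W) (y1 + of_real s * w)) > 0"
  shows "Re (W (y1 + of_real b * w)) < Re (W y1)"
proof -
  have hd: "deriv W holomorphic_on UNIV" by (intro holomorphic_deriv W) auto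
  have lin: "((\<lambda>s::real. y1 + of_real s * w) has_vector_derivative w) (at s)" for s
    by (auto intro!: derivative_eq_intros)
  have f1: "((\<lambda>s. Re (W (y1 + of_real s * w))) has_real_derivative Re (w * deriv W (y1 + of_real s * w))) (at s)" for s
    using field_vector_diff_chain_at[OF lin holomorphic_derivI[OF W open_UNIV UNIV_I]]
    unfolding has_real_derivative_iff_has_vector_derivative o_def
    by (rule bounded_linear.has_vector_derivative[OF bounded_linear_Re])
  have f2: "((\<lambda>s. Re (w * deriv W (y1 + of_real s * w))) has_real_derivative - Re (deriv (deriv W) (y1 + of_real s * w))) (at s)" for s
  proof -
    have "((\<lambda>s. w * deriv W (y1 + of_real s * w)) has_vector_derivative w * (w * deriv (deriv W) (y1 + of_real s * w))) (at s)"
      using field_vector_diff_chain_at[OF lin holomorphic_derivI[OF hd open_UNIV UNIV_I]]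
      unfolding o_def by (rule bounded_linear.has_vector_derivative[OF bounded_linear_mult_right])
    also have "w * (w * deriv (deriv W) (y1 + of_real s * w)) = - deriv (deriv W) (y1 + of_real s * w)"
      using d(2) by (simp add: power2_eq_square flip: mult.assoc)
    finally show ?thesis unfolding has_real_derivative_iff_has_vector_derivative
      using bounded_linear.has_vector_derivative[OF bounded_linear_Re] by fastforce
  qed
  have neg: "Re (w * deriv W (y1 + of_real s * w)) < 0" if s: "0 < s" "s < b" for s
  proof -
    have "Re (w * deriv W (y1 + of_real s * w)) < Re (w * deriv W (y1 + of_real 0 * w))"
    proof (rule DERIV_neg_imp_decreasing[OF s(1)])
      fix x assume "0 \<le> x" "x \<le> s"
      then show "\<exists>y. ((\<lambda>s. Re (w * deriv W (y1 + of_real s * w))) has_real_derivative y) (at x) \<and> y < 0"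
        using f2[of x] pos[of x] s by fastforce
    qed
    then show ?thesis using crit by simp
  qed
  have "Re (W (y1 + of_real b * w)) < Re (W (y1 + of_real 0 * w))"
  proof (rule DERIV_neg_imp_decreasing_open[OF b])
    fix x assume "0 < x" "x < b"
    then show "\<exists>y. ((\<lambda>s. Re (W (y1 + of_real s * w))) has_real_derivative y) (at x) \<and> y < 0"
      using f1[of x] neg[of x] by blast
  qed (auto intro!: continuous_at_imp_continuous_on DERIV_isCont[OF f1])
  then show ?thesis by simp
qed

text \<open>The logarithms of the critical points have critical values whose imaginary parts differ by the nonzero
  multiples of \<open>2 * pi * p / m\<close>.\<close>

lemma critical_value_separation:
  assumes m: "m > 0" and p: "p < 0" and \<alpha>: "\<alpha> < m" and \<beta>: "\<beta> < m" and \<delta>: "\<delta> > 0"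
  shows "\<exists>\<epsilon>>0. \<exists>A. \<forall>W y1 y. close_to_W_lim m p A \<epsilon> W \<longrightarrow> norm (y1 - critical_log m p \<beta>) \<le> \<epsilon> \<longrightarrow>
     norm (exp y - limit_crit m p \<alpha>) \<le> \<epsilon> \<longrightarrow> Im (W y) = Im (W y1) \<longrightarrow>
     \<alpha> = \<beta> \<and> norm (y - critical_log m p \<beta>) \<le> \<delta>"
proof -
  define r where "r = root m (- p / real m)"
  have r: "r > 0" "r ^ m = - p / real m" using m p real_root_pow_pos[of m "- p / real m"] by (auto simp: r_def divide_neg_pos)
  define R where "R = - p / real m"
  have Lm: "exp (of_nat m * critical_log m p \<gamma>) = of_real R" for \<gamma>
  proof -
    have "exp (of_nat m * critical_log m p \<gamma>) = limit_crit m p \<gamma> ^ m"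
      by (simp add: exp_of_nat_mult exp_critical_log m p)
    also have "\<dots> = of_real (r ^ m) * cis (2 * pi * real \<gamma>)"
      using m by (simp add: limit_crit_def r_def power_mult_distrib Complex.DeMoivre)
    also have "cis (2 * pi * real \<gamma>) = 1" using cis_multiple_2pi[of "real \<gamma>"] by simp
    finally show ?thesis using r by (simp add: R_def)
  qed
  \<comment> \<open>A bound for the deviation of \<open>Im W_lim\<close> from its critical value at
    displacement \<open>\<eta>\<close> from a critical point.\<close>
  define h :: "complex \<Rightarrow> real" where "h = (\<lambda>\<eta>. R * norm (exp (of_nat m * \<eta>) - 1) + \<bar>p\<bar> * norm \<eta>)"
  have "(h \<longlongrightarrow> h 0) (at 0)" unfolding h_def by (intro tendsto_intros)
  moreover have h0: "h 0 < \<bar>p\<bar> * (pi / (2 * real m))" using m p by (simp add: h_def mult_neg_pos divide_neg_pos)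
  ultimately have "\<forall>\<^sub>F \<eta> in at 0. h \<eta> < \<bar>p\<bar> * (pi / (2 * real m))" by (rule order_tendstoD)
  with h0 have "\<forall>\<^sub>F \<eta> in nhds 0. h \<eta> < \<bar>p\<bar> * (pi / (2 * real m))" by (simp add: eventually_nhds_conv_at)
  then obtain \<theta> where \<theta>: "\<theta> > 0" "\<And>\<eta>. norm \<eta> < \<theta> \<Longrightarrow> h \<eta> < \<bar>p\<bar> * (pi / (2 * real m))"
    unfolding eventually_nhds_metric by (auto simp: dist_norm)
  define \<theta>' where "\<theta>' = Min {\<theta> / 2, \<delta>, 1}"
  have \<theta>': "\<theta>' > 0" "\<theta>' < \<theta>" "\<theta>' \<le> \<delta>" "\<theta>' \<le> 1" using \<theta>(1) \<delta> by (auto simp: \<theta>'_def)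
  have "(Ln \<longlongrightarrow> Ln 1) (at 1)" by (intro tendsto_Ln tendsto_ident_at) auto
  then have "\<forall>\<^sub>F u in at 1. norm (Ln u) < \<theta>'" using \<theta>'(1) by (auto simp: tendsto_iff)
  then have "\<forall>\<^sub>F u in nhds 1. norm (Ln u) < \<theta>'" using \<theta>'(1) by (simp add: eventually_nhds_conv_at)
  then obtain d where d: "d > 0" "\<And>u. norm (u - 1) < d \<Longrightarrow> norm (Ln u) < \<theta>'"
    unfolding eventually_nhds_metric by (auto simp: dist_norm)
  \<comment> \<open>In units of the gap \<open>2 * pi * \<bar>p\<bar> / m\<close> between
    neighbouring critical values, the two displacements contribute less than 1/4 each and the two
    approximations of \<open>W\<close> at most 1/8 each, which stays below one gap.\<close>
  define \<epsilon> where "\<epsilon> = Min {\<theta>', d * r / 2, r / 2, \<bar>p\<bar> * (pi / (4 * real m))}"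
  have \<epsilon>: "\<epsilon> > 0" "\<epsilon> \<le> \<theta>'" "\<epsilon> \<le> d * r / 2" "\<epsilon> \<le> r / 2" "\<epsilon> \<le> \<bar>p\<bar> * (pi / (4 * real m))"
    using \<theta>'(1) d(1) r(1) m p by (auto simp: \<epsilon>_def mult_neg_pos divide_neg_pos)
  define A where "A = \<bar>ln r\<bar> + 1"
  have ReL: "Re (critical_log m p \<gamma>) = ln r" and ImL: "Im (critical_log m p \<gamma>) = 2 * pi * real \<gamma> / real m" for \<gamma>
    by (auto simp: critical_log_def r_def)
  have R: "R > 0" using m p by (simp add: R_def divide_neg_pos)
  have ImW: "\<bar>Im (W_lim m p (critical_log m p \<gamma> + \<eta>)) - p * (2 * pi * real \<gamma> / real m)\<bar> \<le> h \<eta>" for \<gamma> \<eta>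
  proof -
    have "Im (W_lim m p (critical_log m p \<gamma> + \<eta>)) - p * (2 * pi * real \<gamma> / real m)
        = R * Im (exp (of_nat m * \<eta>) - 1) + p * Im \<eta>"
      unfolding W_lim_def distrib_left exp_add Lm by (simp add: ImL)
    also have "\<bar>\<dots>\<bar> \<le> R * \<bar>Im (exp (of_nat m * \<eta>) - 1)\<bar> + \<bar>p\<bar> * \<bar>Im \<eta>\<bar>"
      using R by (metis abs_mult abs_of_pos abs_triangle_ineq)
    also have "\<dots> \<le> h \<eta>" unfolding h_def using R
      by (intro add_mono mult_left_mono abs_Im_le_cmod) auto
    finally show ?thesis .
  qed
  have main: "\<alpha> = \<beta> \<and> norm (y - critical_log m p \<beta>) \<le> \<delta>"
    if W: "close_to_W_lim m p A \<epsilon> W" and y1: "norm (y1 - critical_log m p \<beta>) \<le> \<epsilon>"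
      and y: "norm (exp y - limit_crit m p \<alpha>) \<le> \<epsilon>" and im: "Im (W y) = Im (W y1)" for W y1 y
  proof -
    define \<eta>1 where "\<eta>1 = y1 - critical_log m p \<beta>"
    define \<eta> where "\<eta> = Ln (exp y / limit_crit m p \<alpha>)"
    have nl: "norm (limit_crit m p \<alpha>) = r" using r(1) by (simp add: limit_crit_def r_def norm_mult)
    have "exp y / limit_crit m p \<alpha> - 1 = (exp y - limit_crit m p \<alpha>) / limit_crit m p \<alpha>"
      using limit_crit_nonzero[OF m p] by (simp add: diff_divide_distrib)
    then have "norm (exp y / limit_crit m p \<alpha> - 1) \<le> \<epsilon> / r"
      using y r by (simp add: norm_divide nl divide_right_mono)
    also have "\<dots> \<le> d / 2" using \<epsilon>(3) r by (simp add: field_simps)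
    also have "\<dots> < d" using d by simp
    finally have \<eta>: "norm \<eta> < \<theta>'" unfolding \<eta>_def by (rule d(2))
    have "exp (critical_log m p \<alpha> + \<eta>) = exp y" unfolding \<eta>_def by (rule Ln_quotient_lift[OF m p]) simp
    from exp_eq[THEN iffD1, OF this[symmetric]]
    obtain k where k: "y = critical_log m p \<alpha> + \<eta> + of_int (2 * k) * of_real pi * \<i>" by auto
    have eqk: "exp (of_nat m * (of_int (2 * k) * of_real pi * \<i>)) = 1"
    proof -
      have "of_nat m * (of_int (2 * k) * of_real pi * \<i>) = 0 + of_real (of_int (2 * (int m * k)) * pi) * \<i>" by simp
      then have "exp (of_nat m * (of_int (2 * k) * of_real pi * \<i>)) = exp 0" unfolding exp_eq by blast
      then show ?thesis by (simp only: exp_zero)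
    qed
    have Wk: "W_lim m p y = W_lim m p (critical_log m p \<alpha> + \<eta>) + of_real p * (of_int (2 * k) * of_real pi * \<i>)"
    proof -
      have "exp (of_nat m * y) = exp (of_nat m * (critical_log m p \<alpha> + \<eta>))"
        unfolding k distrib_left[of "of_nat m" "critical_log m p \<alpha> + \<eta>"] exp_add eqk by simp
      then show ?thesis unfolding W_lim_def by (simp add: k algebra_simps)
    qed
    have Rey: "\<bar>Re y\<bar> \<le> A" "\<bar>Re y1\<bar> \<le> A"
    proof -
      have "Re y = ln r + Re \<eta>" by (simp add: k ReL)
      then show "\<bar>Re y\<bar> \<le> A" using abs_Re_le_cmod[of \<eta>] \<eta> \<theta>' unfolding A_def by linarith
      have "Re y1 = ln r + Re \<eta>1" by (simp add: \<eta>1_def ReL)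
      then show "\<bar>Re y1\<bar> \<le> A" using abs_Re_le_cmod[of \<eta>1] y1 \<epsilon>(2) \<theta>' unfolding A_def \<eta>1_def by linarith
    qed
    have c: "\<bar>Im (W y) - Im (W_lim m p y)\<bar> \<le> \<epsilon>" "\<bar>Im (W y1) - Im (W_lim m p y1)\<bar> \<le> \<epsilon>"
      using W Rey abs_Im_le_cmod[of "W y - W_lim m p y"] abs_Im_le_cmod[of "W y1 - W_lim m p y1"]
      unfolding close_to_W_lim_def by force+
    have h1: "\<bar>Im (W_lim m p y1) - p * (2 * pi * real \<beta> / real m)\<bar> < \<bar>p\<bar> * (pi / (2 * real m))"
      using ImW[of \<beta> \<eta>1] \<theta>(2)[of \<eta>1] y1 \<epsilon>(2) \<theta>'(2) by (simp add: \<eta>1_def)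
    have h2: "\<bar>Im (W_lim m p y) - p * (2 * pi * real \<alpha> / real m) - p * (2 * pi * of_int k)\<bar> < \<bar>p\<bar> * (pi / (2 * real m))"
      using ImW[of \<alpha> \<eta>] \<theta>(2)[of \<eta>] \<eta> \<theta>'(2) by (simp add: Wk)
    \<comment> \<open>The distance of the two critical values counted in gaps, one sheet being worth
      \<open>m\<close> of them. Once it vanishes, \<open>m\<close> divides
      \<open>\<beta> - \<alpha>\<close>, and both indices are below \<open>m\<close>.\<close>
    define J where "J = int \<alpha> - int \<beta> + int m * k"
    have "p * (2 * pi * real \<alpha> / real m) + p * (2 * pi * of_int k) - p * (2 * pi * real \<beta> / real m) = p * (2 * pi / real m) * of_int J"
      using m by (simp add: J_def field_simps)
    moreover have "\<bar>p * (2 * pi * real \<alpha> / real m) + p * (2 * pi * of_int k) - p * (2 * pi * real \<beta> / real m)\<bar>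
       < 2 * \<epsilon> + 2 * (\<bar>p\<bar> * (pi / (2 * real m)))"
    proof -
      have "\<bar>X1 - Y1\<bar> \<le> \<epsilon> \<Longrightarrow> \<bar>X2 - Y2\<bar> \<le> \<epsilon> \<Longrightarrow> \<bar>Y2 - v\<bar> < B \<Longrightarrow> \<bar>Y1 - u1 - u2\<bar> < B \<Longrightarrow> X1 = X2 \<Longrightarrow>
          \<bar>u1 + u2 - v\<bar> < 2 * \<epsilon> + 2 * B" for X1 Y1 X2 Y2 u1 u2 v B :: real
        by linarith
      from this[OF c h1 h2 im] show ?thesis .
    qed
    moreover have "2 * \<epsilon> + 2 * (\<bar>p\<bar> * (pi / (2 * real m))) \<le> \<bar>p\<bar> * (2 * pi / real m)"
    proof -
      define B where "B = \<bar>p\<bar> * (pi / (4 * real m))"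
      have e: "\<bar>p\<bar> * (pi / (2 * real m)) = 2 * B" "\<bar>p\<bar> * (2 * pi / real m) = 8 * B" by (simp_all add: B_def)
      have "\<epsilon> \<le> B" unfolding B_def by (rule \<epsilon>(5))
      then show ?thesis unfolding e using \<epsilon>(1) by linarith
    qed
    ultimately have "\<bar>p * (2 * pi / real m)\<bar> * \<bar>of_int J\<bar> < \<bar>p * (2 * pi / real m)\<bar> * 1"
      by (simp add: abs_mult)
    then have "J = 0" by (subst (asm) mult_less_cancel_left_pos) (use m p in auto)
    then have J: "int \<beta> - int \<alpha> = int m * k" by (simp add: J_def)
    have "k = 0"
    proof (rule ccontr)
      assume "k \<noteq> 0"
      then have "int m * 1 \<le> int m * \<bar>k\<bar>" by (intro mult_left_mono) auto
      also have "\<dots> = \<bar>int \<beta> - int \<alpha>\<bar>" by (simp add: J abs_mult)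
      finally show False using \<alpha> \<beta> by linarith
    qed
    then have "\<alpha> = \<beta>" "y = critical_log m p \<alpha> + \<eta>" using J by (auto simp: k)
    then show ?thesis using \<eta> \<theta>'(3) by auto
  qed
  then show ?thesis by (intro exI[of _ \<epsilon>] conjI exI[of _ A] \<epsilon>(1)) blast
qed

text \<open>This is the uniform estimate behind dominated convergence. If \<open>exp y\<close> is
  away from the pole, a constant will do. Otherwise separation of the critical values forces
  \<open>\<alpha> = \<beta>\<close> and puts \<open>y\<close> next to the critical point
  \<open>y1\<close>: there \<open>t^2 = norm (W y - W y1)\<close> is at most quadratic in
  \<open>y - y1\<close>, while \<open>exp y - exp y1\<close> is bounded below linearly.\<close>

lemma thimble_pole_distance:
  assumes m: "m > 0" and p: "p < 0" and \<alpha>: "\<alpha> < m" and \<beta>: "\<beta> < m"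
  shows "\<exists>\<epsilon>>0. \<exists>A. \<exists>\<kappa>>0. \<forall>W y1 P y t. close_to_W_lim m p A \<epsilon> W \<longrightarrow> norm (y1 - critical_log m p \<beta>) \<le> \<epsilon> \<longrightarrow>
     deriv W y1 = 0 \<longrightarrow> norm (P - limit_crit m p \<alpha>) \<le> \<epsilon> \<longrightarrow> (\<alpha> = \<beta> \<longrightarrow> P = exp y1) \<longrightarrow> W y = W y1 + of_real (t\<^sup>2) \<longrightarrow>
     \<kappa> * min 1 \<bar>t\<bar> \<le> norm (exp y - P)"
proof -
  let ?L = "critical_log m p \<beta>"
  have "((\<lambda>w::complex. (exp w - 1) / w) \<longlongrightarrow> 1) (at 0)"
    using DERIV_exp[of "0::complex"] by (simp add: has_field_derivative_iff)
  then have "\<forall>\<^sub>F w::complex in at 0. norm ((exp w - 1) / w - 1) < 1 / 2"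
    by (auto simp: tendsto_iff dist_norm dest!: spec[of _ "1 / 2"])
  then obtain d where d: "d > 0" "\<And>w::complex. w \<noteq> 0 \<Longrightarrow> norm w < d \<Longrightarrow> norm ((exp w - 1) / w - 1) < 1 / 2"
    unfolding eventually_at by auto
  have lower: "norm w / 2 \<le> norm (exp w - 1)" if w: "norm w < d" for w :: complex
  proof (cases "w = 0")
    case False
    have "1 - norm ((exp w - 1) / w) \<le> norm ((exp w - 1) / w - 1)"
      using norm_triangle_ineq2[of 1 "(exp w - 1) / w"] by (simp add: norm_minus_commute)
    then have "1 / 2 \<le> norm ((exp w - 1) / w)" using d(2)[OF False w] by linarith
    then show ?thesis using False by (simp add: norm_divide field_simps)
  qed auto
  \<comment> \<open>It yields \<open>norm (y - y1) <= 2 * \<delta> < d\<close>, so that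
    \<open>lower\<close> applies, and keeps \<open>y\<close> in the unit ball on which
    \<open>W''\<close> is bounded.\<close>
  define \<delta> where "\<delta> = min (d / 4) (1 / 2)"
  have \<delta>: "\<delta> > 0" "\<delta> \<le> d / 4" "\<delta> \<le> 1 / 2" using d(1) by (auto simp: \<delta>_def)
  obtain \<epsilon>0 A0 where \<epsilon>0: "\<epsilon>0 > 0" and sep: "\<And>W y1 y. close_to_W_lim m p A0 \<epsilon>0 W \<Longrightarrow> norm (y1 - ?L) \<le> \<epsilon>0 \<Longrightarrow>
     norm (exp y - limit_crit m p \<alpha>) \<le> \<epsilon>0 \<Longrightarrow> Im (W y) = Im (W y1) \<Longrightarrow> \<alpha> = \<beta> \<and> norm (y - ?L) \<le> \<delta>"
    using critical_value_separation[OF m p \<alpha> \<beta> \<delta>(1)] by metis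
  define \<epsilon> where "\<epsilon> = Min {\<epsilon>0 / 2, \<delta>, 1 / 4}"
  have \<epsilon>: "\<epsilon> > 0" "\<epsilon> \<le> \<epsilon>0 / 2" "\<epsilon> \<le> \<delta>" "\<epsilon> \<le> 1 / 4" using \<epsilon>0 \<delta> by (auto simp: \<epsilon>_def)
  define a where "a = \<bar>Re ?L\<bar>"
  define A where "A = max A0 (a + 2)"
  \<comment> \<open>A bound for the second derivative of \<open>W\<close> on the unit ball around
    \<open>critical_log\<close>; the summand 1 absorbs \<open>4 * \<epsilon>\<close>.\<close>
  define K where "K = (real m)\<^sup>2 * exp (real m * (a + 1)) + 1"
  have K: "K > 0" unfolding K_def by (intro add_nonneg_pos) auto
  \<comment> \<open>The numerator bounds \<open>norm (exp y1)\<close> from below, the 2 comes from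
    \<open>lower\<close> and \<open>sqrt K\<close> from
    \<open>\<bar>t\<bar> <= sqrt K * norm u\<close>.\<close>
  define c where "c = exp (- a - 1) / (2 * sqrt K)"
  have c: "c > 0" using K by (simp add: c_def)
  define \<kappa> where "\<kappa> = min (\<epsilon>0 / 2) c"
  have \<kappa>: "\<kappa> > 0" "\<kappa> \<le> \<epsilon>0 / 2" "\<kappa> \<le> c" using c \<epsilon>0 by (auto simp: \<kappa>_def)
  have main: "\<kappa> * min 1 \<bar>t\<bar> \<le> norm (exp y - P)"
    if W: "close_to_W_lim m p A \<epsilon> W" and y1: "norm (y1 - ?L) \<le> \<epsilon>"
     and crit: "deriv W y1 = 0" and P: "norm (P - limit_crit m p \<alpha>) \<le> \<epsilon>" "\<alpha> = \<beta> \<Longrightarrow> P = exp y1"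
     and y: "W y = W y1 + of_real (t\<^sup>2)" for W y1 P y t
  proof (cases "norm (exp y - P) \<ge> \<epsilon>0 / 2")
    case True
    have "\<kappa> * min 1 \<bar>t\<bar> \<le> \<kappa> * 1" using \<kappa>(1) by (intro mult_left_mono) auto
    then show ?thesis using True \<kappa>(2) by linarith
  next
    case False
    have "norm (exp y - limit_crit m p \<alpha>) \<le> norm (exp y - P) + norm (P - limit_crit m p \<alpha>)"
      using norm_triangle_ineq[of "exp y - P" "P - limit_crit m p \<alpha>"] by simp
    also have "\<dots> \<le> \<epsilon>0" using False P(1) \<epsilon>(2) by linarith
    finally have n: "norm (exp y - limit_crit m p \<alpha>) \<le> \<epsilon>0" .
    have "\<alpha> = \<beta> \<and> norm (y - ?L) \<le> \<delta>"
    proof (rule sep[OF _ _ n])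
      show "close_to_W_lim m p A0 \<epsilon>0 W"
        by (rule close_to_W_lim_mono[OF W]) (use \<epsilon>(2) \<epsilon>0 in \<open>auto simp: A_def\<close>)
      show "norm (y1 - ?L) \<le> \<epsilon>0" using y1 \<epsilon>(2) \<epsilon>0 by linarith
      show "Im (W y) = Im (W y1)" by (simp add: y)
    qed
    then have ab: "\<alpha> = \<beta>" and yL: "norm (y - ?L) \<le> \<delta>" by auto
    define u where "u = y - y1"
    have "u = (y - ?L) - (y1 - ?L)" by (simp add: u_def)
    then have u: "norm u \<le> 2 * \<delta>" using norm_triangle_ineq4[of "y - ?L" "y1 - ?L"] yL y1 \<epsilon>(3) by simp
    have hW: "W holomorphic_on UNIV" using W by (simp add: close_to_W_lim_def)
    have hd: "deriv W holomorphic_on UNIV" by (intro holomorphic_deriv hW) auto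
    let ?B = "cball ?L 1"
    have y1B: "y1 \<in> ?B" and yB: "y \<in> ?B"
      using y1 yL \<epsilon>(4) \<delta>(3) by (auto simp: dist_norm norm_minus_commute)
    have ReB: "\<bar>Re v\<bar> \<le> a + 1" if "v \<in> ?B" for v
      using that abs_Re_le_cmod[of "?L - v"] by (simp add: a_def dist_norm)
    have W2: "norm (deriv (deriv W) v) \<le> K" if "v \<in> ?B" for v
    proof -
      have "norm (deriv (deriv W) v - (of_nat m)\<^sup>2 * exp (of_nat m * v)) \<le> 4 * \<epsilon>"
        by (rule close_to_W_lim_deriv2[OF W _ \<epsilon>(1)]) (use ReB[OF that] in \<open>simp add: A_def\<close>)
      moreover have "norm ((of_nat m)\<^sup>2 * exp (of_nat m * v)) \<le> (real m)\<^sup>2 * exp (real m * (a + 1))"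
      proof -
        have "real m * Re v \<le> real m * (a + 1)" using ReB[OF that] by (intro mult_left_mono) auto
        then show ?thesis by (simp add: norm_mult norm_power mult_left_mono)
      qed
      ultimately show ?thesis unfolding K_def using \<epsilon>(4)
        norm_triangle_ineq[of "deriv (deriv W) v - (of_nat m)\<^sup>2 * exp (of_nat m * v)" "(of_nat m)\<^sup>2 * exp (of_nat m * v)"] by simp
    qed
    have W1: "norm (deriv W v) \<le> K * norm (v - y1)" if "v \<in> ?B" for v
    proof -
      have "norm (deriv W v - deriv W y1) \<le> K * norm (v - y1)"
        by (rule field_differentiable_bound[of ?B _ "deriv (deriv W)"])
           (use W2 that y1B holomorphic_derivI[OF hd open_UNIV UNIV_I] in \<open>auto intro: has_field_derivative_at_within\<close>)
      then show ?thesis using crit by simp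
    qed
    have seg: "closed_segment y1 y \<subseteq> ?B" by (intro closed_segment_subset y1B yB) auto
    have "norm (W y - W y1) \<le> (K * norm u) * norm (y - y1)"
    proof (rule field_differentiable_bound[of "closed_segment y1 y" _ "deriv W"])
      fix v assume v: "v \<in> closed_segment y1 y"
      show "(W has_field_derivative deriv W v) (at v within closed_segment y1 y)"
        using holomorphic_derivI[OF hW open_UNIV UNIV_I] by (blast intro: has_field_derivative_at_within)
      have "norm (v - y1) \<le> norm u" using segment_bound1[OF v] by (simp add: u_def)
      then show "norm (deriv W v) \<le> K * norm u"
        using W1[of v] v seg K by (smt (verit) mult_left_mono subsetD)
    qed auto
    then have "t\<^sup>2 \<le> K * (norm u)\<^sup>2" using y by (simp add: u_def power2_eq_square mult.assoc norm_mult)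
    then have "sqrt (t\<^sup>2) \<le> sqrt (K * (norm u)\<^sup>2)" by (simp only: real_sqrt_le_iff)
    then have tu: "\<bar>t\<bar> \<le> sqrt K * norm u" by (simp add: real_sqrt_mult)
    have "exp y - exp y1 = exp y1 * (exp u - 1)" by (simp add: u_def exp_diff field_simps)
    then have "norm (exp y - exp y1) = exp (Re y1) * norm (exp u - 1)" by (simp add: norm_mult)
    also have "\<dots> \<ge> exp (- a - 1) * (norm u / 2)"
      using ReB[OF y1B] u \<delta>(2) d(1) by (intro mult_mono lower) auto
    finally have "exp (- a - 1) * (norm u / 2) \<le> norm (exp y - exp y1)" .
    moreover have "c * \<bar>t\<bar> \<le> exp (- a - 1) * (norm u / 2)"
      using mult_left_mono[OF tu, of c] c K by (simp add: c_def mult_ac)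
    moreover have "\<kappa> * min 1 \<bar>t\<bar> \<le> c * \<bar>t\<bar>" using \<kappa> by (intro mult_mono) auto
    ultimately show ?thesis using ab P(2) by simp
  qed
  show ?thesis
    using main by (intro exI[of _ \<epsilon>] conjI exI[of _ A] exI[of _ \<kappa>] allI impI \<epsilon>(1) \<kappa>(1)) blast+
qed

section \<open>The limit thimble and curves close to it\<close>

lemma critical_log_real_part:
  assumes "m > 0" "p < 0"
  shows "exp (real m * Re (critical_log m p \<beta>)) = - p / real m"
proof -
  have r: "root m (- p / real m) > 0" using assms by (simp add: divide_neg_pos)
  have "exp (real m * Re (critical_log m p \<beta>)) = exp (ln (root m (- p / real m))) ^ m"
    by (simp add: critical_log_def exp_of_nat_mult)
  also have "\<dots> = - p / real m"
    using r assms real_root_pow_pos[of m "- p / real m"] by (simp add: divide_neg_pos)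
  finally show ?thesis .
qed

context
  fixes m :: nat and p :: real and \<beta> :: nat and V :: "real \<Rightarrow> real" and \<tau> x0 :: real and \<xi> \<xi>' :: "real \<Rightarrow> real"
  assumes m: "m > 0" and p: "p < 0"
    and \<tau>_def: "\<tau> = 2 * pi * real \<beta> / real m"
    and V_def: "V = (\<lambda>x. exp (real m * x) + p * x)"
    and x0_def: "x0 = ln (root m (- p / real m))"
    and \<xi>: "\<xi> 0 = x0" "bij \<xi>" "\<And>t. (\<xi> has_real_derivative \<xi>' t) (at t)" "\<And>t. \<xi>' t > 0" "\<And>t. V (\<xi> t) = V x0 + t\<^sup>2"
begin

lemma critical_log_eq: "critical_log m p \<beta> = Complex x0 \<tau>"
  by (simp add: critical_log_def x0_def \<tau>_def)

lemma W_lim_offset: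
  "W_lim m p (Complex x (\<tau> + v)) =
     Complex (exp (real m * x) * cos (real m * v) + p * x) (exp (real m * x) * sin (real m * v) + p * (\<tau> + v))"
proof -
  have "real m * (\<tau> + v) = real m * v + 2 * pi * real_of_int (int \<beta>)"
    using m by (simp add: \<tau>_def field_simps)
  then have "cis (real m * (\<tau> + v)) = cis (real m * v)"
    by (simp only: cis_mult[symmetric] cis_multiple_2pi Ints_of_int mult_1_right)
  then have "exp (of_nat m * Complex x (\<tau> + v)) = of_real (exp (real m * x)) * cis (real m * v)"
    by (subst exp_eq_polar) simp
  then show ?thesis by (simp add: W_lim_def complex_eq_iff)
qed

lemma W_lim_axis: "W_lim m p (Complex x \<tau>) = Complex (V x) (p * \<tau>)"
  using W_lim_offset[of x 0] by (simp add: V_def)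

text \<open>Off the horizontal line \<open>off_axis_below\<close> with \<open>s = 0\<close> puts
  \<open>Re W_lim\<close> below its critical value. On the line,
  \<open>V (\<xi> s) = V x0 + s^2\<close> leaves only \<open>s = t\<close> and
  \<open>s = - t\<close>.\<close>

lemma W_lim_level_set:
  assumes y: "\<bar>real m * (Im y - \<tau>)\<bar> < pi / 2" and W: "W_lim m p y = W_lim m p (Complex x0 \<tau>) + of_real (t\<^sup>2)"
  shows "y = Complex (\<xi> t) \<tau> \<or> y = Complex (\<xi> (- t)) \<tau>"
proof -
  have yv: "y = Complex (Re y) (\<tau> + (Im y - \<tau>))" by simp
  have eqs: "exp (real m * Re y) * cos (real m * (Im y - \<tau>)) + p * Re y = V x0 + t\<^sup>2"
     "exp (real m * Re y) * sin (real m * (Im y - \<tau>)) + p * Im y = p * \<tau>"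
    using W unfolding W_lim_axis by (subst (asm) yv, subst (asm) W_lim_offset, simp add: complex_eq_iff)+
  have im: "Im y = \<tau>"
  proof (rule ccontr)
    assume "Im y \<noteq> \<tau>"
    then have "exp (real m * Re y) * cos (real m * (Im y - \<tau>)) + p * Re y < V x0"
      using off_axis_below[of "Im y - \<tau>" "real m" "real m" 0 "Re y" p x0] y m eqs(2)
      by (simp add: V_def algebra_simps)
    then show False using eqs(1) by simp
  qed
  obtain s where s: "\<xi> s = Re y" using \<xi>(2) by (metis bij_pointE)
  have "V (\<xi> s) = V x0 + t\<^sup>2" using eqs(1) im by (simp add: V_def s)
  then have "s\<^sup>2 = t\<^sup>2" using \<xi>(5)[of s] by simp
  then have "s = t \<or> s = - t" by (simp add: power2_eq_iff)
  then show ?thesis using s im by (auto simp: complex_eq_iff)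
qed

lemma thimble_param_strict_mono: "s < t \<Longrightarrow> \<xi> s < \<xi> t"
  by (rule DERIV_pos_imp_increasing[where f = \<xi>]) (use \<xi>(3,4) in blast)+

text \<open>A perturbed thimble cannot leave the rectangle \<open>R\<close>, because the limit thimble meets the frontier of \<open>R\<close> only
  at larger values of \<open>t\<close>. Of the two points of \<open>R\<close> at the same level the one on the correct side is selected by
  \<open>Re_less_on_vertical\<close>: the curve never returns to the vertical line through the critical point.\<close>

lemma thimble_converges:
  assumes e: "e > 0"
  shows "\<exists>\<epsilon>>0. \<exists>A. \<forall>W G G'. close_to_W_lim m p A \<epsilon> W \<longrightarrow> norm (G 0 - critical_log m p \<beta>) \<le> \<epsilon> \<longrightarrow>
    continuous_on UNIV G \<longrightarrow> (\<forall>t. W (G t) = W (G 0) + of_real (t\<^sup>2)) \<longrightarrow>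
    (G has_vector_derivative G') (at 0) \<longrightarrow> Re G' > 0 \<longrightarrow> norm (G t0 - Complex (\<xi> t0) \<tau>) < e"
proof (cases "t0 = 0")
  case True
  show ?thesis
    by (rule exI[of _ "e / 2"]) (use e in \<open>auto simp: True \<xi>(1) critical_log_eq\<close>)
next
  case False
  \<comment> \<open>The sign lets both halves of the curve be followed with a nonnegative parameter,
    through \<open>H s = G (\<sigma> * s)\<close>.\<close>
  define \<sigma> where "\<sigma> = sgn t0"
  define T where "T = \<bar>t0\<bar>"
  have T: "T > 0" "t0 = \<sigma> * T" and \<sigma>: "\<sigma> = 1 \<or> \<sigma> = -1" "\<sigma> * \<sigma> = 1"
    using False by (auto simp: T_def \<sigma>_def sgn_if)
  let ?L = "Complex x0 \<tau>"
  \<comment> \<open>On a strip of this half width \<open>cos (m * v) >= cos (pi / 4)\<close>, which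
    keeps \<open>Re W''\<close> positive, and the angle is below \<open>pi / 2\<close> as
    \<open>W_lim_level_set\<close> demands.\<close>
  define \<rho> where "\<rho> = pi / (4 * real m)"
  have \<rho>: "\<rho> > 0" using m by (simp add: \<rho>_def)
  have \<rho>': "\<bar>real m * v\<bar> \<le> pi / 4" if "\<bar>v\<bar> \<le> \<rho>" for v
  proof -
    have "\<bar>real m * v\<bar> \<le> real m * \<rho>" using that by (simp add: abs_mult mult_left_mono)
    then show ?thesis using m by (simp add: \<rho>_def)
  qed
  have \<rho>'': "\<bar>real m * v\<bar> < pi / 2" if "\<bar>v\<bar> \<le> \<rho>" for v
    using \<rho>'[OF that] pi_gt_zero by linarith
  \<comment> \<open>One unit of the parameter beyond \<open>T\<close> on both sides, so that the
    limit thimble lies in the interior of the rectangle for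
    \<open>\<bar>s\<bar> <= T\<close>.\<close>
  define lo hi where "lo = \<xi> (- T - 1)" and "hi = \<xi> (T + 1)"
  have lohi: "lo < x0" "x0 < hi"
    using thimble_param_strict_mono[of "- T - 1" 0] thimble_param_strict_mono[of 0 "T + 1"] T(1) by (auto simp: lo_def hi_def \<xi>(1))
  define R where "R = {y. lo \<le> Re y \<and> Re y \<le> hi \<and> \<tau> - \<rho> \<le> Im y \<and> Im y \<le> \<tau> + \<rho>}"
  define O' where "O' = {y. lo < Re y \<and> Re y < hi \<and> \<tau> - \<rho> < Im y \<and> Im y < \<tau> + \<rho>}"
  have Rbox: "R = cbox (Complex lo (\<tau> - \<rho>)) (Complex hi (\<tau> + \<rho>))"
    and Obox: "O' = box (Complex lo (\<tau> - \<rho>)) (Complex hi (\<tau> + \<rho>))"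
    by (auto simp: R_def O'_def in_cbox_complex_iff in_box_complex_iff)
  have R: "compact R" "convex R" "closed R" by (simp_all add: Rbox closed_cbox)
  have O': "open O'" "O' \<subseteq> R" by (simp add: Obox) (auto simp: O'_def R_def)
  have fr: "frontier O' \<subseteq> R - O'"
    unfolding frontier_def using O' closure_minimal[OF O'(2) R(3)] by (auto simp: interior_open)
  define d where "d = \<bar>\<xi> (- t0) - x0\<bar> / 2"
  have side: "\<sigma> * (\<xi> (- t0) - x0) = - (2 * d)" "d > 0"
  proof -
    have "\<sigma> * (\<xi> (- t0) - x0) < 0"
    proof (cases "t0 > 0")
      case True
      then have "\<xi> (- t0) < x0" using thimble_param_strict_mono[of "- t0" 0] \<xi>(1) by simp
      then show ?thesis using True by (simp add: \<sigma>_def)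
    next
      case n: False
      then have "x0 < \<xi> (- t0)" using thimble_param_strict_mono[of 0 "- t0"] \<xi>(1) False by simp
      then show ?thesis using n False by (simp add: \<sigma>_def)
    qed
    then show "\<sigma> * (\<xi> (- t0) - x0) = - (2 * d)" "d > 0"
      using \<sigma>(1) by (auto simp: d_def)
  qed
  have "\<exists>\<mu>>0. \<forall>ys\<in>(R - O') \<times> {0..T}. \<mu> \<le> norm (W_lim m p (fst ys) - W_lim m p ?L - of_real ((snd ys)\<^sup>2))"
  proof (rule compact_positive_lower_bound)
    show "compact ((R - O') \<times> {0..T})" by (intro compact_Times compact_diff R(1) O'(1)) auto
    show "continuous_on ((R - O') \<times> {0..T}) (\<lambda>ys. norm (W_lim m p (fst ys) - W_lim m p ?L - of_real ((snd ys)\<^sup>2)))"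
      by (intro continuous_intros)
    fix ys assume ys: "ys \<in> (R - O') \<times> {0..T}"
    show "0 < norm (W_lim m p (fst ys) - W_lim m p ?L - of_real ((snd ys)\<^sup>2))"
    proof (rule ccontr)
      assume "\<not> ?thesis"
      then have "W_lim m p (fst ys) = W_lim m p ?L + of_real ((snd ys)\<^sup>2)" by (simp add: algebra_simps)
      moreover have "\<bar>real m * (Im (fst ys) - \<tau>)\<bar> < pi / 2"
        using ys by (intro \<rho>'') (auto simp: R_def)
      ultimately have "fst ys = Complex (\<xi> (snd ys)) \<tau> \<or> fst ys = Complex (\<xi> (- snd ys)) \<tau>"
        using W_lim_level_set by blast
      moreover have "lo < \<xi> s \<and> \<xi> s < hi" if "\<bar>s\<bar> \<le> T" for s
        unfolding lo_def hi_def using that by (intro conjI thimble_param_strict_mono) auto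
      ultimately have "fst ys \<in> O'" using ys \<rho> by (auto simp: O'_def)
      then show False using ys by auto
    qed
  qed
  then obtain \<mu>1 where \<mu>1: "\<mu>1 > 0" "\<And>y s. y \<in> R - O' \<Longrightarrow> s \<in> {0..T} \<Longrightarrow> \<mu>1 \<le> norm (W_lim m p y - W_lim m p ?L - of_real (s\<^sup>2))"
    by fastforce
  \<comment> \<open>The wrong places for \<open>G t0\<close>: at distance \<open>e / 2\<close> or
    more from its target. The mirror point \<open>\<xi> (- t0)\<close>, the only other point at this
    level, is cut off by the last condition, \<open>d\<close> being half its distance from the
    vertical line.\<close>
  define K2 where "K2 = R \<inter> {y. e / 2 \<le> norm (y - Complex (\<xi> t0) \<tau>)} \<inter> {y. - d \<le> \<sigma> * (Re y - x0)}"
  have "\<exists>\<mu>>0. \<forall>y\<in>K2. \<mu> \<le> norm (W_lim m p y - W_lim m p ?L - of_real (t0\<^sup>2))"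
  proof (rule compact_positive_lower_bound)
    show "compact K2" unfolding K2_def
      by (intro compact_Int_closed R(1) closed_Collect_le continuous_intros)
    show "continuous_on K2 (\<lambda>y. norm (W_lim m p y - W_lim m p ?L - of_real (t0\<^sup>2)))"
      by (intro continuous_intros)
    fix y assume y: "y \<in> K2"
    show "0 < norm (W_lim m p y - W_lim m p ?L - of_real (t0\<^sup>2))"
    proof (rule ccontr)
      assume "\<not> ?thesis"
      then have "W_lim m p y = W_lim m p ?L + of_real (t0\<^sup>2)" by (simp add: algebra_simps)
      moreover have "\<bar>real m * (Im y - \<tau>)\<bar> < pi / 2"
        using y by (intro \<rho>'') (auto simp: K2_def R_def)
      ultimately have "y = Complex (\<xi> t0) \<tau> \<or> y = Complex (\<xi> (- t0)) \<tau>"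
        using W_lim_level_set by blast
      then show False using y side e by (auto simp: K2_def)
    qed
  qed
  then obtain \<mu>2 where \<mu>2: "\<mu>2 > 0" "\<And>y. y \<in> K2 \<Longrightarrow> \<mu>2 \<le> norm (W_lim m p y - W_lim m p ?L - of_real (t0\<^sup>2))"
    by blast
  define \<kappa> where "\<kappa> = (real m)\<^sup>2 * (exp (real m * lo) * cos (pi / 4))"
  have \<kappa>: "\<kappa> > 0" unfolding \<kappa>_def using m by (simp add: cos_45)
  have "isCont (W_lim m p) ?L" by (rule DERIV_isCont[OF has_field_derivative_W_lim])
  then have "\<forall>e>0. \<forall>\<^sub>F y in at ?L. norm (W_lim m p y - W_lim m p ?L) < e"
    unfolding isCont_def tendsto_iff dist_norm .
  moreover have \<mu>: "min \<mu>1 \<mu>2 / 4 > 0" using \<mu>1(1) \<mu>2(1) by simp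
  ultimately have "\<forall>\<^sub>F y in at ?L. norm (W_lim m p y - W_lim m p ?L) < min \<mu>1 \<mu>2 / 4" by blast
  with \<mu> have "\<forall>\<^sub>F y in nhds ?L. norm (W_lim m p y - W_lim m p ?L) < min \<mu>1 \<mu>2 / 4"
    unfolding eventually_nhds_conv_at by simp
  moreover have "\<forall>\<^sub>F y in nhds ?L. y \<in> O'"
    by (rule eventually_nhds_in_open[OF O'(1)]) (use lohi \<rho> in \<open>simp add: O'_def\<close>)
  ultimately have "\<forall>\<^sub>F y in nhds ?L. norm (W_lim m p y - W_lim m p ?L) < min \<mu>1 \<mu>2 / 4 \<and> y \<in> O'"
    by (rule eventually_conj)
  then obtain \<theta> where \<theta>: "\<theta> > 0" "\<And>y. norm (y - ?L) < \<theta> \<Longrightarrow> norm (W_lim m p y - W_lim m p ?L) < min \<mu>1 \<mu>2 / 4"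
      "\<And>y. norm (y - ?L) < \<theta> \<Longrightarrow> y \<in> O'"
    unfolding eventually_nhds_metric dist_norm by blast
  \<comment> \<open>The entry \<open>\<kappa> / 8\<close> keeps \<open>Re W''\<close> positive
    against an error of \<open>4 * \<epsilon>\<close>. With \<open>\<mu>1 / 8\<close> and
    \<open>\<mu>2 / 8\<close> the two approximation errors and the shift of the critical value add
    up to less than \<open>min \<mu>1 \<mu>2\<close>. The entry \<open>d\<close> keeps
    \<open>y1\<close> on the admissible side in \<open>K2\<close>.\<close>
  define \<epsilon> where "\<epsilon> = Min {\<theta> / 2, d, \<kappa> / 8, \<mu>1 / 8, \<mu>2 / 8}"
  have \<epsilon>: "\<epsilon> > 0" "\<epsilon> < \<theta>" "\<epsilon> \<le> d" "\<epsilon> \<le> \<kappa> / 8" "\<epsilon> \<le> \<mu>1 / 8" "\<epsilon> \<le> \<mu>2 / 8"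
    using \<theta>(1) side(2) \<kappa> \<mu>1(1) \<mu>2(1) by (auto simp: \<epsilon>_def)
  define A where "A = \<bar>lo\<bar> + \<bar>hi\<bar> + 1"
  have main: "norm (G t0 - Complex (\<xi> t0) \<tau>) < e"
    if W: "close_to_W_lim m p A \<epsilon> W" and G0: "norm (G 0 - ?L) \<le> \<epsilon>"
      and cG: "continuous_on UNIV G" and WG: "\<And>t. W (G t) = W (G 0) + of_real (t\<^sup>2)"
      and dG: "(G has_vector_derivative G') (at 0)" and G': "Re G' > 0" for W G G'
  proof -
    define y1 where "y1 = G 0"
    have hW: "W holomorphic_on UNIV" using W by (simp add: close_to_W_lim_def)
    have crit: "deriv W y1 = 0" unfolding y1_def
      by (rule critical_of_square_param[OF hW dG _ WG]) (use G' in auto)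
    have WW: "norm (W y - W_lim m p y) \<le> \<epsilon>" if "y \<in> R" for y
      using W that unfolding close_to_W_lim_def by (auto simp: R_def A_def)
    have W2: "Re (deriv (deriv W) y) > 0" if "y \<in> R" for y
    proof -
      have Rey: "\<bar>Re y\<bar> \<le> A - 1" using that by (auto simp: R_def A_def)
      have "\<kappa> \<le> Re ((of_nat m)\<^sup>2 * exp (of_nat m * y))"
      proof -
        have ab: "\<bar>real m * (Im y - \<tau>)\<bar> \<le> pi / 4" using that by (intro \<rho>') (auto simp: R_def)
        have "cos (pi / 4) \<le> cos (real m * (Im y - \<tau>))"
          using cos_monotone_0_pi_le[of "\<bar>real m * (Im y - \<tau>)\<bar>" "pi / 4"] ab by simp
        moreover have "exp (real m * lo) \<le> exp (real m * Re y)" using that m by (simp add: R_def)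
        ultimately have "\<kappa> \<le> (real m)\<^sup>2 * (exp (real m * Re y) * cos (real m * (Im y - \<tau>)))"
          unfolding \<kappa>_def by (intro mult_left_mono mult_mono) (auto simp: cos_45)
        also have "exp (real m * Re y) * cos (real m * (Im y - \<tau>)) = Re (exp (of_nat m * y))"
          using W_lim_offset[of "Re y" "Im y - \<tau>"] by (simp add: W_lim_def complex_eq_iff)
        finally show ?thesis by (simp add: of_nat_power[symmetric] del: of_nat_power)
      qed
      moreover have "norm (deriv (deriv W) y - (of_nat m)\<^sup>2 * exp (of_nat m * y)) \<le> 4 * \<epsilon>"
        by (rule close_to_W_lim_deriv2[OF W Rey \<epsilon>(1)])
      ultimately show ?thesis
        using abs_Re_le_cmod[of "deriv (deriv W) y - (of_nat m)\<^sup>2 * exp (of_nat m * y)"] \<epsilon>(4) \<kappa> by simp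
    qed
    have y1: "norm (y1 - ?L) < \<theta>" using G0 \<epsilon>(2) by (simp add: y1_def)
    have y1O: "y1 \<in> O'" and y1R: "y1 \<in> R" using \<theta>(3)[OF y1] O'(2) by auto
    have near: "norm (W_lim m p (G t) - W_lim m p ?L - of_real (t\<^sup>2)) < min \<mu>1 \<mu>2" if "G t \<in> R" for t
    proof -
      have "W_lim m p (G t) - W_lim m p ?L - of_real (t\<^sup>2) =
          - (W (G t) - W_lim m p (G t)) + ((W y1 - W_lim m p y1) + (W_lim m p y1 - W_lim m p ?L))"
        using WG[of t] by (simp add: y1_def)
      also have "norm \<dots> \<le> norm (W (G t) - W_lim m p (G t)) + (norm (W y1 - W_lim m p y1) + norm (W_lim m p y1 - W_lim m p ?L))"
        using norm_triangle_ineq norm_triangle_mono norm_minus_cancel by (metis order_refl)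
      also have "\<dots> < min \<mu>1 \<mu>2" using WW[OF that] WW[OF y1R] \<theta>(2)[OF y1] \<epsilon>(5,6) \<mu>1(1) \<mu>2(1) by linarith
      finally show ?thesis .
    qed
    define H where "H = (\<lambda>s. G (\<sigma> * s))"
    have cH: "continuous_on S H" for S
      unfolding H_def by (intro continuous_on_compose2[OF cG] continuous_intros) auto
    have sq: "(\<sigma> * s)\<^sup>2 = s\<^sup>2" for s using \<sigma>(1) by (auto simp: power2_eq_square)
    have HO: "H s \<in> O'" if s: "s \<in> {0..T}" for s
    proof (rule ccontr)
      assume "H s \<notin> O'"
      then have "H ` {0..T} \<inter> frontier O' \<noteq> {}"
      proof (intro connected_Int_frontier connected_continuous_image cH)
        have "H 0 \<in> H ` {0..T}" "H s \<in> H ` {0..T}" using s T(1) by auto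
        moreover have "H 0 \<in> O'" using y1O by (simp add: H_def y1_def)
        ultimately show "H ` {0..T} \<inter> O' \<noteq> {}" "H ` {0..T} - O' \<noteq> {}" using \<open>H s \<notin> O'\<close> by blast+
      qed simp
      then obtain s' where s': "s' \<in> {0..T}" "H s' \<in> R - O'" using fr by blast
      then show False using \<mu>1(2)[OF s'(2,1)] near[of "\<sigma> * s'"] by (simp add: H_def sq[unfolded power_mult_distrib] power_mult_distrib)
    qed
    have off: "Re (H s) \<noteq> Re y1" if s: "s \<in> {0<..T}" for s
    proof
      assume re: "Re (H s) = Re y1"
      define b where "b = \<bar>Im (H s) - Im y1\<bar>"
      define w where "w = (if Im (H s) > Im y1 then \<i> else - \<i>)"
      have Hs: "H s = y1 + of_real b * w" by (auto simp: complex_eq_iff re b_def w_def)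
      have WH: "W (H s) = W y1 + of_real (s\<^sup>2)" using WG[of "\<sigma> * s"] by (simp only: H_def y1_def sq)
      have "b > 0"
      proof (rule ccontr)
        assume "\<not> b > 0"
        then have "b = 0" by (simp add: b_def)
        then show False using WH s Hs by simp
      qed
      moreover have "Re (deriv (deriv W) (y1 + of_real s' * w)) > 0" if "0 \<le> s'" "s' \<le> b" for s'
      proof (rule W2)
        have "H s \<in> R" using HO[of s] s O'(2) by auto
        then show "y1 + of_real s' * w \<in> R"
          using y1R that by (auto simp: R_def w_def b_def split: if_splits)
      qed
      ultimately have "Re (W (H s)) < Re (W y1)"
        unfolding Hs by (intro Re_less_on_vertical[OF hW crit]) (auto simp: w_def)
      then show False using WH by simp
    qed
    have dRe: "((\<lambda>t. Re (G t)) has_real_derivative Re G') (at 0)"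
      using dG unfolding has_real_derivative_iff_has_vector_derivative
      by (rule bounded_linear.has_vector_derivative[OF bounded_linear_Re])
    \<comment> \<open>The curve starts on the correct side since \<open>Re G' > 0\<close>; by
      \<open>off\<close> and the intermediate value theorem it stays there.\<close>
    have "((\<lambda>s. \<sigma> * Re (H s)) has_real_derivative \<sigma> * (Re G' * \<sigma>)) (at 0)"
      unfolding H_def by (intro DERIV_cmult DERIV_chain2[where f = "\<lambda>t. Re (G t)"])
        (use dRe in \<open>auto intro!: derivative_eq_intros\<close>)
    moreover have "\<sigma> * (Re G' * \<sigma>) > 0" using \<sigma> G' by (metis mult.commute mult.left_commute mult_1)
    ultimately obtain h where h: "h > 0" "\<And>s. s > 0 \<Longrightarrow> s < h \<Longrightarrow> \<sigma> * Re (H 0) < \<sigma> * Re (H s)"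
      using DERIV_pos_inc_right[of "\<lambda>s. \<sigma> * Re (H s)" _ 0] by auto
    have H0: "H 0 = y1" by (simp add: H_def y1_def)
    have pos: "\<sigma> * Re (H T) > \<sigma> * Re y1"
    proof (rule ccontr)
      assume n: "\<not> ?thesis"
      define s where "s = min (h / 2) T"
      have s: "0 < s" "s < h" "s \<le> T" using h(1) T(1) by (auto simp: s_def)
      have "\<exists>x\<ge>s. x \<le> T \<and> \<sigma> * Re (H x) = \<sigma> * Re y1"
      proof (rule IVT2')
        show "\<sigma> * Re y1 \<le> \<sigma> * Re (H s)" using h(2)[OF s(1,2)] by (simp add: H0)
        show "\<sigma> * Re (H T) \<le> \<sigma> * Re y1" using n by simp
        show "continuous_on {s..T} (\<lambda>x. \<sigma> * Re (H x))" by (intro continuous_intros cH)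
      qed (rule s(3))
      then obtain x where "s \<le> x" "x \<le> T" "\<sigma> * Re (H x) = \<sigma> * Re y1" by blast
      then have "x \<in> {0<..T}" "\<sigma> * Re (H x) = \<sigma> * Re y1" using s(1) by auto
      then show False using off[of x] \<sigma>(1) by auto
    qed
    have HT: "H T = G t0" by (simp add: H_def T(2))
    have "G t0 \<notin> K2"
    proof
      assume "G t0 \<in> K2"
      moreover from this have "G t0 \<in> R" by (simp add: K2_def)
      ultimately show False using \<mu>2(2) near[of t0] by fastforce
    qed
    moreover have "G t0 \<in> R" using HO[of T] T(1) O'(2) by (auto simp: HT)
    moreover have "- d \<le> \<sigma> * (Re (G t0) - x0)"
    proof -
      have "\<bar>Re y1 - x0\<bar> \<le> \<epsilon>" using G0 abs_Re_le_cmod[of "y1 - ?L"] by (simp add: y1_def)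
      then have "- d \<le> \<sigma> * (Re y1 - x0)" using \<epsilon>(3) \<sigma>(1) by auto
      then show ?thesis using pos by (simp add: HT right_diff_distrib)
    qed
    ultimately have "norm (G t0 - Complex (\<xi> t0) \<tau>) < e / 2" by (auto simp: K2_def)
    then show ?thesis using e by simp
  qed
  show ?thesis
    unfolding critical_log_eq using main
    by (intro exI[of _ \<epsilon>] conjI exI[of _ A] allI impI \<epsilon>(1)) blast
qed

end

subsection \<open>Finite parts of oscillatory integrals\<close>

text \<open>The coefficient \<open>A\<close> of the divergent part is determined as well: multiplied
  by \<open>e\<close>, the difference of the two expansions tends both to 0 and to
  \<open>A' - A\<close>.\<close>

lemma has_finite_part_unique:
  assumes "has_finite_part f L" "has_finite_part f L'"
  shows "L = L'"
proof -
  define I where "I = (\<lambda>e. LINT t:{t. e \<le> \<bar>t\<bar>}|lborel. f t)"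
  obtain A A' where A: "((\<lambda>e. I e - A / of_real e) \<longlongrightarrow> L) (at_right 0)" and A': "((\<lambda>e. I e - A' / of_real e) \<longlongrightarrow> L') (at_right 0)"
    using assms unfolding has_finite_part_def I_def by blast
  have "((\<lambda>e. (A' - A) / complex_of_real e) \<longlongrightarrow> L - L') (at_right 0)"
    using tendsto_diff[OF A A'] by (simp add: diff_divide_distrib)
  then have "((\<lambda>e. complex_of_real e * ((A' - A) / complex_of_real e)) \<longlongrightarrow> of_real 0 * (L - L')) (at_right 0)"
    by (intro tendsto_mult tendsto_of_real tendsto_ident_at)
  moreover have "\<forall>\<^sub>F e in at_right 0. complex_of_real e * ((A' - A) / complex_of_real e) = A' - A"
    by (auto simp: eventually_at_filter)
  ultimately have "((\<lambda>e::real. A' - A) \<longlongrightarrow> 0) (at_right 0)"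
    using Lim_transform_eventually by fastforce
  then have "A' = A" by (simp add: tendsto_const_iff)
  with A' have "((\<lambda>e. I e - A / of_real e) \<longlongrightarrow> L') (at_right 0)" by simp
  from tendsto_unique[OF _ A this] show ?thesis by (simp add: trivial_limit_at_right_real)
qed

lemma finite_part_eqI: "has_finite_part f L \<Longrightarrow> finite_part f = L"
  unfolding finite_part_def using has_finite_part_unique by blast

lemma integrable_power_gauss:
  fixes z :: real
  assumes "z < 0"
  shows "integrable lborel (\<lambda>t. \<bar>t\<bar> ^ k * exp (t\<^sup>2 / z))"
proof -
  define \<sigma> where "\<sigma> = sqrt (- z / 2)"
  have \<sigma>: "\<sigma> > 0" "2 * \<sigma>\<^sup>2 = - z" using assms by (auto simp: \<sigma>_def)
  have "integrable lborel (\<lambda>t. sqrt (2 * pi * \<sigma>\<^sup>2) * (normal_density 0 \<sigma> t * \<bar>t - 0\<bar> ^ k))"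
    by (intro integrable_mult_right integrable_normal_moment_abs \<sigma>)
  also have "(\<lambda>t. sqrt (2 * pi * \<sigma>\<^sup>2) * (normal_density 0 \<sigma> t * \<bar>t - 0\<bar> ^ k)) = (\<lambda>t. \<bar>t\<bar> ^ k * exp (t\<^sup>2 / z))"
    using \<sigma>(1) unfolding normal_density_def \<sigma>(2) by (auto simp: fun_eq_iff)
  finally show ?thesis .
qed

lemma integrable_linear_gauss:
  fixes z :: real
  assumes "z < 0"
  shows "integrable lborel (\<lambda>t. B * ((1 + \<bar>t\<bar>) * exp (t\<^sup>2 / z)))"
proof -
  have "integrable lborel (\<lambda>t. \<bar>t\<bar> ^ 0 * exp (t\<^sup>2 / z) + \<bar>t\<bar> ^ 1 * exp (t\<^sup>2 / z))"
    by (intro Bochner_Integration.integrable_add integrable_power_gauss assms)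
  then have "integrable lborel (\<lambda>t. B * (\<bar>t\<bar> ^ 0 * exp (t\<^sup>2 / z) + \<bar>t\<bar> ^ 1 * exp (t\<^sup>2 / z)))"
    by (rule integrable_mult_right)
  then show ?thesis by (simp add: algebra_simps)
qed

text \<open>The factor \<open>t\<close> compensates the simple zero allowed in the denominator:
  \<open>\<bar>t\<bar> / min 1 \<bar>t\<bar>\<close> is the maximum of 1 and
  \<open>\<bar>t\<bar>\<close>.\<close>

lemma oscillatory_bound:
  fixes c D :: complex and z t :: real
  assumes \<kappa>: "\<kappa> > 0" and C: "C > 0" "C \<le> norm c" and D: "\<kappa> * min 1 \<bar>t\<bar> \<le> norm D"
  shows "norm (of_real (2 * t / z * exp (t\<^sup>2 / z)) / (c * D)) \<le> 2 / (\<bar>z\<bar> * (C * \<kappa>)) * ((1 + \<bar>t\<bar>) * exp (t\<^sup>2 / z))"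
proof (cases "t = 0")
  case False
  have pos: "0 < C * (\<kappa> * min 1 \<bar>t\<bar>)" using \<kappa> C(1) False by simp
  have "C * (\<kappa> * min 1 \<bar>t\<bar>) \<le> norm c * norm D"
    using C D \<kappa> by (intro mult_mono) auto
  then have "norm (of_real (2 * t / z * exp (t\<^sup>2 / z)) / (c * D)) \<le> norm (of_real (2 * t / z * exp (t\<^sup>2 / z)) :: complex) / (C * (\<kappa> * min 1 \<bar>t\<bar>))"
    unfolding norm_divide norm_mult[of c] using pos by (intro divide_left_mono mult_pos_pos[OF _ pos] norm_ge_zero) linarith+
  also have "\<dots> = 2 / (\<bar>z\<bar> * (C * \<kappa>)) * (\<bar>t\<bar> / min 1 \<bar>t\<bar> * exp (t\<^sup>2 / z))"
    unfolding norm_of_real by (simp add: abs_mult)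
  also have "\<dots> \<le> 2 / (\<bar>z\<bar> * (C * \<kappa>)) * ((1 + \<bar>t\<bar>) * exp (t\<^sup>2 / z))"
    using C \<kappa> False by (intro mult_left_mono mult_right_mono) (auto simp: min_def)
  finally show ?thesis .
qed (use assms in auto)

text \<open>At a critical point \<open>W - W y0\<close> vanishes to second order and
  \<open>exp - exp y0\<close> to first order. Dividing out the powers of \<open>y - y0\<close> by
  the removable singularity theorem, twice and once, leaves a denominator that is nonzero at
  \<open>y0\<close>.\<close>

lemma square_quotient_holomorphic:
  assumes W: "W holomorphic_on UNIV" and W0: "deriv W y0 = 0"
  shows "\<exists>Q. Q field_differentiable (at y0) \<and> (\<forall>y. exp y \<noteq> exp y0 \<longrightarrow> Q y = (W y - W y0) / (exp y - exp y0)\<^sup>2)"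
proof -
  define h1 where "h1 = (\<lambda>y. if y = y0 then deriv W y0 else (W y - W y0) / (y - y0))"
  define h where "h = (\<lambda>y. if y = y0 then deriv h1 y0 else (h1 y - h1 y0) / (y - y0))"
  define e1 where "e1 = (\<lambda>y. if y = y0 then deriv exp y0 else (exp y - exp y0) / (y - y0))"
  have h1: "h1 holomorphic_on UNIV" unfolding h1_def by (rule pole_lemma_open[OF W open_UNIV])
  have h: "h holomorphic_on UNIV" unfolding h_def by (rule pole_lemma_open[OF h1 open_UNIV])
  have e1: "e1 holomorphic_on UNIV" unfolding e1_def
    by (rule pole_lemma_open[OF holomorphic_on_exp open_UNIV])
  have e10: "e1 y0 \<noteq> 0" by (simp add: e1_def DERIV_imp_deriv[OF DERIV_exp])
  have "(\<lambda>y. h y / (e1 y)\<^sup>2) field_differentiable (at y0)"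
    using e10 h e1 by (intro field_differentiable_divide field_differentiable_power)
      (auto simp: holomorphic_on_def)
  moreover have "h y / (e1 y)\<^sup>2 = (W y - W y0) / (exp y - exp y0)\<^sup>2" if "exp y \<noteq> exp y0" for y
  proof -
    have ne: "y - y0 \<noteq> 0" using that by auto
    then have "h y = (W y - W y0) / (y - y0)\<^sup>2" by (simp add: h_def h1_def W0 power2_eq_square)
    moreover have "e1 y = (exp y - exp y0) / (y - y0)" using ne by (simp add: e1_def)
    ultimately show ?thesis using ne that by (simp add: power_divide)
  qed
  ultimately show ?thesis by blast
qed

lemma has_vector_derivative_quotient_tendsto:
  fixes f :: "real \<Rightarrow> complex"
  assumes "(f has_vector_derivative D) (at x)"
  shows "((\<lambda>t. (f t - f x) / of_real (t - x)) \<longlongrightarrow> D) (at x)"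
proof -
  have "((\<lambda>t. norm (f t - f x - (t - x) *\<^sub>R D) / norm (t - x)) \<longlongrightarrow> 0) (at x)"
    using assms unfolding has_vector_derivative_def has_derivative_iff_norm by blast
  moreover have "\<forall>\<^sub>F t in at x. norm (f t - f x - (t - x) *\<^sub>R D) / norm (t - x) = norm ((f t - f x) / of_real (t - x) - D)"
  proof -
    have "norm (f t - f x - (t - x) *\<^sub>R D) / norm (t - x) = norm ((f t - f x) / of_real (t - x) - D)" if "t \<noteq> x" for t
    proof -
      have "(f t - f x) / of_real (t - x) - D = (f t - f x - (t - x) *\<^sub>R D) / of_real (t - x)"
        using that by (simp add: diff_divide_distrib scaleR_conv_of_real)
      then show ?thesis by (simp only: norm_divide norm_of_real real_norm_def)
    qed
    then show ?thesis by (auto simp: eventually_at_filter)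
  qed
  ultimately have "((\<lambda>t. norm ((f t - f x) / of_real (t - x) - D)) \<longlongrightarrow> 0) (at x)"
    by (rule Lim_transform_eventually)
  then show ?thesis using tendsto_norm_zero_iff LIM_zero_iff by blast
qed

text \<open>The square of \<open>t / (exp (g t) - exp (g 0))\<close> is a holomorphic function of \<open>g t\<close>, so the quotient is a branch of
  its square root.\<close>

lemma pole_quotient_differentiable:
  assumes W: "W holomorphic_on UNIV" and W0: "deriv W (g 0) = 0"
    and g: "(g has_vector_derivative g') (at (0::real))" "g' \<noteq> 0"
    and Wg: "\<And>t. W (g t) = W (g 0) + of_real (t\<^sup>2)"
    and ne: "\<And>t. t \<noteq> 0 \<Longrightarrow> exp (g t) \<noteq> exp (g 0)"
  shows "\<exists>w w'. (w has_vector_derivative w') (at 0) \<and>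
     (\<forall>\<^sub>F t in at 0. 1 / (exp (g t) - exp (g 0)) = w t / of_real t)"
proof -
  obtain Q where Q: "Q field_differentiable (at (g 0))"
     "\<And>y. exp y \<noteq> exp (g 0) \<Longrightarrow> Q y = (W y - W (g 0)) / (exp y - exp (g 0))\<^sup>2"
    using square_quotient_holomorphic[OF W W0] by blast
  define s where "s = (\<lambda>t::real. of_real t / (exp (g t) - exp (g 0)))"
  \<comment> \<open>The limit of \<open>s\<close> at 0, by the derivative of
    \<open>exp (g t)\<close>.\<close>
  define s0 where "s0 = 1 / (exp (g 0) * g')"
  have s0: "s0 \<noteq> 0" using g(2) by (simp add: s0_def)
  have Qs: "Q (g t) = (s t)\<^sup>2" if "t \<noteq> 0" for t
    using Q(2)[OF ne[OF that]] Wg[of t] by (simp add: s_def power_divide)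
  have "((\<lambda>t. exp (g t)) has_vector_derivative g' * exp (g 0)) (at 0)"
    using field_vector_diff_chain_at[OF g(1) DERIV_exp] by (simp add: o_def)
  then have "((\<lambda>t. (exp (g t) - exp (g 0)) / of_real t) \<longlongrightarrow> g' * exp (g 0)) (at 0)"
    using has_vector_derivative_quotient_tendsto by fastforce
  then have "((\<lambda>t. inverse ((exp (g t) - exp (g 0)) / of_real t)) \<longlongrightarrow> inverse (g' * exp (g 0))) (at 0)"
    by (rule tendsto_inverse) (use g(2) in auto)
  then have s_lim: "(s \<longlongrightarrow> s0) (at 0)" by (simp add: s_def s0_def field_simps)
  have "isCont g 0" using g(1) by (rule has_vector_derivative_continuous)
  then have "isCont (\<lambda>t. Q (g t)) 0"
    by (rule isCont_o2) (use Q(1) field_differentiable_imp_continuous_at in blast)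
  then have "((\<lambda>t. Q (g t)) \<longlongrightarrow> Q (g 0)) (at 0)" by (simp add: isCont_def)
  moreover have "((\<lambda>t. Q (g t)) \<longlongrightarrow> s0\<^sup>2) (at 0)"
    by (rule Lim_transform_eventually[OF tendsto_power[OF s_lim, of 2]]) (auto simp: eventually_at_filter Qs)
  ultimately have Q0: "Q (g 0) = s0\<^sup>2" by (rule tendsto_unique[rotated]) simp
  obtain Q' where Q': "(Q has_field_derivative Q') (at (g 0))" using Q(1) by (auto simp: field_differentiable_def)
  \<comment> \<open>Dividing by \<open>s0^2\<close> moves the value at 0 to 1, where
    \<open>csqrt\<close> is differentiable; the factor \<open>s0\<close> restores the
    branch.\<close>
  define w where "w = (\<lambda>t. s0 * csqrt (Q (g t) / s0\<^sup>2))"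
  have "(csqrt has_field_derivative inverse (2 * csqrt 1)) (at (Q (g 0) / s0\<^sup>2))"
    using has_field_derivative_csqrt[of 1] s0 by (simp add: Q0)
  note DERIV_cmult[OF DERIV_chain2[OF this DERIV_cdivide[OF Q']], of s0]
  from field_vector_diff_chain_at[OF g(1) this]
  have "\<exists>w'. (w has_vector_derivative w') (at 0)" unfolding w_def o_def by blast
  moreover have "\<forall>\<^sub>F t in at 0. 1 / (exp (g t) - exp (g 0)) = w t / of_real t"
  proof -
    have "((\<lambda>t. s t / s0) \<longlongrightarrow> s0 / s0) (at 0)" by (intro tendsto_intros s_lim s0)
    then have "((\<lambda>t. Re (s t / s0)) \<longlongrightarrow> 1) (at 0)" using tendsto_Re s0 by fastforce
    then have "\<forall>\<^sub>F t in at 0. Re (s t / s0) > 0" by (rule order_tendstoD) simp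
    moreover have "\<forall>\<^sub>F t::real in at 0. t \<noteq> 0" by (simp add: eventually_at_filter)
    ultimately show ?thesis
    proof eventually_elim
      case (elim t)
      have "w t = s0 * csqrt ((s t / s0)\<^sup>2)" using Qs[OF elim(2)] by (simp add: w_def power_divide)
      also have "\<dots> = s t" using elim(1) s0 by (simp add: csqrt_square)
      finally show ?case using elim(2) by (simp add: s_def)
    qed
  qed
  ultimately show ?thesis by blast
qed

text \<open>The symmetric difference \<open>F e - F (- e)\<close> is \<open>2 * w 0 / e\<close> plus
  the difference of two difference quotients of \<open>w\<close> with the common limit
  \<open>w'\<close>, so no constant term survives. The condition on \<open>E\<close> makes
  \<open>E e - 1\<close> negligible against \<open>e\<close>.\<close>

lemma symmetric_difference_finite_part:
  fixes F :: "real \<Rightarrow> complex" and E :: "real \<Rightarrow> real"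
  assumes w: "(w has_vector_derivative w') (at 0)" and F: "\<forall>\<^sub>F t in at 0. F t = w t / of_real t"
    and E: "(E has_real_derivative 0) (at 0)" "E 0 = 1"
  shows "((\<lambda>e. of_real (E e) * (F e - F (- e)) - (2 * w 0) / of_real e) \<longlongrightarrow> 0) (at_right 0)"
proof -
  have q: "((\<lambda>t. (w t - w 0) / of_real t) \<longlongrightarrow> w') (at 0)"
    using has_vector_derivative_quotient_tendsto[OF w] by simp
  have q1: "((\<lambda>t. (w t - w 0) / of_real t) \<longlongrightarrow> w') (at_right 0)"
    by (rule filterlim_mono[OF q order_refl]) (simp add: at_le)
  have neg: "filterlim (\<lambda>t::real. - t) (at 0) (at_right 0)"
    by (auto simp: filterlim_at eventually_at_filter intro!: tendsto_eq_intros)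
  have q2: "((\<lambda>t. (w (- t) - w 0) / of_real (- t)) \<longlongrightarrow> w') (at_right 0)"
    by (rule filterlim_compose[OF q neg])
  have "isCont w 0" by (rule has_vector_derivative_continuous[OF w])
  then have wl: "(w \<longlongrightarrow> w 0) (at 0)" by (simp add: isCont_def)
  have w1: "(w \<longlongrightarrow> w 0) (at_right 0)" by (rule filterlim_mono[OF wl order_refl]) (simp add: at_le)
  have w2: "((\<lambda>t. w (- t)) \<longlongrightarrow> w 0) (at_right 0)" by (rule filterlim_compose[OF wl neg])
  have "((\<lambda>e. (E e - 1) / e) \<longlongrightarrow> 0) (at 0)" using E by (simp add: has_field_derivative_iff)
  then have E1: "((\<lambda>e. (E e - 1) / e) \<longlongrightarrow> 0) (at_right 0)"
    by (rule filterlim_mono[OF _ order_refl]) (simp add: at_le)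
  have "((\<lambda>e. of_real ((E e - 1) / e) * (w e + w (- e)) + ((w e - w 0) / of_real e - (w (- e) - w 0) / of_real (- e)))
      \<longlongrightarrow> of_real 0 * (w 0 + w 0) + (w' - w')) (at_right 0)"
    by (intro tendsto_intros E1 w1 w2 q1 q2)
  moreover have "\<forall>\<^sub>F e in at_right 0. of_real ((E e - 1) / e) * (w e + w (- e)) + ((w e - w 0) / of_real e - (w (- e) - w 0) / of_real (- e))
      = of_real (E e) * (F e - F (- e)) - (2 * w 0) / of_real e"
  proof -
    have "\<forall>\<^sub>F e in at_right 0. F e = w e / of_real e"
      using F by (rule filter_leD[rotated]) (simp add: at_le)
    moreover have "\<forall>\<^sub>F e in at_right 0. F (- e) = w (- e) / of_real (- e)"
      using neg F by (auto simp: filterlim_iff)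
    moreover have "\<forall>\<^sub>F e::real in at_right 0. e > 0" by (simp add: eventually_at_filter)
    ultimately show ?thesis
    proof eventually_elim
      case (elim e)
      show ?case unfolding elim(1,2) using elim(3) by (simp add: field_simps)
    qed
  qed
  ultimately show ?thesis using Lim_transform_eventually by fastforce
qed

text \<open>Integration by parts with \<open>H = - E * F\<close> turns \<open>f\<close> into
  \<open>k\<close>, whose singularity at 0 is cancelled by the factor \<open>t\<close>. The boundary
  terms at \<open>e\<close> and \<open>- e\<close> contribute a multiple of \<open>1 / e\<close> and
  a null term. The conditions on \<open>R\<close> and \<open>C\<close> bound \<open>g'\<close>,
  which makes \<open>f\<close> integrable away from 0; these constants do not enter the
  value.\<close>

lemma has_finite_part_oscillatory:
  fixes g :: "real \<Rightarrow> complex"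
  assumes z: "z < 0" and W: "W holomorphic_on UNIV" and g: "g C1_differentiable_on UNIV"
    and Wg: "\<And>t. W (g t) = W (g 0) + of_real (t\<^sup>2)"
    and g0: "vector_derivative g (at 0) \<noteq> 0"
    and \<kappa>: "\<kappa> > 0" and dist: "\<And>t. \<kappa> * min 1 \<bar>t\<bar> \<le> norm (exp (g t) - P)"
    and c: "c \<noteq> 0"
    and R: "\<And>y. \<bar>Re y\<bar> \<ge> R \<Longrightarrow> norm (deriv W y) \<ge> 1" "\<And>y. \<bar>Re y\<bar> \<le> R \<Longrightarrow> Re (W y) \<le> C"
  shows "has_finite_part (oscillatory_integrand W z P c g)
     (LINT t|lborel. of_real (2 * t / z * exp (t\<^sup>2 / z)) / (c * (exp (g t) - P)))"
proof -
  define g' where "g' = (\<lambda>t. vector_derivative g (at t))"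
  have dg: "(g has_vector_derivative g' t) (at t)" for t
    using g unfolding C1_differentiable_on_eq g'_def by (simp add: vector_derivative_works)
  have cg': "continuous_on UNIV g'" using g unfolding C1_differentiable_on_eq g'_def by simp
  have cg: "continuous_on UNIV g"
    using dg by (meson continuous_at_imp_continuous_on has_vector_derivative_continuous)
  have isg: "isCont g t" "isCont g' t" for t
    using cg cg' by (auto simp: continuous_on_eq_continuous_at)
  have WD: "deriv W (g t) * g' t = of_real (2 * t)" for t
    by (rule deriv_along_square_param[OF W dg Wg])
  define E where "E = (\<lambda>t::real. exp (t\<^sup>2 / z))"
  define F where "F = (\<lambda>t. 1 / (c * (exp (g t) - P)))"
  define k where "k = (\<lambda>t. of_real (2 * t / z * E t) * F t)"
  define f where "f = oscillatory_integrand W z P c g"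
  have dE: "(E has_real_derivative 2 * t / z * E t) (at t)" for t
    unfolding E_def using z by (auto intro!: derivative_eq_intros)
  have dN: "((\<lambda>s. c * (exp (g s) - P)) has_vector_derivative c * (exp (g t) * g' t)) (at t)" for t
  proof -
    have "((\<lambda>y. c * (exp y - P)) has_field_derivative c * exp (g t)) (at (g t))"
      by (auto intro!: derivative_eq_intros)
    from field_vector_diff_chain_at[OF dg this] show ?thesis by (simp add: o_def mult_ac)
  qed
  have f: "f t = of_real (E t) * (c * (exp (g t) * g' t) / (c * (exp (g t) - P))\<^sup>2)" for t
    using Wg[of t] unfolding f_def oscillatory_integrand_def E_def
    by (simp add: vector_derivative_at[OF dN] exp_of_real[symmetric])
  have ne: "exp (g t) \<noteq> P" if "t \<noteq> 0" for t
  proof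
    assume "exp (g t) = P"
    then have "\<kappa> * min 1 \<bar>t\<bar> \<le> 0" using dist[of t] by simp
    moreover have "\<kappa> * min 1 \<bar>t\<bar> > 0" using \<kappa> that by simp
    ultimately show False by simp
  qed
  have gm [measurable]: "g \<in> borel_measurable borel" "g' \<in> borel_measurable borel"
    using cg cg' by (auto intro: borel_measurable_continuous_onI)
  have expm [measurable]: "(\<lambda>t. exp (g t)) \<in> borel_measurable borel"
    by (intro borel_measurable_continuous_onI continuous_intros cg)
  have Em [measurable]: "E \<in> borel_measurable borel" unfolding E_def by measurable
  have Fm [measurable]: "F \<in> borel_measurable borel" unfolding F_def by measurable
  have km [measurable]: "k \<in> borel_measurable borel" unfolding k_def by measurable
  have fm [measurable]: "f \<in> borel_measurable borel" unfolding f by measurable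
  have isE: "isCont (\<lambda>t. complex_of_real (E t)) t" for t
    unfolding E_def by (intro continuous_intros) (use z in auto)
  have isF: "isCont F t" if "t \<noteq> 0" for t
    unfolding F_def using ne[OF that] c by (intro continuous_intros isg) auto
  have isf: "isCont f t" if "t \<noteq> 0" for t
    unfolding f using ne[OF that] c by (intro continuous_intros isg isE) auto
  have isk: "isCont k t" if "t \<noteq> 0" for t
    unfolding k_def of_real_mult using z by (intro continuous_intros isF that isE) auto
  have gauss: "integrable lborel (\<lambda>t. B * ((1 + \<bar>t\<bar>) * E t))" for B
    unfolding E_def by (rule integrable_linear_gauss[OF z])
  have Fb: "norm (F t) \<le> 1 / (norm c * \<kappa> * min 1 \<bar>t\<bar>)" if "t \<noteq> 0" for t
  proof -
    have "norm c * \<kappa> * min 1 \<bar>t\<bar> \<le> norm (c * (exp (g t) - P))"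
      using mult_left_mono[OF dist[of t], of "norm c"] by (simp add: norm_mult mult_ac)
    moreover have "0 < norm c * \<kappa> * min 1 \<bar>t\<bar>" using c \<kappa> that by simp
    ultimately show ?thesis unfolding F_def by (simp add: norm_divide frac_le)
  qed
  have kb: "norm (k t) \<le> 2 / (\<bar>z\<bar> * (norm c * \<kappa>)) * ((1 + \<bar>t\<bar>) * E t)" for t
    using oscillatory_bound[OF \<kappa> _ order_refl dist, of c t z] c by (simp add: k_def F_def E_def)
  have kI: "integrable lborel k"
    by (rule Bochner_Integration.integrable_bound[OF gauss[of "2 / (\<bar>z\<bar> * (norm c * \<kappa>))"]])
       (simp, rule AE_I2, rule order_trans[OF kb], simp only: real_norm_def abs_ge_self)
  have g'b: "\<exists>M\<ge>0. \<forall>t. norm (g' t) \<le> M * (1 + \<bar>t\<bar>)"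
  proof -
    \<comment> \<open>Beyond \<open>T\<close> the value \<open>Re (W (g t))\<close> exceeds
      \<open>C\<close>, hence \<open>\<bar>Re (g t)\<bar> > R\<close> and the derivative of
      \<open>W\<close> has norm at least 1; then \<open>WD\<close> bounds the velocity.\<close>
    define T where "T = sqrt (\<bar>C - Re (W (g 0))\<bar> + 1)"
    have big: "norm (g' t) \<le> 2 * \<bar>t\<bar>" if "\<bar>t\<bar> \<ge> T" for t
    proof -
      have "T\<^sup>2 \<le> t\<^sup>2" using that power_mono[of T "\<bar>t\<bar>" 2] by (simp add: T_def)
      then have "Re (W (g t)) > C" using Wg[of t] by (simp add: T_def)
      then have "norm (deriv W (g t)) \<ge> 1" using R[of "g t"] by linarith
      then have "norm (g' t) \<le> norm (deriv W (g t)) * norm (g' t)"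
        using mult_right_mono[of 1 "norm (deriv W (g t))" "norm (g' t)"] by simp
      also have "\<dots> = norm (of_real (2 * t) :: complex)" using WD[of t] by (simp only: norm_mult[symmetric])
      finally show ?thesis by simp
    qed
    have "compact (g' ` {- T..T})"
      by (intro compact_continuous_image continuous_on_subset[OF cg']) auto
    then have "bounded (g' ` {- T..T})" by (rule compact_imp_bounded)
    then obtain M where "\<forall>x\<in>g' ` {- T..T}. norm x \<le> M" unfolding bounded_iff ..
    then have M: "norm (g' t) \<le> M" if "t \<in> {- T..T}" for t using that by simp
    have ex: "(\<bar>M\<bar> + 2) * (1 + \<bar>t\<bar>) = \<bar>M\<bar> + \<bar>M\<bar> * \<bar>t\<bar> + 2 + 2 * \<bar>t\<bar>" "0 \<le> \<bar>M\<bar> * \<bar>t\<bar>" for t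
      by (simp_all add: algebra_simps)
    have "norm (g' t) \<le> (\<bar>M\<bar> + 2) * (1 + \<bar>t\<bar>)" for t
    proof (cases "\<bar>t\<bar> \<ge> T")
      case True
      then show ?thesis using big[OF True] ex[of t] by linarith
    next
      case False
      then have "t \<in> {- T..T}" by (simp add: abs_le_iff not_le abs_less_iff)
      from M[OF this] have "norm (g' t) \<le> \<bar>M\<bar>" by simp
      also have "\<dots> \<le> (\<bar>M\<bar> + 2) * (1 + \<bar>t\<bar>)" using ex[of t] by linarith
      finally show ?thesis .
    qed
    then show ?thesis by (intro exI[of _ "\<bar>M\<bar> + 2"]) auto
  qed
  then obtain M where M: "M \<ge> 0" "\<And>t. norm (g' t) \<le> M * (1 + \<bar>t\<bar>)" by blast
  have fI: "set_integrable lborel {t. e \<le> \<bar>t\<bar>} f" if e: "e > 0" for e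
  proof -
    define \<delta> where "\<delta> = \<kappa> * min 1 e"
    have \<delta>: "\<delta> > 0" using \<kappa> e by (simp add: \<delta>_def)
    \<comment> \<open>The numerator \<open>exp (g t)\<close> may be unbounded, but it is at most
      \<open>D + norm P\<close> in norm and is divided by \<open>D^2\<close>, with
      \<open>D >= \<delta>\<close>.\<close>
    define B where "B = (1 / \<delta> + norm P / \<delta>\<^sup>2) / norm c * M"
    have B: "norm (f t) \<le> B * ((1 + \<bar>t\<bar>) * E t)" if t: "e \<le> \<bar>t\<bar>" for t
    proof -
      define D where "D = norm (exp (g t) - P)"
      have "\<delta> \<le> \<kappa> * min 1 \<bar>t\<bar>" unfolding \<delta>_def using t \<kappa> by (intro mult_left_mono) auto
      then have D: "D \<ge> \<delta>" using dist[of t] by (simp add: D_def)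
      have "norm (exp (g t)) \<le> D + norm P" unfolding D_def using norm_triangle_ineq[of "exp (g t) - P" P] by simp
      then have "norm (exp (g t)) / D\<^sup>2 \<le> (D + norm P) / D\<^sup>2" by (intro divide_right_mono) auto
      also have "\<dots> = 1 / D + norm P / D\<^sup>2" using D \<delta> by (simp add: add_divide_distrib power2_eq_square)
      also have "\<dots> \<le> 1 / \<delta> + norm P / \<delta>\<^sup>2"
        using D \<delta> by (intro add_mono divide_left_mono power_mono mult_pos_pos zero_less_power) auto
      finally have q: "norm (exp (g t)) / D\<^sup>2 \<le> 1 / \<delta> + norm P / \<delta>\<^sup>2" .
      have "norm (f t) = E t * (norm (exp (g t)) / D\<^sup>2 / norm c * norm (g' t))"
        unfolding f D_def by (simp add: norm_mult norm_divide norm_power power_mult_distrib E_def power2_eq_square del: norm_exp_eq_Re)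
      also have "\<dots> \<le> E t * ((1 / \<delta> + norm P / \<delta>\<^sup>2) / norm c * (M * (1 + \<bar>t\<bar>)))"
        using M \<delta> by (intro mult_left_mono mult_mono divide_right_mono q) (auto simp: E_def)
      also have "\<dots> = B * ((1 + \<bar>t\<bar>) * E t)" by (simp add: B_def)
      finally show ?thesis .
    qed
    show ?thesis unfolding set_integrable_def
    proof (rule Bochner_Integration.integrable_bound[OF gauss[of B]])
      show "(\<lambda>t. indicat_real {t. e \<le> \<bar>t\<bar>} t *\<^sub>R f t) \<in> borel_measurable lborel" by measurable
      have "0 \<le> B * ((1 + \<bar>t\<bar>) * E t)" for t
        using M \<delta> by (auto simp: B_def E_def intro!: mult_nonneg_nonneg divide_nonneg_nonneg add_nonneg_nonneg)
      then show "AE t in lborel. norm (indicat_real {t. e \<le> \<bar>t\<bar>} t *\<^sub>R f t) \<le> norm (B * ((1 + \<bar>t\<bar>) * E t))"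
        using B by (auto simp: indicator_def)
    qed
  qed
  have kI': "set_integrable lborel S k" if "S \<in> sets borel" for S
    unfolding set_integrable_def using kI that by (simp add: integrable_mult_indicator)
  define H where "H = (\<lambda>t. - (of_real (E t) * F t))"
  have dH: "(H has_vector_derivative f t - k t) (at t)" if "t \<noteq> 0" for t
  proof -
    have "c * (exp (g t) - P) \<noteq> 0" using ne[OF that] c by simp
    moreover have "((\<lambda>t. complex_of_real (E t)) has_vector_derivative of_real (2 * t / z * E t)) (at t)"
      using dE[of t] unfolding has_real_derivative_iff_has_vector_derivative
      by (rule bounded_linear.has_vector_derivative[OF bounded_linear_of_real])
    moreover have "(F has_vector_derivative - (c * (exp (g t) * g' t)) / (c * (exp (g t) - P))\<^sup>2) (at t)"
    proof -
      have "((\<lambda>u. 1 / u) has_field_derivative - 1 / (c * (exp (g t) - P))\<^sup>2) (at (c * (exp (g t) - P)))"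
        using ne[OF that] c by (auto intro!: derivative_eq_intros simp: power2_eq_square)
      from field_vector_diff_chain_at[OF dN this] show ?thesis unfolding F_def o_def by simp
    qed
    ultimately have "(H has_vector_derivative - (of_real (E t) * (- (c * (exp (g t) * g' t)) / (c * (exp (g t) - P))\<^sup>2)
        + of_real (2 * t / z * E t) * F t)) (at t)"
      unfolding H_def by (intro has_vector_derivative_minus has_vector_derivative_mult)
    then show ?thesis unfolding f k_def by simp
  qed
  have Hb: "norm (H t) \<le> E t / (norm c * \<kappa>)" if "\<bar>t\<bar> \<ge> 1" for t
    using mult_left_mono[OF Fb[of t], of "E t"] that by (auto simp: H_def norm_mult E_def)
  have Hinf: "(H \<longlongrightarrow> 0) at_top" "(H \<longlongrightarrow> 0) at_bot"
  proof -
    have "(E \<longlongrightarrow> 0) at_top" unfolding E_def using z by real_asymp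
    moreover have "(E \<longlongrightarrow> 0) at_bot" unfolding E_def using z by real_asymp
    ultimately have E0: "((\<lambda>t. E t / (norm c * \<kappa>)) \<longlongrightarrow> 0) at_top" "((\<lambda>t. E t / (norm c * \<kappa>)) \<longlongrightarrow> 0) at_bot"
      by (simp_all add: tendsto_divide_zero)
    show "(H \<longlongrightarrow> 0) at_top"
      by (rule Lim_null_comparison[OF _ E0(1)], rule eventually_mono[OF eventually_ge_at_top[of 1]]) (auto intro: Hb)
    show "(H \<longlongrightarrow> 0) at_bot"
      by (rule Lim_null_comparison[OF _ E0(2)], rule eventually_mono[OF eventually_le_at_bot[of "-1"]]) (auto intro: Hb)
  qed
  have parts: "(LINT t:{t. e \<le> \<bar>t\<bar>}|lborel. f t) = of_real (E e) * (F e - F (- e)) + (LINT t:{t. e \<le> \<bar>t\<bar>}|lborel. k t)"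
    if e: "e > 0" for e
  proof -
    have fkI: "set_integrable lborel {t. e \<le> \<bar>t\<bar>} (\<lambda>t. f t - k t)"
      by (intro set_integral_diff fI e kI') measurable
    have S: "{e<..} \<subseteq> {t. e \<le> \<bar>t\<bar>}" "{..< - e} \<subseteq> {t. e \<le> \<bar>t\<bar>}" by auto
    have "isCont H e" "isCont H (- e)"
      by (rule has_vector_derivative_continuous[OF dH], use e in simp)+
    then have "(H \<longlongrightarrow> H e) (at e)" "(H \<longlongrightarrow> H (- e)) (at (- e))" by (simp_all only: isCont_def)
    then have HC: "(H \<longlongrightarrow> H e) (at_right e)" "(H \<longlongrightarrow> H (- e)) (at_left (- e))"
      by (auto elim!: filterlim_mono[OF _ order_refl] intro!: at_le)
    have "(LBINT x=ereal e..\<infinity>. f x - k x) = 0 - H e"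
    proof (rule interval_integral_FTC_integrable)
      show "set_integrable lborel (einterval (ereal e) \<infinity>) (\<lambda>t. f t - k t)"
        by (rule set_integrable_subset[OF fkI]) (use S in \<open>auto simp: einterval_def\<close>)
      show "((H \<circ> real_of_ereal) \<longlongrightarrow> H e) (at_right (ereal e))"
        using HC(1) by (simp only: ereal_tendsto_simps)
      show "((H \<circ> real_of_ereal) \<longlongrightarrow> 0) (at_left \<infinity>)"
        using Hinf(1) by (simp add: ereal_tendsto_simps)
    qed (use e dH isf isk in \<open>auto intro!: continuous_diff\<close>)
    then have I1: "(LINT x:{e<..}|lborel. f x - k x) = - H e"
      by (simp add: interval_integral_to_infinity_eq)
    have "(LBINT x=-\<infinity>..ereal (- e). f x - k x) = H (- e) - 0"
    proof (rule interval_integral_FTC_integrable)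
      show "set_integrable lborel (einterval (-\<infinity>) (ereal (- e))) (\<lambda>t. f t - k t)"
        by (rule set_integrable_subset[OF fkI]) (use S in \<open>auto simp: einterval_def\<close>)
      show "((H \<circ> real_of_ereal) \<longlongrightarrow> H (- e)) (at_left (ereal (- e)))"
        using HC(2) by (simp only: ereal_tendsto_simps)
      show "((H \<circ> real_of_ereal) \<longlongrightarrow> 0) (at_right (-\<infinity>))"
        using Hinf(2) by (simp add: ereal_tendsto_simps)
    qed (use e dH isf isk in \<open>auto intro!: continuous_diff\<close>)
    then have I2: "(LINT x:{..< - e}|lborel. f x - k x) = H (- e)"
      by (simp add: interval_lebesgue_integral_def einterval_def lessThan_def)
    have "(LINT x:{t. e \<le> \<bar>t\<bar>}|lborel. f x - k x) = (LINT x:{e<..} \<union> {..< - e}|lborel. f x - k x)"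
    proof (rule set_integral_cong_set)
      have "x \<in> {e<..} \<union> {..< - e} \<longleftrightarrow> x \<in> {t. e \<le> \<bar>t\<bar>}" if "x \<notin> {e, - e}" for x
        using that by auto
      then show "AE x in lborel. (x \<in> {e<..} \<union> {..< - e}) = (x \<in> {t. e \<le> \<bar>t\<bar>})"
        by (intro AE_I'[of "{e, - e}"] finite_imp_null_set_lborel) auto
    qed (auto simp: set_borel_measurable_def)
    also have "\<dots> = - H e + H (- e)"
      using e S by (subst set_integral_Un)
        (auto simp: I1 I2 intro!: set_integrable_subset[OF fkI])
    also have "\<dots> = of_real (E e) * (F e - F (- e))"
      by (simp add: H_def E_def algebra_simps)
    finally show ?thesis
      using set_integral_diff(2)[OF fI[OF e] kI'[of "{t. e \<le> \<bar>t\<bar>}"]] by (simp add: algebra_simps)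
  qed
  have klim: "((\<lambda>e. LINT t:{t. e \<le> \<bar>t\<bar>}|lborel. k t) \<longlongrightarrow> (LINT t|lborel. k t)) (at_right 0)"
    unfolding tendsto_at_iff_sequentially
  proof (intro allI impI)
    fix X :: "nat \<Rightarrow> real" assume X: "\<forall>i. X i \<in> {0<..} - {0}" "X \<longlonglongrightarrow> 0"
    have "(\<lambda>i. LINT t|lborel. indicat_real {t. X i \<le> \<bar>t\<bar>} t *\<^sub>R k t) \<longlonglongrightarrow> (LINT t|lborel. k t)"
    proof (rule integral_dominated_convergence[where w = "\<lambda>t. norm (k t)"])
      show "AE t in lborel. (\<lambda>i. indicat_real {t. X i \<le> \<bar>t\<bar>} t *\<^sub>R k t) \<longlonglongrightarrow> k t"
      proof (rule AE_I2)
        fix t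
        show "(\<lambda>i. indicat_real {t. X i \<le> \<bar>t\<bar>} t *\<^sub>R k t) \<longlonglongrightarrow> k t"
        proof (cases "t = 0")
          case False
          then have "\<forall>\<^sub>F i in sequentially. X i < \<bar>t\<bar>" using X(2) by (intro order_tendstoD) auto
          then have "\<forall>\<^sub>F i in sequentially. indicat_real {t. X i \<le> \<bar>t\<bar>} t *\<^sub>R k t = k t"
            by eventually_elim auto
          then show ?thesis by (rule tendsto_eventually)
        qed (simp add: k_def)
      qed
    qed (use kI in \<open>auto simp: indicator_def\<close>)
    then show "((\<lambda>e. LINT t:{t. e \<le> \<bar>t\<bar>}|lborel. k t) \<circ> X) \<longlonglongrightarrow> (LINT t|lborel. k t)"
      by (simp add: o_def set_lebesgue_integral_def)
  qed
  \<comment> \<open>Without a pole on the curve the boundary terms cancel in the limit and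
    \<open>A = 0\<close>; with a pole, \<open>F\<close> is a differentiable function divided by
    \<open>t\<close>.\<close>
  have "\<exists>A. ((\<lambda>e. of_real (E e) * (F e - F (- e)) - A / of_real e) \<longlongrightarrow> 0) (at_right 0)"
  proof (cases "P = exp (g 0)")
    case False
    then have cF: "isCont F 0" unfolding F_def using c by (intro continuous_intros isg) auto
    have neg: "filterlim (\<lambda>t::real. - t) (at 0) (at_right 0)"
      by (auto simp: filterlim_at eventually_at_filter intro!: tendsto_eq_intros)
    have F1: "(F \<longlongrightarrow> F 0) (at 0)" using cF by (simp add: isCont_def)
    have E1: "((\<lambda>t. complex_of_real (E t)) \<longlongrightarrow> of_real (E 0)) (at 0)" using isE[of 0] by (simp add: isCont_def)
    have "((\<lambda>e. of_real (E e) * (F e - F (- e))) \<longlongrightarrow> of_real (E 0) * (F 0 - F 0)) (at_right 0)"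
      by (intro tendsto_intros filterlim_compose[OF F1 neg] filterlim_mono[OF F1 order_refl] filterlim_mono[OF E1 order_refl]) (auto simp: at_le)
    then show ?thesis by (intro exI[of _ 0]) simp
  next
    case True
    have "deriv W (g 0) = 0" using WD[of 0] g0 by (simp add: g'_def)
    then obtain w w' where w: "(w has_vector_derivative w') (at 0)"
       "\<forall>\<^sub>F t in at 0. 1 / (exp (g t) - exp (g 0)) = w t / of_real t"
      using pole_quotient_differentiable[OF W _ dg _ Wg] g0 ne unfolding True g'_def by blast
    have "((\<lambda>t. w t / c) has_vector_derivative w' / c) (at 0)"
      by (rule bounded_linear.has_vector_derivative[OF bounded_linear_divide w(1)])
    moreover have Fq: "F t = 1 / (exp (g t) - exp (g 0)) / c" for t
      by (simp add: F_def True mult.commute)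
    have "\<forall>\<^sub>F t in at 0. F t = (w t / c) / of_real t"
      using w(2)
    proof eventually_elim
      case (elim t)
      show ?case unfolding Fq elim by (simp add: mult.commute)
    qed
    moreover note this
    moreover have "(E has_real_derivative 0) (at 0)" using dE[of 0] by simp
    moreover have "E 0 = 1" by (simp add: E_def)
    ultimately show ?thesis using symmetric_difference_finite_part by blast
  qed
  then obtain A where A: "((\<lambda>e. of_real (E e) * (F e - F (- e)) - A / of_real e) \<longlongrightarrow> 0) (at_right 0)" by blast
  have "((\<lambda>e. (of_real (E e) * (F e - F (- e)) - A / of_real e) + (LINT t:{t. e \<le> \<bar>t\<bar>}|lborel. k t)) \<longlongrightarrow> 0 + (LINT t|lborel. k t)) (at_right 0)"
    by (intro tendsto_add A klim)
  moreover have "\<forall>\<^sub>F e in at_right 0. (of_real (E e) * (F e - F (- e)) - A / of_real e) + (LINT t:{t. e \<le> \<bar>t\<bar>}|lborel. k t)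
      = (LINT t:{t. e \<le> \<bar>t\<bar>}|lborel. f t) - A / of_real e"
    using parts by (auto simp: eventually_at_filter)
  ultimately have "((\<lambda>e. (LINT t:{t. e \<le> \<bar>t\<bar>}|lborel. f t) - A / of_real e) \<longlongrightarrow> (LINT t|lborel. k t)) (at_right 0)"
    using Lim_transform_eventually by fastforce
  moreover have "(LINT t|lborel. k t) = (LINT t|lborel. of_real (2 * t / z * exp (t\<^sup>2 / z)) / (c * (exp (g t) - P)))"
    unfolding k_def F_def E_def by simp
  ultimately show ?thesis
    unfolding has_finite_part_def using fI unfolding f_def by auto
qed

subsection \<open>The large radius limit\<close>

text \<open>Towards the right \<open>exp (m * y)\<close> dominates the derivative, towards the left
  the monomial with coefficient \<open>q (- int n)\<close>, which is nonzero. The constants depend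
  on \<open>q\<close> and may degenerate as \<open>q\<close> tends to 0.\<close>

lemma W_T_proper:
  assumes m: "m > 0" and n: "n > 0" and q: "q (- int n) \<noteq> 0"
  shows "\<exists>R C. (\<forall>y. \<bar>Re y\<bar> \<ge> R \<longrightarrow> norm (deriv (W_T m n p q) y) \<ge> 1) \<and>
     (\<forall>y. \<bar>Re y\<bar> \<le> R \<longrightarrow> Re (W_T m n p q y) \<le> C)"
proof -
  let ?A = "\<lambda>y. \<Sum>l\<in>{1..<m}. q (int l) * (of_nat l * exp (of_nat l * y))"
  let ?B = "\<lambda>y. \<Sum>l\<in>{1..n}. q (- int l) * (- (of_nat l * exp (- (of_nat l * y))))"
  let ?B' = "\<lambda>y. \<Sum>l\<in>{1..<n}. q (- int l) * (- (of_nat l * exp (- (of_nat l * y))))"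
  define a where "a = (\<lambda>l. norm (q (int l)))"
  define b where "b = (\<lambda>l. norm (q (- int l)))"
  have bn: "b n > 0" using q by (simp add: b_def)
  \<comment> \<open>The sum of the absolute values of all coefficients of the derivative; times
    \<open>D\<close> it bounds everything except the dominant term.\<close>
  define S where "S = real m + (\<Sum>l\<in>{1..<m}. a l * real l) + (\<Sum>l\<in>{1..n}. b l * real l) + \<bar>p\<bar>"
  have S: "S \<ge> 0" unfolding S_def a_def b_def by (intro add_nonneg_nonneg sum_nonneg) auto
  define R where "R = S + 1 + (S + 1) / b n"
  have R: "R \<ge> S + 1" "R \<ge> (S + 1) / b n" "R \<ge> 0" using S bn by (auto simp: R_def)
  have dW: "deriv (W_T m n p q) y = of_nat m * exp (of_nat m * y) + ?A y + ?B y + of_real p" for y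
    by (rule DERIV_imp_deriv[OF has_field_derivative_W_T])
  have ne: "norm (exp (of_nat l * y)) = exp (real l * Re y)" "norm (exp (- (of_nat l * y))) = exp (- (real l * Re y))" for l y
    by simp_all
  have 1: "norm (deriv (W_T m n p q) y) \<ge> 1" if y: "\<bar>Re y\<bar> \<ge> R" for y
  proof (cases "Re y \<ge> 0")
    case True
    define x where "x = Re y"
    have x: "x \<ge> S + 1" "x \<ge> 0" using y True R by (auto simp: x_def)
    \<comment> \<open>The growth allowed to the subordinate terms. The dominant one exceeds it by
      the factor \<open>exp x >= 1 + x\<close>.\<close>
    define D where "D = exp (real (m - 1) * x)"
    have D: "D \<ge> 1" using x by (simp add: D_def)
    have "norm (?A y + ?B y + of_real p)
      \<le> (\<Sum>l\<in>{1..<m}. a l * real l * D) + (\<Sum>l\<in>{1..n}. b l * real l * D) + \<bar>p\<bar> * D"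
    proof (intro norm_triangle_mono sum_norm_le)
      fix l assume l: "l \<in> {1..<m}"
      have "real l * x \<le> real (m - 1) * x" using l x by (intro mult_right_mono) auto
      then have "exp (real l * x) \<le> D" by (simp add: D_def)
      then show "norm (q (int l) * (of_nat l * exp (of_nat l * y))) \<le> a l * real l * D"
        unfolding norm_mult ne x_def[symmetric] a_def by (simp add: mult_left_mono mult.assoc)
    next
      fix l assume l: "l \<in> {1..n}"
      have "exp (- (real l * x)) \<le> 1" using x by simp
      then have "exp (- (real l * x)) \<le> D" using D by linarith
      then show "norm (q (- int l) * (- (of_nat l * exp (- (of_nat l * y))))) \<le> b l * real l * D"
        unfolding norm_mult norm_minus_cancel ne x_def[symmetric] b_def by (simp add: mult_left_mono mult.assoc)
    next
      show "norm (complex_of_real p) \<le> \<bar>p\<bar> * D" using D by (simp add: mult_le_cancel_left1)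
    qed
    also have "\<dots> \<le> S * D" unfolding S_def using D by (simp add: sum_distrib_right distrib_right)
    finally have small: "norm (?A y + ?B y + of_real p) \<le> S * D" .
    have "real m * x = real (m - 1) * x + x" using m by (simp add: of_nat_diff algebra_simps)
    then have "norm (of_nat m * exp (of_nat m * y)) = real m * (D * exp x)"
      unfolding norm_mult ne x_def[symmetric] by (simp add: D_def exp_add)
    also have "\<dots> \<ge> 1 * (D * (1 + x))"
      using m D x exp_ge_add_one_self[of x] by (intro mult_mono) auto
    finally have "norm (of_nat m * exp (of_nat m * y)) \<ge> D * (1 + x)" by simp
    moreover have "D * (1 + x) \<ge> D * (S + 2)" using D x by (intro mult_left_mono) auto
    ultimately have "norm (of_nat m * exp (of_nat m * y)) - S * D \<ge> 1"
      using D by (simp add: algebra_simps)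
    then show ?thesis
      using small norm_diff_ineq[of "of_nat m * exp (of_nat m * y)" "?A y + ?B y + of_real p"]
      unfolding dW by (simp add: add.assoc)
  next
    case False
    define x where "x = - Re y"
    have x: "x \<ge> (S + 1) / b n" "x \<ge> 0" using y False R by (auto simp: x_def)
    define D where "D = exp (real (n - 1) * x)"
    have D: "D \<ge> 1" using x by (simp add: D_def)
    have split: "(\<Sum>l\<in>{1..n}. f l) = f n + (\<Sum>l\<in>{1..<n}. f l)" for f :: "nat \<Rightarrow> complex"
    proof -
      have "{1..n} = insert n {1..<n}" using n by auto
      then show ?thesis by simp
    qed
    have "norm (of_nat m * exp (of_nat m * y) + ?A y + ?B' y + of_real p)
      \<le> real m * D + (\<Sum>l\<in>{1..<m}. a l * real l * D) + (\<Sum>l\<in>{1..<n}. b l * real l * D) + \<bar>p\<bar> * D"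
    proof (intro norm_triangle_mono sum_norm_le)
      have dec: "exp (real l * Re y) \<le> D" for l
      proof -
        have "real l * Re y \<le> 0" using x by (simp add: x_def mult_nonneg_nonpos)
        then have "exp (real l * Re y) \<le> 1" by simp
        then show ?thesis using D by linarith
      qed
      show "norm (of_nat m * exp (of_nat m * y)) \<le> real m * D"
        unfolding norm_mult ne using dec[of m] by (simp add: mult_left_mono)
      fix l
      show "norm (q (int l) * (of_nat l * exp (of_nat l * y))) \<le> a l * real l * D"
        unfolding norm_mult ne a_def using dec[of l] by (simp add: mult_left_mono mult.assoc)
    next
      fix l assume l: "l \<in> {1..<n}"
      have "real l * x \<le> real (n - 1) * x" using l x by (intro mult_right_mono) auto
      then have "exp (real l * x) \<le> D" by (simp add: D_def)
      moreover have "- (real l * Re y) = real l * x" by (simp add: x_def)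
      ultimately show "norm (q (- int l) * (- (of_nat l * exp (- (of_nat l * y))))) \<le> b l * real l * D"
        unfolding norm_mult norm_minus_cancel ne b_def by (simp add: mult_left_mono mult.assoc)
    next
      show "norm (complex_of_real p) \<le> \<bar>p\<bar> * D" using D by (simp add: mult_le_cancel_left1)
    qed
    also have "\<dots> \<le> S * D"
    proof -
      have "(\<Sum>l\<in>{1..<n}. b l * real l) \<le> (\<Sum>l\<in>{1..n}. b l * real l)"
        by (intro sum_mono2) (auto simp: b_def)
      then have "real m + (\<Sum>l\<in>{1..<m}. a l * real l) + (\<Sum>l\<in>{1..<n}. b l * real l) + \<bar>p\<bar> \<le> S" by (simp add: S_def)
      from mult_right_mono[OF this, of D] D show ?thesis by (simp add: sum_distrib_right distrib_right)
    qed
    finally have small: "norm (of_nat m * exp (of_nat m * y) + ?A y + ?B' y + of_real p) \<le> S * D" .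
    let ?t = "q (- int n) * (- (of_nat n * exp (- (of_nat n * y))))"
    have "- (real n * Re y) = real (n - 1) * x + x" using n by (simp add: x_def of_nat_diff algebra_simps)
    then have "norm ?t = b n * (real n * (D * exp x))"
      unfolding norm_mult norm_minus_cancel ne by (simp add: D_def exp_add b_def)
    moreover have "x \<le> exp x" using exp_ge_add_one_self[of x] by linarith
    then have "b n * (real n * (D * exp x)) \<ge> b n * (1 * (D * x))"
      using n D x bn by (intro mult_left_mono mult_mono) auto
    ultimately have "norm ?t \<ge> D * (b n * x)" by (simp add: mult_ac)
    moreover have "b n * x \<ge> S + 1" using x(1) bn by (simp add: field_simps)
    then have "D * (b n * x) \<ge> D * (S + 1)" using D by (intro mult_left_mono) auto
    ultimately have "norm ?t - S * D \<ge> 1" using D by (simp add: algebra_simps)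
    moreover have "deriv (W_T m n p q) y = ?t + (of_nat m * exp (of_nat m * y) + ?A y + ?B' y + of_real p)"
      unfolding dW split by (simp add: algebra_simps)
    ultimately show ?thesis
      using small norm_diff_ineq[of ?t "of_nat m * exp (of_nat m * y) + ?A y + ?B' y + of_real p"]
      by simp
  qed
  define C where "C = exp (real m * R) + (\<Sum>l\<in>{1..<m}. a l * exp (real l * R)) + (\<Sum>l\<in>{1..n}. b l * exp (real l * R)) + \<bar>p\<bar> * R"
  have 2: "Re (W_T m n p q y) \<le> C" if y: "\<bar>Re y\<bar> \<le> R" for y
  proof -
    have e: "norm (exp (of_nat l * y)) \<le> exp (real l * R)" "norm (exp (- (of_nat l * y))) \<le> exp (real l * R)" for l
    proof -
      have "real l * Re y \<le> real l * R" using y by (intro mult_left_mono) auto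
      moreover have "real l * (- Re y) \<le> real l * R" using y by (intro mult_left_mono) auto
      ultimately show "norm (exp (of_nat l * y)) \<le> exp (real l * R)" "norm (exp (- (of_nat l * y))) \<le> exp (real l * R)"
        unfolding ne by simp_all
    qed
    have "Re (W_T m n p q y) \<le> norm (W_T m n p q y - of_real p * y) + p * Re y"
      using complex_Re_le_cmod[of "W_T m n p q y - of_real p * y"] by simp
    also have "W_T m n p q y - of_real p * y = exp (of_nat m * y) + (\<Sum>l\<in>{1..<m}. q (int l) * exp (of_nat l * y))
     + (\<Sum>l\<in>{1..n}. q (- int l) * exp (- (of_nat l * y)))" by (simp add: W_T_exp)
    also have "norm \<dots> \<le> exp (real m * R) + (\<Sum>l\<in>{1..<m}. a l * exp (real l * R)) + (\<Sum>l\<in>{1..n}. b l * exp (real l * R))"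
    proof (intro norm_triangle_mono sum_norm_le)
      show "norm (exp (of_nat m * y)) \<le> exp (real m * R)" by (rule e)
      show "norm (q (int l) * exp (of_nat l * y)) \<le> a l * exp (real l * R)" for l
        unfolding norm_mult a_def by (intro mult_left_mono e) auto
      show "norm (q (- int l) * exp (- (of_nat l * y))) \<le> b l * exp (real l * R)" for l
        unfolding norm_mult b_def by (intro mult_left_mono e) auto
    qed
    also have "p * Re y \<le> \<bar>p\<bar> * R"
      using mult_left_mono[OF y, of "\<bar>p\<bar>"] abs_ge_self[of "p * Re y"] by (simp add: abs_mult)
    finally show ?thesis unfolding C_def by simp
  qed
  show ?thesis using 1 2 by blast
qed

section \<open>Evaluation of the limit\<close>

lemma W_T_periodic:
  "W_T m n p q (y + of_int k * (2 * of_real pi * \<i>)) = W_T m n p q y + of_real p * (of_int k * (2 * of_real pi * \<i>))"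
proof -
  have "exp (y + of_int k * (2 * of_real pi * \<i>)) = exp y"
    unfolding exp_eq by (intro exI[of _ k]) simp
  then show ?thesis unfolding W_T_def by (simp add: algebra_simps)
qed

text \<open>The substitution \<open>w = \<mu> * exp (m * (\<xi> - x0))\<close> produces Euler's
  integral. Differentiating \<open>V (\<xi> t) = V x0 + t^2\<close> gives
  \<open>2 * t = p * (1 - U) * \<xi>' t\<close> with \<open>U = w / \<mu>\<close>, so the
  denominator cancels, and \<open>t^2 / z\<close> equals \<open>\<mu> - w\<close> plus a multiple of
  \<open>\<xi> - x0\<close>, which supplies the power \<open>\<mu>\<close> of
  \<open>w\<close>.\<close>

lemma thimble_gauss_Gamma_integral:
  fixes m :: nat and p z x0 :: real and V \<xi> \<xi>' :: "real \<Rightarrow> real"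
  assumes m: "m > 0" and p: "p < 0" and z: "z < 0"
    and V_def: "V = (\<lambda>x. exp (real m * x) + p * x)" and x0: "exp (real m * x0) = - p / real m"
    and \<xi>: "\<xi> 0 = x0" "bij \<xi>" "\<And>t. (\<xi> has_real_derivative \<xi>' t) (at t)" "\<And>t. \<xi>' t > 0" "\<And>t. V (\<xi> t) = V x0 + t\<^sup>2"
    and \<mu>_def: "\<mu> = p / (real m * z)"
  shows "has_bochner_integral lborel
     (\<lambda>t. 2 * t / z * exp (t\<^sup>2 / z) * exp (\<xi> t - x0) ^ h / (1 - exp (\<xi> t - x0) ^ m))
     (exp \<mu> * (Gamma (\<mu> + real h / real m) * \<mu> powr (1 - \<mu> - real h / real m)))"
proof -
  define a where "a = \<mu> + real h / real m"
  have \<mu>: "\<mu> > 0" using m p z by (simp add: \<mu>_def divide_neg_neg mult_pos_neg)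
  have a: "a > 0" unfolding a_def using \<mu> by (simp add: add_pos_nonneg)
  define w where "w = (\<lambda>t. \<mu> * exp (real m * (\<xi> t - x0)))"
  define w' where "w' = (\<lambda>t. real m * \<xi>' t * w t)"
  have w0: "w t > 0" for t using \<mu> by (simp add: w_def)
  have dw: "(w has_real_derivative w' t) (at t within S)" for t S
  proof (rule has_field_derivative_at_within)
    show "(w has_real_derivative w' t) (at t)"
      unfolding w_def w'_def by (auto intro!: derivative_eq_intros \<xi>(3))
  qed
  have w'0: "w' t > 0" for t using w0 \<xi>(4) m by (simp add: w'_def)
  have injw: "inj w"
  proof (rule injI)
    fix s t assume "w s = w t"
    then have "\<xi> s = \<xi> t" using \<mu> m by (simp add: w_def)
    then show "s = t" using \<xi>(2) by (simp add: bij_is_inj inj_eq)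
  qed
  have ranw: "range w = {0<..}"
  proof (intro equalityI subsetI)
    fix u :: real assume "u \<in> {0<..}"
    then have u: "u > 0" by simp
    obtain t where t: "\<xi> t = x0 + ln (u / \<mu>) / real m" using \<xi>(2) by (metis bij_pointE)
    have "w t = u" unfolding w_def t using u \<mu> m by simp
    then show "u \<in> range w" by auto
  qed (use w0 in auto)
  define f where "f = (\<lambda>u::real. u powr (a - 1) / exp u)"
  have f: "(f has_integral Gamma a) {0<..}"
  proof -
    have "(f has_integral Gamma a) {0..}" unfolding f_def by (rule Gamma_integral_real[OF a])
    then have "((\<lambda>t. if t \<in> {0<..} then f t else 0) has_integral Gamma a) {0..}"
      by (rule has_integral_spike[of "{0}", rotated 2]) auto
    then show ?thesis by (subst (asm) has_integral_restrict) auto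
  qed
  have "f absolutely_integrable_on {0<..}"
    by (rule nonnegative_absolutely_integrable_1) (use f in \<open>auto simp: f_def integrable_on_def\<close>)
  then have "(\<lambda>t. \<bar>w' t\<bar> * f (w t)) absolutely_integrable_on UNIV \<and> integral UNIV (\<lambda>t. \<bar>w' t\<bar> * f (w t)) = Gamma a"
    using has_absolute_integral_change_of_variables_1'[of UNIV w w' f "Gamma a"] dw injw f ranw
    by (auto simp: integral_unique)
  moreover have eq: "\<bar>w' t\<bar> * f (w t) = real m * \<xi>' t * (w t powr a * exp (- w t))" for t
    using w0[of t] w'0[of t] powr_add[of "w t" "a - 1" 1] by (simp add: w'_def f_def exp_minus field_simps)
  ultimately have I: "set_integrable lebesgue UNIV (\<lambda>t. real m * \<xi>' t * (w t powr a * exp (- w t)))"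
    "integral UNIV (\<lambda>t. real m * \<xi>' t * (w t powr a * exp (- w t))) = Gamma a" by auto
  let ?G = "\<lambda>t. 2 * t / z * exp (t\<^sup>2 / z) * exp (\<xi> t - x0) ^ h / (1 - exp (\<xi> t - x0) ^ m)"
  let ?K = "exp \<mu> * \<mu> powr (1 - a)"
  have pointwise: "?G t = ?K * (real m * \<xi>' t * (w t powr a * exp (- w t)))" if t: "t \<noteq> 0" for t
  proof -
    define d where "d = \<xi> t - x0"
    define U where "U = exp (real m * d)"
    have d: "d \<noteq> 0" using t \<xi>(1,2) by (auto simp: d_def bij_def inj_def)
    have U1: "U \<noteq> 1" using d m by (simp add: U_def)
    have Um: "exp d ^ m = U" by (simp add: U_def exp_of_nat_mult)
    have eU: "exp (real m * \<xi> t) = - p / real m * U"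
      unfolding U_def d_def x0[symmetric] by (simp add: right_diff_distrib flip: exp_add)
    have "(V has_real_derivative real m * exp (real m * \<xi> t) + p) (at (\<xi> t))"
      unfolding V_def by (auto intro!: derivative_eq_intros)
    from DERIV_chain2[OF this \<xi>(3)] have "((\<lambda>t. V x0 + t\<^sup>2) has_real_derivative (real m * exp (real m * \<xi> t) + p) * \<xi>' t) (at t)"
      unfolding \<xi>(5) .
    moreover have "((\<lambda>t. V x0 + t\<^sup>2) has_real_derivative 2 * t) (at t)" by (auto intro!: derivative_eq_intros)
    ultimately have "2 * t = (real m * exp (real m * \<xi> t) + p) * \<xi>' t" by (rule DERIV_unique[rotated])
    then have t2: "2 * t = p * (1 - U) * \<xi>' t" unfolding eU using m by (simp add: algebra_simps)
    have "t\<^sup>2 = V (\<xi> t) - V x0" using \<xi>(5)[of t] by simp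
    also have "\<dots> = - p / real m * U + p * d + p / real m" unfolding V_def eU x0 by (simp add: d_def algebra_simps)
    finally have "t\<^sup>2 / z = \<mu> * (1 - U) + real m * \<mu> * d" unfolding \<mu>_def using m z by (simp add: field_simps)
    moreover have "w t = \<mu> * U" by (simp add: w_def U_def d_def)
    ultimately have "t\<^sup>2 / z = \<mu> + - w t + real m * \<mu> * d" by (simp add: algebra_simps)
    then have e: "exp (t\<^sup>2 / z) = exp \<mu> * exp (- w t) * exp (real m * \<mu> * d)" by (simp only: exp_add)
    have wa: "w t powr a = \<mu> powr a * (exp (real m * \<mu> * d) * exp d ^ h)"
    proof -
      have "w t powr a = \<mu> powr a * exp (real m * d) powr a"
        unfolding w_def d_def[symmetric] using \<mu> by (simp add: powr_mult)
      also have "exp (real m * d) powr a = exp (real m * \<mu> * d + real h * d)"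
        using m by (simp add: powr_def a_def field_simps)
      finally show ?thesis by (simp add: exp_add exp_of_nat_mult)
    qed
    have "?G t = 2 * t / z * exp (t\<^sup>2 / z) * exp d ^ h / (1 - U)" unfolding d_def[symmetric] Um ..
    also have "\<dots> = p / z * \<xi>' t * exp (t\<^sup>2 / z) * exp d ^ h" unfolding t2 using U1 by simp
    also have "p / z = real m * \<mu>" using m z by (simp add: \<mu>_def)
    also have "\<mu> = \<mu> powr (1 - a) * \<mu> powr a" using \<mu> by (simp flip: powr_add)
    finally show ?thesis unfolding e wa by (simp add: mult_ac)
  qed
  have c\<xi>: "continuous_on UNIV \<xi>" using \<xi>(3) by (auto intro: DERIV_continuous_on has_field_derivative_at_within)
  have [measurable]: "\<xi> \<in> borel_measurable borel" by (rule borel_measurable_continuous_onI[OF c\<xi>])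
  have Gm: "?G \<in> borel_measurable lborel" by measurable
  have ae: "AE t in lebesgue. ?K * (real m * \<xi>' t * (w t powr a * exp (- w t))) = ?G t"
  proof (rule AE_completion)
    show "AE t in lborel. ?K * (real m * \<xi>' t * (w t powr a * exp (- w t))) = ?G t"
      by (rule AE_I'[of "{0}"]) (use pointwise in force)+
  qed
  \<comment> \<open>The change of variables yields a statement for the completed measure; Borel
    measurability of the integrand brings it back to \<open>lborel\<close>.\<close>
  have "has_bochner_integral lebesgue (\<lambda>t. real m * \<xi>' t * (w t powr a * exp (- w t))) (Gamma a)"
    using I(1) set_lebesgue_integral_eq_integral(2)[OF I(1)] I(2)
    by (simp add: has_bochner_integral_iff set_integrable_def set_lebesgue_integral_def)
  from has_bochner_integral_mult_right[OF this, of ?K]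
  have K: "has_bochner_integral lebesgue (\<lambda>t. ?K * (real m * \<xi>' t * (w t powr a * exp (- w t)))) (?K * Gamma a)" by simp
  have "has_bochner_integral lebesgue ?G (?K * Gamma a)"
    by (rule has_bochner_integralI_AE[OF K _ ae]) (use Gm in \<open>simp add: measurable_completion\<close>)
  then have "has_bochner_integral lborel ?G (?K * Gamma a)"
    using Gm by (simp add: has_bochner_integral_iff integrable_completion integral_completion)
  then show ?thesis by (simp add: a_def diff_diff_eq mult_ac)
qed

text \<open>Relative to the pole of index \<open>\<alpha>\<close> the ray of index
  \<open>\<beta>\<close> consists of the points \<open>u * v\<close> with \<open>u > 0\<close> and
  \<open>v\<close> an \<open>m\<close>-th root of unity, so \<open>(u * v) ^ m = u ^ m\<close> and
  the common denominator no longer involves the indices. Each term of the geometric sum is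
  integrable on its own, since the factor \<open>t\<close> cancels the zero of
  \<open>1 - u ^ m\<close>. The powers \<open>v ^ h\<close> are the powers of \<open>omega\<close>
  in \<open>P1\<close>.\<close>

lemma limit_integral_value:
  fixes m \<alpha> \<beta> :: nat and p z x0 \<tau> :: real and V \<xi> \<xi>' :: "real \<Rightarrow> real"
  assumes m: "m > 0" and p: "p < 0" and z: "z < 0"
    and V_def: "V = (\<lambda>x. exp (real m * x) + p * x)" and x0_def: "x0 = ln (root m (- p / real m))"
    and \<tau>_def: "\<tau> = 2 * pi * real \<beta> / real m"
    and \<xi>: "\<xi> 0 = x0" "bij \<xi>" "\<And>t. (\<xi> has_real_derivative \<xi>' t) (at t)" "\<And>t. \<xi>' t > 0" "\<And>t. V (\<xi> t) = V x0 + t\<^sup>2"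
    and \<mu>_def: "\<mu> = p / (real m * z)"
    and c_def: "c = - of_real (sqrt (- real m * p)) / limit_crit m p \<alpha>"
  shows "of_real (sqrt (- 2 * pi * z)) *
     (LINT t|lborel. of_real (2 * t / z * exp (t\<^sup>2 / z)) / (c * (exp (Complex (\<xi> t) \<tau>) - limit_crit m p \<alpha>))) = P1 m \<mu> \<alpha> \<beta>"
proof -
  have \<mu>: "\<mu> > 0" using m p z by (simp add: \<mu>_def divide_neg_neg mult_pos_neg)
  define v where "v = cis (2 * pi * (real \<beta> - real \<alpha>) / real m)"
  define s where "s = sqrt (- real m * p)"
  have s: "s > 0" using m p by (simp add: s_def mult_pos_neg)
  have rp: "root m (- p / real m) > 0" using m p by (simp add: divide_neg_pos)
  have x0: "exp (real m * x0) = - p / real m"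
    using critical_log_real_part[OF m p, of \<beta>] by (simp add: critical_log_def x0_def)
  have vm: "v ^ m = 1"
  proof -
    have "real m * (2 * pi * (real \<beta> - real \<alpha>) / real m) = 2 * pi * real_of_int (int \<beta> - int \<alpha>)"
      using m by simp
    then have "v ^ m = cis (2 * pi * real_of_int (int \<beta> - int \<alpha>))"
      unfolding v_def Complex.DeMoivre by (simp only:)
    then show ?thesis by (simp only: cis_multiple_2pi Ints_of_int)
  qed
  have om: "omega m \<alpha> \<beta> powi (- int h) = v ^ h" for h
    unfolding omega_def v_def by (simp add: power_int_minus Complex.DeMoivre cis_inverse) (simp add: algebra_simps diff_divide_distrib)
  define G where "G = (\<lambda>h t. 2 * t / z * exp (t\<^sup>2 / z) * exp (\<xi> t - x0) ^ h / (1 - exp (\<xi> t - x0) ^ m))"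
  define J where "J = (\<lambda>h. exp \<mu> * (Gamma (\<mu> + real h / real m) * \<mu> powr (1 - \<mu> - real h / real m)))"
  have GJ: "has_bochner_integral lborel (G h) (J h)" for h
    unfolding G_def J_def by (rule thimble_gauss_Gamma_integral[OF m p z V_def x0 \<xi> \<mu>_def])
  let ?k = "\<lambda>t. complex_of_real (2 * t / z * exp (t\<^sup>2 / z)) / (c * (exp (Complex (\<xi> t) \<tau>) - limit_crit m p \<alpha>))"
  have k: "?k t = (\<Sum>h<m. v ^ h / of_real s * of_real (G h t))" if t: "t \<noteq> 0" for t
  proof -
    define u where "u = complex_of_real (exp (\<xi> t - x0))"
    have "\<xi> t \<noteq> x0" using t \<xi>(1,2) by (auto simp: bij_def inj_def)
    then have "exp (\<xi> t - x0) ^ m \<noteq> 1" using m by (simp flip: exp_of_nat_mult)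
    then have um: "u ^ m \<noteq> 1" unfolding u_def by (metis of_real_eq_1_iff of_real_power)
    have lc: "limit_crit m p \<alpha> = of_real (exp x0) * cis (2 * pi * real \<alpha> / real m)"
      using rp by (simp add: limit_crit_def x0_def)
    have "exp (Complex (\<xi> t) \<tau>) = of_real (exp (\<xi> t)) * cis \<tau>" by (subst exp_eq_polar) simp
    also have "\<dots> = limit_crit m p \<alpha> * (u * v)"
    proof -
      have "cis (2 * pi * real \<alpha> / real m) * v = cis \<tau>" 
      proof -
        have "2 * pi * real \<alpha> / real m + 2 * pi * (real \<beta> - real \<alpha>) / real m = \<tau>"
          unfolding \<tau>_def by (simp add: algebra_simps flip: add_divide_distrib)
        then show ?thesis unfolding v_def cis_mult by (simp only:)
      qed
      moreover have "of_real (exp x0) * u = complex_of_real (exp (\<xi> t))" by (simp add: u_def flip: of_real_mult exp_add)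
      ultimately show ?thesis unfolding lc by (metis mult.assoc mult.left_commute)
    qed
    finally have "c * (exp (Complex (\<xi> t) \<tau>) - limit_crit m p \<alpha>) = of_real s * (1 - u * v)"
      unfolding c_def s_def[symmetric] using limit_crit_nonzero[OF m p, of \<alpha>] by (simp add: field_simps)
    moreover have "1 / (1 - u * v) = (\<Sum>h<m. (u * v) ^ h) / (1 - u ^ m)"
    proof -
      have "1 - u ^ m = (1 - u * v) * (\<Sum>h<m. (u * v) ^ h)"
        using one_diff_power_eq[of "u * v" m] by (simp add: power_mult_distrib vm)
      moreover from this have "1 - u * v \<noteq> 0" using um by auto
      ultimately show ?thesis using um by (simp add: field_simps)
    qed
    ultimately have "?k t = of_real (2 * t / z * exp (t\<^sup>2 / z)) / of_real s * ((\<Sum>h<m. (u * v) ^ h) / (1 - u ^ m))"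
      by (metis divide_divide_eq_left mult.right_neutral times_divide_eq_right)
    also have "\<dots> = (\<Sum>h<m. v ^ h / of_real s * of_real (G h t))"
      unfolding G_def sum_divide_distrib sum_distrib_left
      by (intro sum.cong refl) (simp add: u_def power_mult_distrib mult_ac)
    finally show ?thesis .
  qed
  have "has_bochner_integral lborel (\<lambda>t. \<Sum>h<m. v ^ h / of_real s * of_real (G h t)) (\<Sum>h<m. v ^ h / of_real s * of_real (J h))"
    by (intro has_bochner_integral_sum has_bochner_integral_mult_right has_bochner_integral_of_real GJ)
  then have L: "(LINT t|lborel. (\<Sum>h<m. v ^ h / of_real s * of_real (G h t))) = (\<Sum>h<m. v ^ h / of_real s * of_real (J h))"
    by (rule has_bochner_integral_integral_eq)
  have c\<xi>: "continuous_on UNIV \<xi>" using \<xi>(3) by (auto intro: DERIV_continuous_on has_field_derivative_at_within)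
  have [measurable]: "\<xi> \<in> borel_measurable borel" by (rule borel_measurable_continuous_onI[OF c\<xi>])
  have ex: "(\<lambda>t. exp (Complex (\<xi> t) \<tau>)) = (\<lambda>t. complex_of_real (exp (\<xi> t)) * cis \<tau>)"
    by (rule ext) (subst exp_eq_polar, simp)
  have [measurable]: "(\<lambda>t. exp (Complex (\<xi> t) \<tau>)) \<in> borel_measurable borel" unfolding ex by measurable
  have "(LINT t|lborel. ?k t) = (LINT t|lborel. (\<Sum>h<m. v ^ h / of_real s * of_real (G h t)))"
  proof (rule integral_cong_AE)
    show "?k \<in> borel_measurable lborel" by measurable
    show "(\<lambda>t. \<Sum>h<m. v ^ h / of_real s * of_real (G h t)) \<in> borel_measurable lborel" unfolding G_def by measurable
    show "AE t in lborel. ?k t = (\<Sum>h<m. v ^ h / of_real s * of_real (G h t))"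
      by (rule AE_I'[of "{0}"]) (use k in force)+
  qed
  also note L
  finally have I: "(LINT t|lborel. ?k t) = (\<Sum>h<m. v ^ h / of_real s * of_real (J h))" .
  \<comment> \<open>The constants of \<open>R_tilde\<close> and of \<open>c\<close> combine to the
    prefactor of \<open>P1\<close>; its exponential is already contained in
    \<open>J\<close>.\<close>
  have q: "sqrt (- 2 * pi * z) / s = sqrt (2 * pi) / (real m * sqrt \<mu>)"
  proof -
    have "sqrt (- 2 * pi * z) / s = sqrt ((- 2 * pi * z) / (- real m * p))" by (simp only: s_def real_sqrt_divide)
    also have "(- 2 * pi * z) / (- real m * p) = (2 * pi) / ((real m)\<^sup>2 * \<mu>)"
      using m p z by (simp add: \<mu>_def field_simps power2_eq_square)
    also have "sqrt \<dots> = sqrt (2 * pi) / (real m * sqrt \<mu>)" by (simp add: real_sqrt_divide real_sqrt_mult)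
    finally show ?thesis .
  qed
  have "of_real (sqrt (- 2 * pi * z)) * (LINT t|lborel. ?k t) = of_real (sqrt (- 2 * pi * z) / s) * (\<Sum>h<m. v ^ h * of_real (J h))"
    unfolding I by (simp add: sum_distrib_left)
  also have "\<dots> = P1 m \<mu> \<alpha> \<beta>"
    unfolding q P1_def om J_def by (simp add: sum_distrib_left mult_ac)
  finally show ?thesis .
qed

text \<open>Passing to sequences makes dominated convergence applicable:
  \<open>thimble_converges\<close> gives pointwise convergence of the integrands, and
  \<open>thimble_pole_distance\<close> the majorant.\<close>

lemma R_tilde_tendsto:
  fixes crit c :: "(int \<Rightarrow> complex) \<Rightarrow> nat \<Rightarrow> complex"
  assumes m: "m > 0" and n: "n > 0" and p: "p < 0" and z: "z < 0" and \<alpha>: "\<alpha> < m" and \<beta>: "\<beta> < m"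
    and crit: "\<And>\<beta>. \<beta> < m \<Longrightarrow> ((\<lambda>q. crit q \<beta>) \<longlongrightarrow> limit_crit m p \<beta>) (at (\<lambda>_. 0) within parameters n)"
    and c: "((\<lambda>q. c q \<alpha>) \<longlongrightarrow> - of_real (sqrt (- real m * p)) / limit_crit m p \<alpha>) (at (\<lambda>_. 0) within parameters n)"
  shows "((\<lambda>q. R_tilde (W_T m n p q) z (crit q \<alpha>) (c q \<alpha>) (crit q \<beta>)) \<longlongrightarrow> P1 m (p / (real m * z)) \<alpha> \<beta>)
     (at (\<lambda>_. 0) within thimble_parameters m n p crit \<beta>)"
  unfolding tendsto_at_iff_sequentially
proof (intro allI impI)
  let ?TP = "thimble_parameters m n p crit \<beta>"
  fix X assume X: "\<forall>i. X i \<in> ?TP - {\<lambda>_. 0}" "X \<longlonglongrightarrow> (\<lambda>_. 0)"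
  have TP: "X i \<in> ?TP" "X i \<in> parameters n" for i using X(1) by (auto simp: thimble_parameters_def)
  have FX: "filterlim X (at (\<lambda>_. 0) within parameters n) sequentially"
    unfolding filterlim_at using X TP by (auto intro!: always_eventually)
  define W where "W = (\<lambda>i. W_T m n p (X i))"
  define Pa Pb cc where "Pa = (\<lambda>i. crit (X i) \<alpha>)" and "Pb = (\<lambda>i. crit (X i) \<beta>)" and "cc = (\<lambda>i. c (X i) \<alpha>)"
  define G where "G = (\<lambda>i. SOME g. thimble_param (W i) (Pb i) g)"
  have tp: "thimble_param (W i) (Pb i) (G i)" for i
  proof -
    have "\<exists>g. thimble_param (W i) (Pb i) g"
      using TP(1)[of i] by (simp add: thimble_parameters_def W_def Pb_def)
    then show ?thesis unfolding G_def by (rule someI_ex)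
  qed
  let ?L = "critical_log m p \<beta>"
  let ?Pa = "limit_crit m p \<alpha>"
  define c0 where "c0 = - of_real (sqrt (- real m * p)) / ?Pa"
  have c0: "c0 \<noteq> 0" using m p limit_crit_nonzero[OF m p, of \<alpha>] by (simp add: c0_def)
  have Pa_lim: "Pa \<longlonglongrightarrow> ?Pa" unfolding Pa_def by (rule filterlim_compose[OF crit[OF \<alpha>] FX])
  have Pb_lim: "Pb \<longlonglongrightarrow> limit_crit m p \<beta>" unfolding Pb_def by (rule filterlim_compose[OF crit[OF \<beta>] FX])
  have cc_lim: "cc \<longlonglongrightarrow> c0" unfolding cc_def c0_def by (rule filterlim_compose[OF c FX])
  have GP: "exp (G i 0) = Pb i" for i using tp[of i] unfolding thimble_param_def by blast
  define y1 where "y1 = (\<lambda>i. ?L + Ln (Pb i / limit_crit m p \<beta>))"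
  have y1: "exp (y1 i) = Pb i" for i
    unfolding y1_def by (rule Ln_quotient_lift[OF m p]) (simp flip: GP)
  have y1_lim: "y1 \<longlonglongrightarrow> ?L"
    unfolding y1_def using tendsto_add[OF tendsto_const tendsto_Ln_quotient[OF m p Pb_lim]] by simp
  have "\<exists>k::int. G i 0 = y1 i + of_real (of_int (2 * k) * pi) * \<i>" for i
    using exp_eq[of "G i 0" "y1 i"] by (simp add: GP y1)
  then obtain k :: "nat \<Rightarrow> int" where k: "\<And>i. G i 0 = y1 i + of_real (of_int (2 * k i) * pi) * \<i>" by metis
  \<comment> \<open>The parametrisation picked by \<open>SOME\<close> may start on any sheet, and
    the sheet may vary with \<open>i\<close>. The translate \<open>H i\<close> starts near
    \<open>critical_log\<close>; the integrand sees only \<open>exp (G i t)\<close> and is not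
    affected.\<close>
  define H where "H = (\<lambda>i t. G i t - of_int (k i) * (2 * of_real pi * \<i>))"
  have GH: "G i t = H i t + of_int (k i) * (2 * of_real pi * \<i>)" for i t by (simp add: H_def)
  have H0: "H i 0 = y1 i" for i by (simp add: H_def k)
  have expH: "exp (H i t) = exp (G i t)" for i t
    unfolding exp_eq by (rule exI[of _ "- k i"]) (simp add: H_def)
  have WG: "W i (G i t) = W i (G i 0) + of_real (t\<^sup>2)" for i t using tp[of i] unfolding thimble_param_def by blast
  have WH: "W i (H i t) = W i (H i 0) + of_real (t\<^sup>2)" for i t
    using WG[of i t] unfolding GH W_def W_T_periodic by simp
  have C1: "G i C1_differentiable_on UNIV" for i using tp[of i] unfolding thimble_param_def by blast
  define g' where "g' = (\<lambda>i. vector_derivative (G i) (at 0))"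
  have g': "Re (g' i) > 0" for i using tp[of i] unfolding thimble_param_def g'_def by blast
  have dG: "(G i has_vector_derivative g' i) (at 0)" for i
    using C1[of i] unfolding C1_differentiable_on_eq g'_def by (simp add: vector_derivative_works)
  have dH: "(H i has_vector_derivative g' i) (at 0)" for i
    unfolding H_def using dG by (auto intro!: derivative_eq_intros)
  have cG: "continuous_on UNIV (G i)" for i
    using C1[of i] unfolding C1_differentiable_on_eq
    by (meson continuous_at_imp_continuous_on differentiable_imp_continuous_within)
  have cH: "continuous_on UNIV (H i)" for i unfolding H_def by (intro continuous_intros cG)
  have hW: "W i holomorphic_on UNIV" for i
    unfolding holomorphic_on_def field_differentiable_def W_def using has_field_derivative_W_T
    by (blast intro: has_field_derivative_at_within)
  have crit1: "deriv (W i) (y1 i) = 0" for i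
    using critical_of_square_param[OF hW dH _ WH] g'[of i] unfolding H0 by force
  have close: "\<forall>\<^sub>F i in sequentially. close_to_W_lim m p A \<epsilon> (W i)" if "\<epsilon> > 0" for A \<epsilon>
    unfolding W_def
    by (rule filterlim_iff[THEN iffD1, rule_format, OF FX eventually_close_to_W_lim[OF that]])
  define V where "V = (\<lambda>x. exp (real m * x) + p * x)"
  define x0 where "x0 = ln (root m (- p / real m))"
  define \<tau> where "\<tau> = 2 * pi * real \<beta> / real m"
  have x0: "exp (real m * x0) = - p / real m"
    using critical_log_real_part[OF m p, of \<beta>] by (simp add: critical_log_def x0_def)
  have "\<exists>\<xi> \<xi>'. \<xi> 0 = x0 \<and> bij \<xi> \<and> (\<forall>t. (\<xi> has_real_derivative \<xi>' t) (at t)) \<and>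
     continuous_on UNIV \<xi>' \<and> (\<forall>t. \<xi>' t > 0) \<and> (\<forall>t. V (\<xi> t) = V x0 + t\<^sup>2)"
  proof (rule convex_square_parametrisation)
    have mp: "real m > 0" using m by simp
    show "(V has_real_derivative real m * exp (real m * x) + p) (at x)" for x
      unfolding V_def by (auto intro!: derivative_eq_intros)
    show "((\<lambda>x. real m * exp (real m * x) + p) has_real_derivative (real m)\<^sup>2 * exp (real m * x)) (at x)" for x
      by (auto intro!: derivative_eq_intros simp: power2_eq_square)
    show "(real m)\<^sup>2 * exp (real m * x) > 0" for x using m by simp
    show "real m * exp (real m * x0) + p = 0" unfolding x0 using m by simp
    show "filterlim V at_top at_top" unfolding V_def using mp p by real_asymp
    show "filterlim V at_top at_bot" unfolding V_def using mp p by real_asymp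
  qed
  then obtain \<xi> \<xi>' where \<xi>: "\<xi> 0 = x0" "bij \<xi>" "\<And>t. (\<xi> has_real_derivative \<xi>' t) (at t)" "\<And>t. \<xi>' t > 0" "\<And>t. V (\<xi> t) = V x0 + t\<^sup>2"
    by blast
  have H_lim: "(\<lambda>i. H i t) \<longlonglongrightarrow> Complex (\<xi> t) \<tau>" for t
  proof (rule tendstoI)
    fix e :: real assume e: "e > 0"
    obtain \<epsilon> A where \<epsilon>: "\<epsilon> > 0" and conv: "\<And>W G G'. close_to_W_lim m p A \<epsilon> W \<Longrightarrow> norm (G 0 - ?L) \<le> \<epsilon> \<Longrightarrow>
        continuous_on UNIV G \<Longrightarrow> (\<forall>t. W (G t) = W (G 0) + of_real (t\<^sup>2)) \<Longrightarrow>
        (G has_vector_derivative G') (at 0) \<Longrightarrow> Re G' > 0 \<Longrightarrow> norm (G t - Complex (\<xi> t) \<tau>) < e"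
      using thimble_converges[OF m p \<tau>_def V_def x0_def \<xi> e, of t] by metis
    have "\<forall>\<^sub>F i in sequentially. norm (y1 i - ?L) < \<epsilon>"
      using y1_lim \<epsilon> by (simp add: tendsto_iff dist_norm)
    with close[OF \<epsilon>, of A] show "\<forall>\<^sub>F i in sequentially. dist (H i t) (Complex (\<xi> t) \<tau>) < e"
    proof eventually_elim
      case (elim i)
      show ?case unfolding dist_norm
        by (rule conv[OF elim(1) _ cH _ dH g']) (use elim(2) H0 WH in auto)
    qed
  qed
  obtain \<epsilon> A \<kappa> where \<epsilon>: "\<epsilon> > 0" and \<kappa>: "\<kappa> > 0" and
    sep: "\<And>W y1 P y t. close_to_W_lim m p A \<epsilon> W \<Longrightarrow> norm (y1 - ?L) \<le> \<epsilon> \<Longrightarrow>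
     deriv W y1 = 0 \<Longrightarrow> norm (P - ?Pa) \<le> \<epsilon> \<Longrightarrow> (\<alpha> = \<beta> \<longrightarrow> P = exp y1) \<Longrightarrow> W y = W y1 + of_real (t\<^sup>2) \<Longrightarrow>
     \<kappa> * min 1 \<bar>t\<bar> \<le> norm (exp y - P)"
    using thimble_pole_distance[OF m p \<alpha> \<beta>] by metis
  have ev_dist: "\<forall>\<^sub>F i in sequentially. \<forall>t. \<kappa> * min 1 \<bar>t\<bar> \<le> norm (exp (G i t) - Pa i)"
  proof -
    have "\<forall>\<^sub>F i in sequentially. norm (y1 i - ?L) < \<epsilon>" "\<forall>\<^sub>F i in sequentially. norm (Pa i - ?Pa) < \<epsilon>"
      using y1_lim Pa_lim \<epsilon> by (simp_all add: tendsto_iff dist_norm)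
    with close[OF \<epsilon>, of A] show ?thesis
    proof eventually_elim
      case (elim i)
      show ?case
      proof
        fix t
        have "W i (H i t) = W i (y1 i) + of_real (t\<^sup>2)" using WH[of i t] by (simp add: H0)
        moreover have "\<alpha> = \<beta> \<longrightarrow> Pa i = exp (y1 i)" by (simp add: y1 Pa_def Pb_def)
        ultimately have "\<kappa> * min 1 \<bar>t\<bar> \<le> norm (exp (H i t) - Pa i)"
          using elim crit1 by (intro sep[of "W i" "y1 i"]) auto
        then show "\<kappa> * min 1 \<bar>t\<bar> \<le> norm (exp (G i t) - Pa i)" by (simp add: expH)
      qed
    qed
  qed
  have ev_c: "\<forall>\<^sub>F i in sequentially. norm c0 / 2 < norm (cc i)"
    using tendsto_norm[OF cc_lim] c0 by (intro order_tendstoD(1)) auto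
  define K where "K = (\<lambda>i t. of_real (2 * t / z * exp (t\<^sup>2 / z)) / (cc i * (exp (G i t) - Pa i)))"
  define K0 where "K0 = (\<lambda>t. of_real (2 * t / z * exp (t\<^sup>2 / z)) / (c0 * (exp (Complex (\<xi> t) \<tau>) - ?Pa)))"
  have R: "\<forall>\<^sub>F i in sequentially. of_real (sqrt (- 2 * pi * z)) * (LINT t|lborel. K i t) = R_tilde (W i) z (Pa i) (cc i) (Pb i)"
    using ev_dist ev_c
  proof eventually_elim
    case (elim i)
    \<comment> \<open>These constants depend on \<open>i\<close>; uniformity is confined to
      \<open>\<kappa>\<close> and the lower bound for \<open>cc\<close>.\<close>
    obtain r C where rC: "\<And>y. \<bar>Re y\<bar> \<ge> r \<Longrightarrow> norm (deriv (W i) y) \<ge> 1" "\<And>y. \<bar>Re y\<bar> \<le> r \<Longrightarrow> Re (W i y) \<le> C"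
      using W_T_proper[OF m n, of "X i" p] TP(2)[of i] unfolding parameters_def W_def by blast
    have "has_finite_part (oscillatory_integrand (W i) z (Pa i) (cc i) (G i)) (LINT t|lborel. K i t)"
      unfolding K_def
      by (rule has_finite_part_oscillatory[OF z hW C1 WG _ \<kappa> _ _ rC])
         (use elim g'[of i] c0 in \<open>auto simp: g'_def\<close>)
    then show ?case unfolding R_tilde_def G_def[symmetric] by (simp add: finite_part_eqI G_def)
  qed
  have Klim: "(\<lambda>i. K i t) \<longlonglongrightarrow> K0 t" for t
  proof (cases "t = 0")
    case False
    have D: "(\<lambda>i. exp (G i t) - Pa i) \<longlonglongrightarrow> exp (Complex (\<xi> t) \<tau>) - ?Pa"
      using tendsto_diff[OF tendsto_exp[OF H_lim[of t]] Pa_lim] by (simp add: expH)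
    have "\<kappa> * min 1 \<bar>t\<bar> \<le> norm (exp (Complex (\<xi> t) \<tau>) - ?Pa)"
      by (rule tendsto_lowerbound[OF tendsto_norm[OF D]]) (use ev_dist in \<open>auto elim: eventually_mono\<close>)
    moreover have "\<kappa> * min 1 \<bar>t\<bar> > 0" using \<kappa> False by simp
    ultimately have "exp (Complex (\<xi> t) \<tau>) - ?Pa \<noteq> 0" by auto
    then show ?thesis unfolding K_def K0_def using c0
      by (intro tendsto_divide tendsto_const tendsto_mult cc_lim D) auto
  qed (simp add: K_def K0_def)
  have "(\<lambda>i. LINT t|lborel. K i t) \<longlonglongrightarrow> (LINT t|lborel. K0 t)"
  proof -
    \<comment> \<open>The bounds hold from some index on, so dominated convergence is applied to the
      shifted sequence.\<close>
    obtain N where N: "\<And>i. i \<ge> N \<Longrightarrow> \<forall>t. \<kappa> * min 1 \<bar>t\<bar> \<le> norm (exp (G i t) - Pa i)" "\<And>i. i \<ge> N \<Longrightarrow> norm c0 / 2 < norm (cc i)"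
      using eventually_conj[OF ev_dist ev_c] unfolding eventually_sequentially by blast
    let ?B = "2 / (\<bar>z\<bar> * (norm c0 / 2 * \<kappa>))"
    have Km [measurable]: "K i \<in> borel_measurable borel" for i
    proof -
      have [measurable]: "(\<lambda>t. exp (G i t)) \<in> borel_measurable borel"
        by (intro borel_measurable_continuous_onI continuous_intros cG)
      show ?thesis unfolding K_def by measurable
    qed
    have K0m [measurable]: "K0 \<in> borel_measurable borel"
      by (rule borel_measurable_LIMSEQ_metric[of K, OF Km Klim])
    have "(\<lambda>i. LINT t|lborel. K (i + N) t) \<longlonglongrightarrow> (LINT t|lborel. K0 t)"
    proof (rule integral_dominated_convergence[where w = "\<lambda>t. ?B * ((1 + \<bar>t\<bar>) * exp (t\<^sup>2 / z))"])
      show "integrable lborel (\<lambda>t. ?B * ((1 + \<bar>t\<bar>) * exp (t\<^sup>2 / z)))"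
        by (rule integrable_linear_gauss[OF z])
      show "AE t in lborel. (\<lambda>i. K (i + N) t) \<longlonglongrightarrow> K0 t"
        using LIMSEQ_ignore_initial_segment[OF Klim] by auto
      show "AE t in lborel. norm (K (i + N) t) \<le> ?B * ((1 + \<bar>t\<bar>) * exp (t\<^sup>2 / z))" for i
      proof (rule AE_I2)
        fix t
        show "norm (K (i + N) t) \<le> ?B * ((1 + \<bar>t\<bar>) * exp (t\<^sup>2 / z))"
          unfolding K_def by (rule oscillatory_bound[OF \<kappa>]) (use N[of "i + N"] c0 in \<open>auto intro: less_imp_le\<close>)
      qed
    qed (use Km K0m in simp_all)
    then show ?thesis by (rule LIMSEQ_offset)
  qed
  then have "(\<lambda>i. of_real (sqrt (- 2 * pi * z)) * (LINT t|lborel. K i t)) \<longlonglongrightarrow> of_real (sqrt (- 2 * pi * z)) * (LINT t|lborel. K0 t)"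
    by (intro tendsto_mult tendsto_const)
  from Lim_transform_eventually[OF this R]
  have "(\<lambda>i. R_tilde (W i) z (Pa i) (cc i) (Pb i)) \<longlonglongrightarrow> of_real (sqrt (- 2 * pi * z)) * (LINT t|lborel. K0 t)" .
  also have "of_real (sqrt (- 2 * pi * z)) * (LINT t|lborel. K0 t) = P1 m (p / (real m * z)) \<alpha> \<beta>"
    unfolding K0_def by (rule limit_integral_value[OF m p z V_def x0_def \<tau>_def \<xi> refl c0_def])
  finally show "((\<lambda>q. R_tilde (W_T m n p q) z (crit q \<alpha>) (c q \<alpha>) (crit q \<beta>)) \<circ> X) \<longlonglongrightarrow> P1 m (p / (real m * z)) \<alpha> \<beta>"
    by (simp add: o_def W_def Pa_def Pb_def cc_def)
qed

theorem proposition3p1: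
  fixes m n :: nat and p z w1 lam mu :: real
    and crit c :: "(int \<Rightarrow> complex) \<Rightarrow> nat \<Rightarrow> complex"
  assumes "m > 0" "n > 0" "coprime m n"
    and "p < 0" "z < 0"
    and crit: "\<forall>\<^sub>F q in at (\<lambda>_. 0) within parameters n.
                 crit q ` {..<m + n} = critical_points (W_T m n p q)"
    and crit_limit: "\<And>\<beta>. \<beta> < m \<Longrightarrow>
                 ((\<lambda>q. crit q \<beta>) \<longlongrightarrow> limit_crit m p \<beta>) (at (\<lambda>_. 0) within parameters n)"
    and c: "\<And>\<alpha>. \<alpha> < m \<Longrightarrow> \<forall>\<^sub>F q in at (\<lambda>_. 0) within parameters n.
                 local_coord_const (W_T m n p q) (crit q \<alpha>) (c q \<alpha>)"
    and c_limit: "\<And>\<alpha>. \<alpha> < m \<Longrightarrow>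
                 ((\<lambda>q. c q \<alpha>) \<longlongrightarrow> - of_real (sqrt (- real m * p)) / limit_crit m p \<alpha>)
                   (at (\<lambda>_. 0) within parameters n)"
    and lam: "lam = w1 / z" and mu: "mu = p / (real m * z)" and "lam = mu"
  shows "\<forall>\<alpha><m. \<forall>\<beta><m.
           at (\<lambda>_. 0) within thimble_parameters m n p crit \<beta> \<noteq> bot \<and>
           ((\<lambda>q. R_tilde (W_T m n p q) z (crit q \<alpha>) (c q \<alpha>) (crit q \<beta>)) \<longlongrightarrow> P1 m lam \<alpha> \<beta>)
             (at (\<lambda>_. 0) within thimble_parameters m n p crit \<beta>) \<and>
           (\<forall>N. (\<lambda>x. P1 m (w1 / x) \<alpha> \<beta> -
                  of_real (2 * pi) *
                  (\<Sum>k<N. fps_nth (P1_series m w1 \<beta> \<alpha>) k * of_real (- x) ^ k))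
               \<in> O[at_left 0](\<lambda>x. of_real x ^ N))"
proof (intro allI impI conjI)
  fix \<alpha> \<beta> assume \<alpha>: "\<alpha> < m" and \<beta>: "\<beta> < m"
  show "at (\<lambda>_. 0) within thimble_parameters m n p crit \<beta> \<noteq> bot"
    using assms(1,2,4) \<beta> crit crit_limit[OF \<beta>] by (rule thimble_parameters_accumulate)
  show "((\<lambda>q. R_tilde (W_T m n p q) z (crit q \<alpha>) (c q \<alpha>) (crit q \<beta>)) \<longlongrightarrow> P1 m lam \<alpha> \<beta>)
             (at (\<lambda>_. 0) within thimble_parameters m n p crit \<beta>)"
    unfolding \<open>lam = mu\<close> mu
    by (rule R_tilde_tendsto[where crit = crit and c = c, OF assms(1,2,4,5) \<alpha> \<beta> crit_limit c_limit[OF \<alpha>]])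
  \<comment> \<open>The identification of \<open>lam\<close> with the positive number
    \<open>mu\<close> forces the weight \<open>w1\<close> to be negative, as the expansion from the
    left requires.\<close>
  have "p / (real m * z) > 0"
    using assms(1,4,5) by (intro divide_neg_neg mult_pos_neg) auto
  then have "w1 / z > 0" using lam mu \<open>lam = mu\<close> by simp
  then have "w1 < 0" using assms(5) by (simp add: zero_less_divide_iff)
  then show "(\<lambda>x. P1 m (w1 / x) \<alpha> \<beta> - of_real (2 * pi) *
                  (\<Sum>k<N. fps_nth (P1_series m w1 \<beta> \<alpha>) k * of_real (- x) ^ k))
               \<in> O[at_left 0](\<lambda>x. of_real x ^ N)" for N
    by (rule P1_asymp[OF assms(1)])
qed

end
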